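(* Let $T_0\in\mathcal{I}_A^a$. Then the orbit $$\mathcal{O}_{T_0}:=\{GT_0: G\in\mathcal{U}_A\}$$ is a $C^\infty$ complemented submanifold of $\mathcal{B}_A(\mathcal{H})$, and the map $$\pi_{T_0}:\mathcal{U}_A\to\mathcal{O}_{T_0},\qquad \pi_{T_0}(G)=GT_0,$$ is a $C^\infty$ submersion. The orbit $\mathcal{O}_{T_0}$ is a union of connected components of $\mathcal{I}_A^a$; consequently $\mathcal{I}_A^a$ is a $C^\infty$ complemented submanifold of $\mathcal{B}_A(\mathcal{H})$.
   Context: $(\mathcal{H},\langle\cdot,\cdot\rangle)$ is a Hilbert space, and $A\in\mathcal{B}(\mathcal{H})$ is a positive contraction with trivial nullspace. The $A$-inner product is $\langle f,g\rangle_A=\langle Af,g\rangle$. An operator $B\in\mathcal{B}(\mathcal{H})$ is $A$-adjointable if there is $B^\sharp\in\mathcal{B}(\mathcal{H})$ (then unique) with $\langle Bf,g\rangle_A=\langle f,B^\sharp g\rangle_A$ for all $f,g\in\mathcal{H}$. $\mathcal{B}_A(\mathcal{H})$ is the algebra of $A$-adjointable operators, an involutive Banach algebra with the norm $|B|=\max\{\|B\|,\|B^\sharp\|\}$ and involution $B\mapsto B^\sharp$. $\mathcal{I}_A^a$ is the set of $A$-adjointable operators $T$ with $T^*AT=A$ (adjointable $A$-isometries; equivalently $T^\sharp T=1$), with the topology induced by $|\cdot|$. $\mathcal{U}_A=\{G\in\mathcal{B}(\mathcal{H}): G\text{ is invertible and }G^*AG=A\}$ is the group of $A$-unitaries; its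 elements are $A$-adjointable with $G^\sharp=G^{-1}$, and it is a $C^\infty$ Banach-Lie group and a $C^\infty$ submanifold of $\mathcal{B}_A(\mathcal{H})$. $\mathcal{U}_A$ acts on $\mathcal{I}_A^a$ by left multiplication. *)

theory Defs
  imports "HOL-Analysis.Analysis"
begin

section \<open>Complex Hilbert spaces\<close>

class complex_hilbert_space = banach +
  fixes scaleC :: "complex \<Rightarrow> 'a \<Rightarrow> 'a"
    and cinner :: "'a \<Rightarrow> 'a \<Rightarrow> complex"
  assumes scaleC_add_right: "scaleC a (x + y) = scaleC a x + scaleC a y"
    and scaleC_add_left: "scaleC (a + b) x = scaleC a x + scaleC b x"
    and scaleC_scaleC: "scaleC a (scaleC b x) = scaleC (a * b) x"
    and scaleC_of_real: "scaleC (complex_of_real r) x = r *\<^sub>R x"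
    and cinner_commute: "cinner x y = cnj (cinner y x)"
    and cinner_add_left: "cinner (x + y) z = cinner x z + cinner y z"
    and cinner_scaleC_left: "cinner (scaleC a x) y = a * cinner x y"
    and cinner_self: "cinner x x = complex_of_real ((norm x)\<^sup>2)"

text \<open>The type \<open>'a \<Rightarrow>\<^sub>L 'a\<close> consists of the bounded \<^emph>\<open>real\<close>-linear maps;
  \<open>B(H)\<close> is the subspace of complex-linear ones, with the same operator norm.\<close>

definition bop :: "('a::complex_hilbert_space \<Rightarrow>\<^sub>L 'a) set" where
  "bop = {B. \<forall>c x. blinfun_apply B (scaleC c x) = scaleC c (blinfun_apply B x)}"

definition hadj :: "('a::complex_hilbert_space \<Rightarrow>\<^sub>L 'a) \<Rightarrow> 'a \<Rightarrow>\<^sub>L 'a" where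
  "hadj B = (THE C. C \<in> bop \<and>
     (\<forall>x y. cinner (blinfun_apply B x) y = cinner x (blinfun_apply C y)))"

definition positive_op :: "('a::complex_hilbert_space \<Rightarrow>\<^sub>L 'a) \<Rightarrow> bool" where
  "positive_op A \<longleftrightarrow> A \<in> bop \<and> (\<forall>x. cinner (blinfun_apply A x) x \<in> \<real>\<^sub>\<ge>\<^sub>0)"

section \<open>Adjointable operators, isometries and unitaries for the \<open>A\<close>-inner product\<close>

definition A_inner :: "('a::complex_hilbert_space \<Rightarrow>\<^sub>L 'a) \<Rightarrow> 'a \<Rightarrow> 'a \<Rightarrow> complex" where
  "A_inner A f g = cinner (blinfun_apply A f) g"

definition is_A_adjoint ::
  "('a::complex_hilbert_space \<Rightarrow>\<^sub>L 'a) \<Rightarrow> ('a \<Rightarrow>\<^sub>L 'a) \<Rightarrow> ('a \<Rightarrow>\<^sub>L 'a) \<Rightarrow> bool" where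
  "is_A_adjoint A B C \<longleftrightarrow> C \<in> bop \<and>
     (\<forall>f g. A_inner A (blinfun_apply B f) g = A_inner A f (blinfun_apply C g))"

definition A_adjointable :: "('a::complex_hilbert_space \<Rightarrow>\<^sub>L 'a) \<Rightarrow> ('a \<Rightarrow>\<^sub>L 'a) set" where
  "A_adjointable A = {B \<in> bop. \<exists>C. is_A_adjoint A B C}"

definition sharp ::
  "('a::complex_hilbert_space \<Rightarrow>\<^sub>L 'a) \<Rightarrow> ('a \<Rightarrow>\<^sub>L 'a) \<Rightarrow> 'a \<Rightarrow>\<^sub>L 'a" where
  "sharp A B = (THE C. is_A_adjoint A B C)"

definition A_norm :: "('a::complex_hilbert_space \<Rightarrow>\<^sub>L 'a) \<Rightarrow> ('a \<Rightarrow>\<^sub>L 'a) \<Rightarrow> real" where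
  "A_norm A B = max (norm B) (norm (sharp A B))"

definition adjointable_A_isometries ::
  "('a::complex_hilbert_space \<Rightarrow>\<^sub>L 'a) \<Rightarrow> ('a \<Rightarrow>\<^sub>L 'a) set" where
  "adjointable_A_isometries A = {T \<in> A_adjointable A. hadj T o\<^sub>L A o\<^sub>L T = A}"

definition A_unitaries :: "('a::complex_hilbert_space \<Rightarrow>\<^sub>L 'a) \<Rightarrow> ('a \<Rightarrow>\<^sub>L 'a) set" where
  "A_unitaries A = {G \<in> bop.
     (\<exists>K \<in> bop. G o\<^sub>L K = id_blinfun \<and> K o\<^sub>L G = id_blinfun) \<and> hadj G o\<^sub>L A o\<^sub>L G = A}"

definition A_orbit ::
  "('a::complex_hilbert_space \<Rightarrow>\<^sub>L 'a) \<Rightarrow> ('a \<Rightarrow>\<^sub>L 'a) \<Rightarrow> ('a \<Rightarrow>\<^sub>L 'a) set" where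
  "A_orbit A T = {G o\<^sub>L T | G. G \<in> A_unitaries A}"

section \<open>Normed spaces on a carrier\<close>

text \<open>The space \<open>B_A(H)\<close> depends on the term \<open>A\<close> and its norm is not the restriction of the
  operator norm, so it cannot be an instance of a type class. A normed space is therefore
  represented by a pair of a linear subspace of some real vector space type and a norm on it.
  Scalars are real throughout: the involution is conjugate-linear, so that
  the groups and manifolds considered here are real ones.\<close>

type_synonym 'v nspace = "'v set \<times> ('v \<Rightarrow> real)"

abbreviation vecs :: "'v nspace \<Rightarrow> 'v set" where "vecs \<equiv> fst"
abbreviation nrm :: "'v nspace \<Rightarrow> 'v \<Rightarrow> real" where "nrm \<equiv> snd"

definition ntop :: "'v::real_vector nspace \<Rightarrow> 'v topology" where
  "ntop X = Metric_space.mtopology (vecs X) (\<lambda>x y. nrm X (x - y))"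

definition real_line :: "real nspace" where
  "real_line = (UNIV, abs)"

definition BA :: "('a::complex_hilbert_space \<Rightarrow>\<^sub>L 'a) \<Rightarrow> ('a \<Rightarrow>\<^sub>L 'a) nspace" where
  "BA A = (A_adjointable A, A_norm A)"

definition closed_subspace :: "'v::real_vector nspace \<Rightarrow> 'v set \<Rightarrow> bool" where
  "closed_subspace X F \<longleftrightarrow> subspace F \<and> F \<subseteq> vecs X \<and> closedin (ntop X) F"

definition complemented_subspace :: "'v::real_vector nspace \<Rightarrow> 'v set \<Rightarrow> bool" where
  "complemented_subspace X F \<longleftrightarrow> closed_subspace X F \<and>
     (\<exists>W. closed_subspace X W \<and> F \<inter> W = {0} \<and> vecs X = {f + w | f w. f \<in> F \<and> w \<in> W})"

section \<open>Smooth maps\<close>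

definition bounded_linear_nspace ::
  "'v::real_vector nspace \<Rightarrow> 'w::real_vector nspace \<Rightarrow> ('v \<Rightarrow> 'w) \<Rightarrow> bool" where
  "bounded_linear_nspace X Y L \<longleftrightarrow>
     (\<forall>x\<in>vecs X. L x \<in> vecs Y) \<and>
     (\<forall>x\<in>vecs X. \<forall>y\<in>vecs X. L (x + y) = L x + L y) \<and>
     (\<forall>x\<in>vecs X. \<forall>c. L (c *\<^sub>R x) = c *\<^sub>R L x) \<and>
     (\<exists>K. \<forall>x\<in>vecs X. nrm Y (L x) \<le> K * nrm X x)"

definition has_fderiv ::
  "'v::real_vector nspace \<Rightarrow> 'w::real_vector nspace \<Rightarrow> 'v set \<Rightarrow> ('v \<Rightarrow> 'w) \<Rightarrow> 'v
     \<Rightarrow> ('v \<Rightarrow> 'w) \<Rightarrow> bool" where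
  "has_fderiv X Y U f x L \<longleftrightarrow> bounded_linear_nspace X Y L \<and>
     (\<forall>e>0. \<exists>d>0. \<forall>y\<in>U. nrm X (y - x) < d \<longrightarrow>
        nrm Y (f y - f x - L (y - x)) \<le> e * nrm X (y - x))"

text \<open>An \<open>n\<close>-linear map is a function on lists of length \<open>n\<close>.\<close>

definition lists_of :: "'v nspace \<Rightarrow> nat \<Rightarrow> 'v list set" where
  "lists_of X n = {vs. set vs \<subseteq> vecs X \<and> length vs = n}"

definition bounded_multilinear_nspace ::
  "'v::real_vector nspace \<Rightarrow> 'w::real_vector nspace \<Rightarrow> nat \<Rightarrow> ('v list \<Rightarrow> 'w) \<Rightarrow> bool" where
  "bounded_multilinear_nspace X Y n L \<longleftrightarrow>
     (\<forall>vs\<in>lists_of X n. L vs \<in> vecs Y) \<and>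
     (\<forall>vs\<in>lists_of X n. \<forall>i<n. \<forall>x\<in>vecs X. \<forall>y\<in>vecs X.
        L (vs[i := x + y]) = L (vs[i := x]) + L (vs[i := y])) \<and>
     (\<forall>vs\<in>lists_of X n. \<forall>i<n. \<forall>x\<in>vecs X. \<forall>c.
        L (vs[i := c *\<^sub>R x]) = c *\<^sub>R L (vs[i := x])) \<and>
     (\<exists>K. \<forall>vs\<in>lists_of X n. nrm Y (L vs) \<le> K * prod_list (map (nrm X) vs))"

text \<open>\<open>C\<^sup>\<infinity>\<close> maps \<open>U \<rightarrow> Y\<close> on an open subset \<open>U\<close> of \<open>X\<close>. Here \<open>D n x\<close> is the \<open>n\<close>-th
  Frechet derivative at \<open>x\<close>, regarded as a bounded \<open>n\<close>-linear map; the last clause says that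
  \<open>D (Suc n)\<close> is the Frechet derivative of \<open>D n\<close>, with respect to the norm of the space of bounded
  \<open>n\<close>-linear maps, under the identification of \<open>L(X, L\<^sup>n(X; Y))\<close> with \<open>L\<^sup>n\<^sup>+\<^sup>1(X; Y)\<close>.\<close>

definition smooth_on ::
  "'v::real_vector nspace \<Rightarrow> 'w::real_vector nspace \<Rightarrow> 'v set \<Rightarrow> ('v \<Rightarrow> 'w) \<Rightarrow> bool" where
  "smooth_on X Y U f \<longleftrightarrow> openin (ntop X) U \<and>
     (\<exists>D :: nat \<Rightarrow> 'v \<Rightarrow> 'v list \<Rightarrow> 'w.
        (\<forall>x\<in>U. D 0 x [] = f x) \<and>
        (\<forall>n. \<forall>x\<in>U. bounded_multilinear_nspace X Y n (D n x)) \<and>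
        (\<forall>n. \<forall>x\<in>U. \<forall>e>0. \<exists>d>0. \<forall>y\<in>U. nrm X (y - x) < d \<longrightarrow>
           (\<forall>vs\<in>lists_of X n.
              nrm Y (D n y vs - D n x vs - D (Suc n) x ((y - x) # vs))
                \<le> e * nrm X (y - x) * prod_list (map (nrm X) vs))))"

section \<open>Submanifolds and submersions\<close>

definition smooth_diffeo ::
  "'v::real_vector nspace \<Rightarrow> 'v set \<Rightarrow> 'v set \<Rightarrow> ('v \<Rightarrow> 'v) \<Rightarrow> bool" where
  "smooth_diffeo X U V \<phi> \<longleftrightarrow> smooth_on X X U \<phi> \<and> bij_betw \<phi> U V \<and>
     smooth_on X X V (inv_into U \<phi>)"

text \<open>The model space \<open>F\<close> may vary with the point.\<close>

definition complemented_submanifold :: "'v::real_vector nspace \<Rightarrow> 'v set \<Rightarrow> bool" where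
  "complemented_submanifold X M \<longleftrightarrow> M \<subseteq> vecs X \<and>
     (\<forall>p\<in>M. \<exists>U V \<phi> F. p \<in> U \<and> smooth_diffeo X U V \<phi> \<and>
        complemented_subspace X F \<and> \<phi> ` (U \<inter> M) = V \<inter> F)"

text \<open>Tangent vectors are the velocities at time 0 of smooth curves in \<open>M\<close>.\<close>

definition tangent_space :: "'v::real_vector nspace \<Rightarrow> 'v set \<Rightarrow> 'v \<Rightarrow> 'v set" where
  "tangent_space X M p = {v \<in> vecs X. \<exists>\<gamma> e. e > 0 \<and> smooth_on real_line X {-e<..<e} \<gamma> \<and>
     \<gamma> ` {-e<..<e} \<subseteq> M \<and> \<gamma> 0 = p \<and>
     has_fderiv real_line X {-e<..<e} \<gamma> 0 (\<lambda>t. t *\<^sub>R v)}"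

text \<open>Near each \<open>p\<close> the map \<open>f\<close> is the restriction of a smooth map \<open>g\<close> between the ambient spaces;
  the tangent map of \<open>f\<close> at \<open>p\<close> is then the restriction to the tangent space of \<open>M\<close> of the derivative
  \<open>L\<close> of \<open>g\<close>, whatever the choice of \<open>g\<close>. This tangent map is required to be onto, with
  complemented kernel.\<close>

definition smooth_submersion ::
  "'v::real_vector nspace \<Rightarrow> 'v set \<Rightarrow> 'w::real_vector nspace \<Rightarrow> 'w set \<Rightarrow> ('v \<Rightarrow> 'w) \<Rightarrow> bool" where
  "smooth_submersion X M Y N f \<longleftrightarrow>
     complemented_submanifold X M \<and> complemented_submanifold Y N \<and> f ` M \<subseteq> N \<and>
     (\<forall>p\<in>M. \<exists>U g L. p \<in> U \<and> smooth_on X Y U g \<and> (\<forall>x\<in>U \<inter> M. g x = f x) \<and>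
        has_fderiv X Y U g p L \<and>
        L ` tangent_space X M p = tangent_space Y N (f p) \<and>
        complemented_subspace (tangent_space X M p, nrm X) {v \<in> tangent_space X M p. L v = 0})"

end

theory Submission
  imports Defs
begin

text \<open>\<open>B\<^sub>A(H)\<close> is an involutive normed algebra in which \<open>1 - a\<close> is invertible for \<open>|a| < 1\<close>; the
  \<open>A\<close>-isometries are the elements \<open>T\<close> with \<open>T\<^sup>\<sharp> T = 1\<close>, and the \<open>A\<close>-unitaries those with also
  \<open>T T\<^sup>\<sharp> = 1\<close>. In such an algebra no inverse function theorem and no functional calculus are needed:
  a noncommutative Cayley transform centred at an isometry \<open>t\<close> is a rational diffeomorphism, with
  rational inverse, which straightens the isometries near \<open>t\<close> to the complemented subspace of all
  \<open>v\<close> with \<open>t\<^sup>\<sharp> v\<close> skew. Every isometry \<open>T\<close> in its domain is \<open>G t\<close> for an explicit unitary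
  \<open>G\<close>, the Cayley transform of a skew \<open>K\<close> with \<open>K (T + t) = T - t\<close>. So orbits are open, hence also
  closed, in the set of isometries, and the tangent space at \<open>t\<close> consists of the \<open>K t\<close> with
  \<open>K\<close> skew, which makes the orbit map a submersion.\<close>

section \<open>Normed spaces on a carrier\<close>

text \<open>The norm \<open>max\<close> of operator and adjoint makes the involution isometric but
  need not satisfy the C*-identity. So neither square roots nor polar decompositions can carry an
  isometry to a nearby one, and even \<open>\<one> + T\<^sup>\<sharp> \<odot> T\<close> may be
  singular. Every invertibility is therefore a defining condition of a chart domain, a Neumann
  series, or witnessed by an explicit inverse. Two isometries share an orbit only if their defects
  \<open>\<one> - T \<odot> T\<^sup>\<sharp>\<close> are conjugate by a unitary; near
  \<open>t\<close> no conjugacy has to be searched for, since \<open>K\<close> is assembled from the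
  chart coordinates of \<open>T\<close>. The definition of smoothness asks for the whole tower of
  derivatives at once, which is why the maps are kept inside an inductive class of rational
  expressions. Completeness enters through one axiom, the invertibility of \<open>\<one> - a\<close>
  for small \<open>a\<close>.\<close>

text \<open>The first two axioms concern the junk values of the norm off the carrier too:
  \<^const>\<open>Metric_space\<close> demands that a metric be nonnegative and symmetric on the whole type.\<close>

locale nspace_on =
  fixes E :: "'w::real_vector nspace"
  assumes nrm_nonneg [simp]: "0 \<le> nrm E x"
    and nrm_minus: "nrm E (- x) = nrm E x"
    and subspace_vecs: "subspace (vecs E)"
    and nrm_triangle: "x \<in> vecs E \<Longrightarrow> y \<in> vecs E \<Longrightarrow> nrm E (x + y) \<le> nrm E x + nrm E y"
    and nrm_scaleR: "x \<in> vecs E \<Longrightarrow> nrm E (c *\<^sub>R x) = \<bar>c\<bar> * nrm E x"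
    and nrm_eq_0: "x \<in> vecs E \<Longrightarrow> nrm E x = 0 \<Longrightarrow> x = 0"
begin

lemma vecs_closed [simp, intro]:
  "0 \<in> vecs E"
  "x \<in> vecs E \<Longrightarrow> y \<in> vecs E \<Longrightarrow> x + y \<in> vecs E"
  "x \<in> vecs E \<Longrightarrow> y \<in> vecs E \<Longrightarrow> x - y \<in> vecs E"
  "x \<in> vecs E \<Longrightarrow> - x \<in> vecs E"
  "x \<in> vecs E \<Longrightarrow> c *\<^sub>R x \<in> vecs E"
  using subspace_vecs
  by (auto simp: subspace_0 subspace_add subspace_diff subspace_neg subspace_scale)

lemma nrm_zero [simp]: "nrm E 0 = 0"
  using nrm_scaleR[of 0 0] by simp

lemma nrm_diff_triangle: "x \<in> vecs E \<Longrightarrow> y \<in> vecs E \<Longrightarrow> nrm E (x - y) \<le> nrm E x + nrm E y"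
  using nrm_triangle[of x "- y"] nrm_minus[of y] by simp

lemma nrm_diff_commute: "nrm E (x - y) = nrm E (y - x)"
  using nrm_minus[of "x - y"] by simp

lemma Metric_space_nrm: "Metric_space (vecs E) (\<lambda>x y. nrm E (x - y))"
proof
  show "nrm E (x - y) = 0 \<longleftrightarrow> x = y" if "x \<in> vecs E" "y \<in> vecs E" for x y
    using that nrm_eq_0[of "x - y"] by auto
  show "nrm E (x - z) \<le> nrm E (x - y) + nrm E (y - z)"
    if "x \<in> vecs E" "y \<in> vecs E" "z \<in> vecs E" for x y z
    using that nrm_triangle[of "x - y" "y - z"] by simp
qed (simp_all add: nrm_diff_commute)

lemma topspace_ntop [simp]: "topspace (ntop E) = vecs E"
  by (simp add: ntop_def Metric_space.topspace_mtopology[OF Metric_space_nrm])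

lemma openin_ntop:
  "openin (ntop E) U \<longleftrightarrow>
     U \<subseteq> vecs E \<and> (\<forall>x\<in>U. \<exists>d>0. \<forall>y\<in>vecs E. nrm E (y - x) < d \<longrightarrow> y \<in> U)"
  unfolding ntop_def Metric_space.openin_mtopology[OF Metric_space_nrm]
  unfolding subset_iff Metric_space.in_mball[OF Metric_space_nrm] nrm_diff_commute[of _ x for x]
  by blast

lemma smooth_on_cong:
  assumes "smooth_on E Y U f" "\<And>x. x \<in> U \<Longrightarrow> f x = g x"
  shows "smooth_on E Y U g"
  using assms unfolding smooth_on_def by simp

text \<open>A submersion needs its kernel complemented inside a tangent space, which is a normed
  space of its own under the ambient norm.\<close>

lemma nspace_on_subspace:
  assumes "subspace F" "F \<subseteq> vecs E"
  shows "nspace_on (F, nrm E)"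
  using assms
  by unfold_locales (auto simp: nrm_minus subset_iff intro: nrm_scaleR nrm_triangle nrm_eq_0)

section \<open>Bounded linear maps and their kernels\<close>

lemma bounded_linear_nspaceE:
  assumes "bounded_linear_nspace E Y L"
  obtains K where "0 \<le> K" "\<And>x. x \<in> vecs E \<Longrightarrow> nrm Y (L x) \<le> K * nrm E x"
proof -
  obtain K where K: "\<forall>x\<in>vecs E. nrm Y (L x) \<le> K * nrm E x"
    using assms unfolding bounded_linear_nspace_def by blast
  have "nrm Y (L x) \<le> \<bar>K\<bar> * nrm E x" if "x \<in> vecs E" for x
    using K that mult_right_mono[of K "\<bar>K\<bar>" "nrm E x"] by force
  then show thesis using that[of "\<bar>K\<bar>"] by simp
qed

lemma closed_subspace_kernel:
  assumes Y: "nspace_on Y" and L: "bounded_linear_nspace E Y L"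
  shows "closed_subspace E {x \<in> vecs E. L x = 0}"
proof -
  interpret Y: nspace_on Y by (rule Y)
  obtain K where K: "0 \<le> K" "\<And>x. x \<in> vecs E \<Longrightarrow> nrm Y (L x) \<le> K * nrm E x"
    using bounded_linear_nspaceE[OF L] by blast
  have add: "L (x + y) = L x + L y" if "x \<in> vecs E" "y \<in> vecs E" for x y
    using L that by (auto simp: bounded_linear_nspace_def)
  have sc: "L (c *\<^sub>R x) = c *\<^sub>R L x" and cl: "L x \<in> vecs Y" if "x \<in> vecs E" for x c
    using L that by (auto simp: bounded_linear_nspace_def)
  have L0: "L 0 = 0" using sc[of 0 0] by simp
  have "openin (ntop E) (vecs E - {x \<in> vecs E. L x = 0})"
    unfolding openin_ntop
  proof (intro conjI ballI)
    fix x assume x: "x \<in> vecs E - {x \<in> vecs E. L x = 0}"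
    then have pos: "0 < nrm Y (L x)"
      using Y.nrm_eq_0[of "L x"] cl[of x] by (auto simp: less_le)
    show "\<exists>d>0. \<forall>y\<in>vecs E. nrm E (y - x) < d \<longrightarrow> y \<in> vecs E - {x \<in> vecs E. L x = 0}"
    proof (intro exI conjI ballI impI)
      \<comment> \<open>Within this radius \<open>L y\<close> differs from \<open>L x\<close> by
        less than the norm of \<open>L x\<close>; \<open>K + 1\<close> guards against
        \<open>K = 0\<close>.\<close>
      show "0 < nrm Y (L x) / (K + 1)" using pos K by simp
      fix y assume y: "y \<in> vecs E" and d: "nrm E (y - x) < nrm Y (L x) / (K + 1)"
      have "L y \<noteq> 0"
      proof
        assume 0: "L y = 0"
        have "L (y - x) = - L x"
          using add[of "y - x" x] x y 0 by (simp add: eq_neg_iff_add_eq_0)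
        then have "nrm Y (L x) \<le> K * nrm E (y - x)"
          using K(2)[of "y - x"] x y Y.nrm_minus by simp
        also have "\<dots> \<le> (K + 1) * nrm E (y - x)" by (intro mult_right_mono) auto
        also have "\<dots> < nrm Y (L x)" using d using K by (simp add: field_simps)
        finally show False by simp
      qed
      then show "y \<in> vecs E - {x \<in> vecs E. L x = 0}" using y by simp
    qed
  qed auto
  then show ?thesis
    unfolding closed_subspace_def closedin_def
    by (auto simp: subspace_def L0 add sc)
qed

text \<open>The complement is the range of \<open>L\<close>, closed because it is the kernel of the
  bounded map \<open>x - L x\<close>.\<close>

lemma complemented_subspace_kernel:
  assumes L: "bounded_linear_nspace E E L"
    and idem: "\<And>x. x \<in> vecs E \<Longrightarrow> L (L x) = L x"
  shows "complemented_subspace E {x \<in> vecs E. L x = 0}"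
proof -
  have add: "L (x + y) = L x + L y" if "x \<in> vecs E" "y \<in> vecs E" for x y
    using L that by (auto simp: bounded_linear_nspace_def)
  have sc: "L (c *\<^sub>R x) = c *\<^sub>R L x" and cl: "L x \<in> vecs E" if "x \<in> vecs E" for x c
    using L that by (auto simp: bounded_linear_nspace_def)
  have dif: "L (x - y) = L x - L y" if "x \<in> vecs E" "y \<in> vecs E" for x y
    using add[of "x - y" y] that by simp
  obtain K where K: "0 \<le> K" "\<And>x. x \<in> vecs E \<Longrightarrow> nrm E (L x) \<le> K * nrm E x"
    using bounded_linear_nspaceE[OF L] by blast
  have "bounded_linear_nspace E E (\<lambda>x. x - L x)"
    unfolding bounded_linear_nspace_def
  proof (intro conjI ballI allI exI)
    show "nrm E (x - L x) \<le> (1 + K) * nrm E x" if "x \<in> vecs E" for x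
      using nrm_diff_triangle[of x "L x"] cl[of x] K(2)[of x] that by (simp add: algebra_simps)
  qed (auto simp: add sc cl algebra_simps)
  then have "closed_subspace E {x \<in> vecs E. x - L x = 0}"
    by (intro closed_subspace_kernel[OF nspace_on_axioms])
  moreover have "closed_subspace E {x \<in> vecs E. L x = 0}"
    by (intro closed_subspace_kernel[OF nspace_on_axioms] L)
  moreover have "vecs E = {f + w | f w. f \<in> {x \<in> vecs E. L x = 0} \<and> w \<in> {x \<in> vecs E. x - L x = 0}}"
  proof (intro equalityI subsetI)
    fix x assume x: "x \<in> vecs E"
    have "x = (x - L x) + L x" by simp
    moreover have "x - L x \<in> {x \<in> vecs E. L x = 0}" "L x \<in> {x \<in> vecs E. x - L x = 0}"
      using x cl[of x] idem[of x] dif[of x "L x"] by auto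
    ultimately show "x \<in> {f + w | f w. f \<in> {x \<in> vecs E. L x = 0} \<and> w \<in> {x \<in> vecs E. x - L x = 0}}"
      by blast
  qed auto
  moreover have "{x \<in> vecs E. L x = 0} \<inter> {x \<in> vecs E. x - L x = 0} = {0}"
    using sc[of 0 0] by auto
  ultimately show ?thesis unfolding complemented_subspace_def by blast
qed

end

lemma nspace_on_real_line: "nspace_on real_line"
  by unfold_locales (auto simp: real_line_def abs_mult)

lemma openin_real_line: "openin (ntop real_line) {- e<..<e}"
proof -
  interpret nspace_on real_line by (rule nspace_on_real_line)
  show ?thesis unfolding openin_ntop
  proof (intro conjI ballI)
    fix x assume "x \<in> {- e<..<e}"
    then show "\<exists>d>0. \<forall>y\<in>vecs real_line. nrm real_line (y - x) < d \<longrightarrow> y \<in> {- e<..<e}"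
      by (intro exI[of _ "min (e - x) (e + x)"]) (auto simp: real_line_def)
  qed (simp add: real_line_def)
qed

section \<open>Involutive normed algebras on a carrier\<close>

text \<open>The bilinear laws hold on the whole type, as they do for composition, so rewriting with
  them leaves no membership conditions. The laws of \<open>star\<close> are confined to the carrier
  because \<open>sharp\<close> is meaningful only on adjointable operators.\<close>

locale star_algebra = nspace_on X for X :: "'v::real_vector nspace" +
  fixes mul :: "'v \<Rightarrow> 'v \<Rightarrow> 'v" (infixl "\<odot>" 70)
    and unit :: 'v ("\<one>")
    and star :: "'v \<Rightarrow> 'v" ("(_\<^sup>\<sharp>)" [1000] 1000)
  assumes mul_assoc: "(a \<odot> b) \<odot> c = a \<odot> (b \<odot> c)"
    and mul_add_left: "(a + b) \<odot> c = a \<odot> c + b \<odot> c"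
    and mul_add_right: "a \<odot> (b + c) = a \<odot> b + a \<odot> c"
    and mul_scaleR_left: "(s *\<^sub>R a) \<odot> b = s *\<^sub>R (a \<odot> b)"
    and mul_scaleR_right: "a \<odot> (s *\<^sub>R b) = s *\<^sub>R (a \<odot> b)"
    and one_mul [simp]: "\<one> \<odot> a = a"
    and mul_one [simp]: "a \<odot> \<one> = a"
    and one_closed [simp, intro]: "\<one> \<in> vecs X"
    and mul_closed [simp, intro]: "a \<in> vecs X \<Longrightarrow> b \<in> vecs X \<Longrightarrow> a \<odot> b \<in> vecs X"
    and star_closed [simp, intro]: "a \<in> vecs X \<Longrightarrow> a\<^sup>\<sharp> \<in> vecs X"
    and star_add: "a \<in> vecs X \<Longrightarrow> b \<in> vecs X \<Longrightarrow> (a + b)\<^sup>\<sharp> = a\<^sup>\<sharp> + b\<^sup>\<sharp>"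
    and star_scaleR: "a \<in> vecs X \<Longrightarrow> (s *\<^sub>R a)\<^sup>\<sharp> = s *\<^sub>R a\<^sup>\<sharp>"
    and star_mul: "a \<in> vecs X \<Longrightarrow> b \<in> vecs X \<Longrightarrow> (a \<odot> b)\<^sup>\<sharp> = b\<^sup>\<sharp> \<odot> a\<^sup>\<sharp>"
    and star_star [simp]: "a \<in> vecs X \<Longrightarrow> a\<^sup>\<sharp>\<^sup>\<sharp> = a"
    and nrm_mul: "a \<in> vecs X \<Longrightarrow> b \<in> vecs X \<Longrightarrow> nrm X (a \<odot> b) \<le> nrm X a * nrm X b"
    and nrm_star: "a \<in> vecs X \<Longrightarrow> nrm X (a\<^sup>\<sharp>) = nrm X a"
    and neumann: "a \<in> vecs X \<Longrightarrow> nrm X a < 1 \<Longrightarrow>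
       \<exists>b\<in>vecs X. (\<one> - a) \<odot> b = \<one> \<and> b \<odot> (\<one> - a) = \<one>"
begin

lemma mul_zero [simp]: "a \<odot> 0 = 0" "0 \<odot> a = 0"
  using mul_scaleR_right[of a 0 0] mul_scaleR_left[of 0 0 a] by simp_all

lemma mul_minus_right [simp]: "a \<odot> (- b) = - (a \<odot> b)"
  using mul_scaleR_right[of a "-1" b] by simp

lemma mul_minus_left [simp]: "(- a) \<odot> b = - (a \<odot> b)"
  using mul_scaleR_left[of "-1" a b] by simp

lemma mul_diff_right: "a \<odot> (b - c) = a \<odot> b - a \<odot> c"
  using mul_add_right[of a b "- c"] by simp

lemma mul_diff_left: "(a - b) \<odot> c = a \<odot> c - b \<odot> c"
  using mul_add_left[of a "- b" c] by simp

lemmas expand = mul_add_left mul_add_right mul_diff_left mul_diff_right mul_scaleR_left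
  mul_scaleR_right mul_assoc

lemma star_zero [simp]: "0\<^sup>\<sharp> = 0"
  using star_scaleR[of 0 0] by simp

lemma star_minus: "a \<in> vecs X \<Longrightarrow> (- a)\<^sup>\<sharp> = - a\<^sup>\<sharp>"
  using star_scaleR[of a "-1"] by simp

lemma star_diff: "a \<in> vecs X \<Longrightarrow> b \<in> vecs X \<Longrightarrow> (a - b)\<^sup>\<sharp> = a\<^sup>\<sharp> - b\<^sup>\<sharp>"
  using star_add[of a "- b"] by (simp add: star_minus)

lemma star_one [simp]: "\<one>\<^sup>\<sharp> = \<one>"
  by (metis mul_one one_closed star_closed star_mul star_star)

lemmas star_expand = star_add star_diff star_minus star_scaleR star_mul

section \<open>Inverses and bounded linear maps in the algebra\<close>

definition invertible_in :: "'v \<Rightarrow> bool" where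
  "invertible_in a \<longleftrightarrow> (\<exists>b\<in>vecs X. a \<odot> b = \<one> \<and> b \<odot> a = \<one>)"

definition inverse_in :: "'v \<Rightarrow> 'v" where
  "inverse_in a = (SOME b. b \<in> vecs X \<and> a \<odot> b = \<one> \<and> b \<odot> a = \<one>)"

lemma inverse_in:
  assumes "invertible_in a"
  shows "inverse_in a \<in> vecs X" "a \<odot> inverse_in a = \<one>" "inverse_in a \<odot> a = \<one>"
    "a \<odot> (inverse_in a \<odot> z) = z" "inverse_in a \<odot> (a \<odot> z) = z"
proof -
  have "inverse_in a \<in> vecs X \<and> a \<odot> inverse_in a = \<one> \<and> inverse_in a \<odot> a = \<one>"
    unfolding inverse_in_def by (rule someI_ex) (use assms in \<open>auto simp: invertible_in_def\<close>)
  then show "inverse_in a \<in> vecs X" "a \<odot> inverse_in a = \<one>" "inverse_in a \<odot> a = \<one>"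
    "a \<odot> (inverse_in a \<odot> z) = z" "inverse_in a \<odot> (a \<odot> z) = z"
    by (simp_all add: mul_assoc[symmetric])
qed

lemma inverse_in_eq:
  assumes "b \<in> vecs X" "a \<odot> b = \<one>" "b \<odot> a = \<one>"
  shows "inverse_in a = b"
proof -
  have "invertible_in a" using assms by (auto simp: invertible_in_def)
  from inverse_in(5)[OF this, of b] show ?thesis using assms by simp
qed

lemma bounded_linear_mul:
  assumes "c \<in> vecs X" "d \<in> vecs X"
  shows "bounded_linear_nspace X X (\<lambda>v. c \<odot> v \<odot> d)"
  unfolding bounded_linear_nspace_def
proof (intro conjI ballI allI exI)
  fix v assume v: "v \<in> vecs X"
  have "nrm X (c \<odot> v \<odot> d) \<le> (nrm X c * nrm X v) * nrm X d"
    using assms v by (meson nrm_mul mul_closed order_trans mult_right_mono nrm_nonneg)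
  then show "nrm X (c \<odot> v \<odot> d) \<le> (nrm X c * nrm X d) * nrm X v"
    by (simp add: mult_ac)
qed (use assms in \<open>auto simp: expand\<close>)

lemma bounded_linear_star: "bounded_linear_nspace X X star"
  unfolding bounded_linear_nspace_def
  by (auto simp: star_expand nrm_star intro!: exI[of _ 1])

lemma bounded_linear_add:
  assumes "bounded_linear_nspace E X f" "bounded_linear_nspace E X g" "nspace_on E"
  shows "bounded_linear_nspace E X (\<lambda>v. f v + g v)"
proof -
  interpret E: nspace_on E by fact
  obtain K L where "\<And>x. x \<in> vecs E \<Longrightarrow> nrm X (f x) \<le> K * nrm E x"
    "\<And>x. x \<in> vecs E \<Longrightarrow> nrm X (g x) \<le> L * nrm E x"
    using E.bounded_linear_nspaceE[OF assms(1)] E.bounded_linear_nspaceE[OF assms(2)] by metis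
  then have "nrm X (f x + g x) \<le> (K + L) * nrm E x" if "x \<in> vecs E" for x
    using that nrm_triangle[of "f x" "g x"] assms
    by (fastforce simp: bounded_linear_nspace_def algebra_simps)
  then show ?thesis
    using assms unfolding bounded_linear_nspace_def
    by (intro conjI ballI allI exI[of _ "K + L"]) (auto simp: algebra_simps)
qed

lemma bounded_linear_compose:
  assumes "bounded_linear_nspace E X f" "bounded_linear_nspace X X g" "nspace_on E"
  shows "bounded_linear_nspace E X (\<lambda>v. g (f v))"
proof -
  interpret E: nspace_on E by fact
  obtain K L where K: "\<And>x. x \<in> vecs E \<Longrightarrow> nrm X (f x) \<le> K * nrm E x"
    and L: "0 \<le> L" "\<And>x. x \<in> vecs X \<Longrightarrow> nrm X (g x) \<le> L * nrm X x"
    using E.bounded_linear_nspaceE[OF assms(1)] bounded_linear_nspaceE[OF assms(2)] by metis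
  have "nrm X (g (f x)) \<le> (L * K) * nrm E x" if "x \<in> vecs E" for x
  proof -
    have "f x \<in> vecs X" using assms that by (auto simp: bounded_linear_nspace_def)
    then have "nrm X (g (f x)) \<le> L * nrm X (f x)" by (rule L)
    also have "\<dots> \<le> L * (K * nrm E x)" using K[OF that] L by (intro mult_left_mono) auto
    finally show ?thesis by (simp add: mult_ac)
  qed
  then show ?thesis
    using assms unfolding bounded_linear_nspace_def
    by (intro conjI ballI allI exI[of _ "L * K"]) auto
qed

section \<open>Smoothness of rational maps\<close>

text \<open>\<open>rat E U I f\<close>: the value \<open>f x v\<close> is a noncommutative rational expression in \<open>x \<in> U\<close> which is
  multilinear in the vectors \<open>v i\<close>, \<open>i \<in> I\<close>. This class is closed under differentiation, the
  direction of the derivative being the new slot 0; hence its members with \<open>I = {}\<close> are smooth.\<close>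

inductive rat :: "'w::real_vector nspace \<Rightarrow> 'w set \<Rightarrow> nat set \<Rightarrow> ('w \<Rightarrow> (nat \<Rightarrow> 'w) \<Rightarrow> 'v) \<Rightarrow> bool"
  for E U where
  zero: "finite I \<Longrightarrow> rat E U I (\<lambda>x v. 0)"
| const: "c \<in> vecs X \<Longrightarrow> rat E U {} (\<lambda>x v. c)"
| var: "bounded_linear_nspace E X l \<Longrightarrow> rat E U {} (\<lambda>x v. l x)"
| slot: "bounded_linear_nspace E X l \<Longrightarrow> rat E U {i} (\<lambda>x v. l (v i))"
| add: "rat E U I f \<Longrightarrow> rat E U I g \<Longrightarrow> rat E U I (\<lambda>x v. f x v + g x v)"
| mult: "rat E U I f \<Longrightarrow> rat E U J g \<Longrightarrow> I \<inter> J = {} \<Longrightarrow> rat E U (I \<union> J) (\<lambda>x v. f x v \<odot> g x v)"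
| post: "bounded_linear_nspace X X l \<Longrightarrow> rat E U I f \<Longrightarrow> rat E U I (\<lambda>x v. l (f x v))"
| inv: "rat E U {} (\<lambda>x v. f x) \<Longrightarrow>
    (\<And>x. x \<in> U \<Longrightarrow> R x \<in> vecs X \<and> f x \<odot> R x = \<one> \<and> R x \<odot> f x = \<one>) \<Longrightarrow> rat E U {} (\<lambda>x v. R x)"

section \<open>Multilinearity and boundedness in the slots\<close>

lemma rat_finite: "rat E U I f \<Longrightarrow> finite I"
  by (induction rule: rat.induct) auto

text \<open>Renumbering frees slot 0 for the direction of differentiation; the undifferentiated
  factor in the product rule is shifted in this way.\<close>

lemma rat_shift: "rat E U I f \<Longrightarrow> rat E U (Suc ` I) (\<lambda>x v. f x (v \<circ> Suc))"
proof (induction rule: rat.induct)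
  case (mult I f J g)
  then have "Suc ` I \<inter> Suc ` J = {}" by auto
  with mult show ?case by (simp add: image_Un rat.mult)
next
  case (inv f R)
  show ?case using rat.inv[OF inv(1,2)] by simp
qed (auto intro: rat.intros)

lemma rat_closed:
  assumes "rat E U I f" "U \<subseteq> vecs E" "x \<in> U" "\<And>i. i \<in> I \<Longrightarrow> v i \<in> vecs E"
  shows "f x v \<in> vecs X"
  using assms by (induction rule: rat.induct) (auto simp: bounded_linear_nspace_def)

lemma rat_fun_upd_irrelevant: "rat E U I f \<Longrightarrow> i \<notin> I \<Longrightarrow> f x (v(i := a)) = f x v"
proof (induction rule: rat.induct)
  case (inv f R)
  then show ?case by simp
qed auto

text \<open>In a product the slot sets are disjoint, so slot \<open>i\<close> occurs in exactly one
  factor and the other is constant in \<open>v i\<close>.\<close>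

lemma rat_linear:
  assumes "rat E U I f" "nspace_on E" "U \<subseteq> vecs E" "x \<in> U" "\<And>i. i \<in> I \<Longrightarrow> v i \<in> vecs E"
    "i \<in> I" "a \<in> vecs E" "b \<in> vecs E"
  shows "f x (v(i := a + b)) = f x (v(i := a)) + f x (v(i := b)) \<and>
    f x (v(i := c *\<^sub>R a)) = c *\<^sub>R f x (v(i := a))"
  using assms
proof (induction rule: rat.induct)
  case (slot l j)
  then show ?case by (auto simp: bounded_linear_nspace_def)
next
  case (mult I f J g)
  show ?case
  proof (cases "i \<in> I")
    case True
    then have "i \<notin> J" using mult by auto
    then have "g x (v(i := z)) = g x v" for z by (rule rat_fun_upd_irrelevant[OF mult(2)])
    moreover have "f x (v(i := a + b)) = f x (v(i := a)) + f x (v(i := b)) \<and>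
        f x (v(i := c *\<^sub>R a)) = c *\<^sub>R f x (v(i := a))"
      using mult True by blast
    ultimately show ?thesis by (simp only: mul_add_left mul_scaleR_left simp_thms)
  next
    case False
    then have "i \<in> J" using mult by auto
    then have "g x (v(i := a + b)) = g x (v(i := a)) + g x (v(i := b)) \<and>
        g x (v(i := c *\<^sub>R a)) = c *\<^sub>R g x (v(i := a))"
      using mult by blast
    moreover have "f x (v(i := z)) = f x v" for z
      by (rule rat_fun_upd_irrelevant[OF mult(1) False])
    ultimately show ?thesis by (simp only: mul_add_right mul_scaleR_right simp_thms)
  qed
next
  case (post l I f)
  have "f x (v(i := z)) \<in> vecs X" if "z \<in> vecs E" for z
    using post that by (intro rat_closed[OF post(2)]) auto
  then have "f x (v(i := a)) \<in> vecs X" "f x (v(i := b)) \<in> vecs X" using post by blast+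
  then have "l (f x (v(i := a)) + f x (v(i := b))) = l (f x (v(i := a))) + l (f x (v(i := b)))"
    "l (c *\<^sub>R f x (v(i := a))) = c *\<^sub>R l (f x (v(i := a)))"
    using post(1) unfolding bounded_linear_nspace_def by blast+
  moreover have "f x (v(i := a + b)) = f x (v(i := a)) + f x (v(i := b))"
    "f x (v(i := c *\<^sub>R a)) = c *\<^sub>R f x (v(i := a))"
    using post by blast+
  ultimately show ?case by (simp only: simp_thms)
qed (auto simp: scaleR_add_right)

text \<open>The constant belongs to one fixed point \<open>x\<close>. For an inverse it is the norm
  of the value there, since an inverse carries no slots.\<close>

lemma rat_bounded:
  assumes "rat E U I f" "nspace_on E" "U \<subseteq> vecs E" "x \<in> U"
  shows "\<exists>K\<ge>0. \<forall>v. (\<forall>i\<in>I. v i \<in> vecs E) \<longrightarrow> nrm X (f x v) \<le> K * (\<Prod>i\<in>I. nrm E (v i))"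
  using assms
proof (induction rule: rat.induct)
  case (zero I)
  then show ?case by (intro exI[of _ 0]) auto
next
  case (const c)
  then show ?case by (intro exI[of _ "nrm X c"]) auto
next
  case (var l)
  then show ?case by (intro exI[of _ "nrm X (l x)"]) auto
next
  case (slot l i)
  interpret E: nspace_on E by (rule slot)
  obtain K where "0 \<le> K" "\<And>x. x \<in> vecs E \<Longrightarrow> nrm X (l x) \<le> K * nrm E x"
    using E.bounded_linear_nspaceE[OF slot(1)] by blast
  then show ?case by (intro exI[of _ K]) auto
next
  case (add I f g)
  then obtain K L where "K \<ge> 0" "L \<ge> 0" and
    K: "\<And>v. (\<forall>i\<in>I. v i \<in> vecs E) \<Longrightarrow> nrm X (f x v) \<le> K * (\<Prod>i\<in>I. nrm E (v i))" and
    L: "\<And>v. (\<forall>i\<in>I. v i \<in> vecs E) \<Longrightarrow> nrm X (g x v) \<le> L * (\<Prod>i\<in>I. nrm E (v i))"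
    by blast
  show ?case
  proof (intro exI[of _ "K + L"] conjI allI impI)
    fix v assume v: "\<forall>i\<in>I. v i \<in> vecs E"
    then have "nrm X (f x v + g x v) \<le> nrm X (f x v) + nrm X (g x v)"
      using add by (intro nrm_triangle rat_closed[of E U I]) auto
    then show "nrm X (f x v + g x v) \<le> (K + L) * (\<Prod>i\<in>I. nrm E (v i))"
      using K[OF v] L[OF v] by (simp add: algebra_simps)
  qed (use \<open>K \<ge> 0\<close> \<open>L \<ge> 0\<close> in auto)
next
  case (mult I f J g)
  interpret E: nspace_on E by (rule mult)
  obtain K L where "K \<ge> 0" "L \<ge> 0" and
    K: "\<And>v. (\<forall>i\<in>I. v i \<in> vecs E) \<Longrightarrow> nrm X (f x v) \<le> K * (\<Prod>i\<in>I. nrm E (v i))" and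
    L: "\<And>v. (\<forall>i\<in>J. v i \<in> vecs E) \<Longrightarrow> nrm X (g x v) \<le> L * (\<Prod>i\<in>J. nrm E (v i))"
    using mult by blast
  show ?case
  proof (intro exI[of _ "K * L"] conjI allI impI)
    fix v assume v: "\<forall>i\<in>I \<union> J. v i \<in> vecs E"
    then have "nrm X (f x v \<odot> g x v) \<le> nrm X (f x v) * nrm X (g x v)"
      using mult by (intro nrm_mul) (auto intro!: rat_closed[OF mult(1)] rat_closed[OF mult(2)])
    also have "\<dots> \<le> (K * (\<Prod>i\<in>I. nrm E (v i))) * (L * (\<Prod>i\<in>J. nrm E (v i)))"
      using v \<open>K \<ge> 0\<close> by (intro mult_mono K L mult_nonneg_nonneg prod_nonneg) auto
    also have "\<dots> = K * L * (\<Prod>i\<in>I \<union> J. nrm E (v i))"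
      using mult rat_finite[OF mult(1)] rat_finite[OF mult(2)] by (subst prod.union_disjoint) (auto simp: mult_ac)
    finally show "nrm X (f x v \<odot> g x v) \<le> K * L * (\<Prod>i\<in>I \<union> J. nrm E (v i))" .
  qed (use \<open>K \<ge> 0\<close> \<open>L \<ge> 0\<close> in auto)
next
  case (post l I f)
  then obtain K where "K \<ge> 0" and
    K: "\<And>v. (\<forall>i\<in>I. v i \<in> vecs E) \<Longrightarrow> nrm X (f x v) \<le> K * (\<Prod>i\<in>I. nrm E (v i))"
    by blast
  obtain L where L: "0 \<le> L" "\<And>x. x \<in> vecs X \<Longrightarrow> nrm X (l x) \<le> L * nrm X x"
    using bounded_linear_nspaceE[OF post(1)] by blast
  show ?case
  proof (intro exI[of _ "L * K"] conjI allI impI)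
    fix v assume v: "\<forall>i\<in>I. v i \<in> vecs E"
    then have "nrm X (l (f x v)) \<le> L * nrm X (f x v)"
      using post by (intro L rat_closed[OF post(2)]) auto
    also have "\<dots> \<le> L * (K * (\<Prod>i\<in>I. nrm E (v i)))"
      using K[OF v] L by (intro mult_left_mono) auto
    finally show "nrm X (l (f x v)) \<le> L * K * (\<Prod>i\<in>I. nrm E (v i))" by (simp add: mult_ac)
  qed (use \<open>K \<ge> 0\<close> L in auto)
next
  case (inv f R)
  then show ?case by (intro exI[of _ "nrm X (R x)"]) auto
qed

text \<open>A quadratic bound on the remainder, instead of \<open>o(h)\<close>, frees the product and quotient rules
  from \<open>\<epsilon>\<close>-arguments; a single constant \<open>M\<close> is both the bound and the inverse of the radius.\<close>

definition quad_deriv where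
  "quad_deriv E U I f f' x M \<longleftrightarrow> (\<forall>y\<in>U. nrm E (y - x) * M < 1 \<longrightarrow>
     (\<forall>v. (\<forall>i\<in>I. v i \<in> vecs E) \<longrightarrow>
       nrm X (f y v - f x v - f' x (case_nat (y - x) v))
         \<le> M * (nrm E (y - x))\<^sup>2 * (\<Prod>i\<in>I. nrm E (v i))))"

section \<open>Derivatives of rational expressions\<close>

lemma quad_derivD:
  assumes "quad_deriv E U I f f' x M" "y \<in> U" "nrm E (y - x) * M < 1" "\<And>i. i \<in> I \<Longrightarrow> v i \<in> vecs E"
  shows "nrm X (f y v - f x v - f' x (case_nat (y - x) v))
     \<le> M * (nrm E (y - x))\<^sup>2 * (\<Prod>i\<in>I. nrm E (v i))"
  using assms unfolding quad_deriv_def by blast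

text \<open>\<open>case_nat h v\<close> has \<open>h\<close> in slot 0 and \<open>v\<close> moved up
  by one; splitting off that slot displays the bound as one for a linear map in
  \<open>h\<close>.\<close>

lemma rat_bounded_deriv:
  assumes "rat E U (insert 0 (Suc ` I)) f'" "nspace_on E" "U \<subseteq> vecs E" "x \<in> U"
  shows "\<exists>K\<ge>0. \<forall>h v. h \<in> vecs E \<longrightarrow> (\<forall>i\<in>I. v i \<in> vecs E) \<longrightarrow>
     f' x (case_nat h v) \<in> vecs X \<and>
     nrm X (f' x (case_nat h v)) \<le> K * nrm E h * (\<Prod>i\<in>I. nrm E (v i))"
proof -
  have fin: "finite I" using rat_finite[OF assms(1)] by (simp add: finite_image_iff)
  obtain K where "K \<ge> 0" and K: "\<And>v. (\<forall>i\<in>insert 0 (Suc ` I). v i \<in> vecs E) \<Longrightarrow>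
      nrm X (f' x v) \<le> K * (\<Prod>i\<in>insert 0 (Suc ` I). nrm E (v i))"
    using rat_bounded[OF assms] by blast
  have "f' x (case_nat h v) \<in> vecs X \<and>
     nrm X (f' x (case_nat h v)) \<le> K * nrm E h * (\<Prod>i\<in>I. nrm E (v i))"
    if "h \<in> vecs E" "\<forall>i\<in>I. v i \<in> vecs E" for h v
  proof
    show "f' x (case_nat h v) \<in> vecs X"
      using that by (intro rat_closed[OF assms(1,3,4)]) auto
    have "(\<Prod>i\<in>insert 0 (Suc ` I). nrm E (case_nat h v i)) = nrm E h * (\<Prod>i\<in>I. nrm E (v i))"
      using fin by (subst prod.insert) (auto simp: prod.reindex)
    then show "nrm X (f' x (case_nat h v)) \<le> K * nrm E h * (\<Prod>i\<in>I. nrm E (v i))"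
      using K[of "case_nat h v"] that by (auto simp: mult.assoc)
  qed
  then show ?thesis using \<open>K \<ge> 0\<close> by blast
qed

text \<open>Inside the radius \<open>1 / M\<close> the quadratic remainder is at most the increment
  times the slot norms, so it adds just 1 to the constant of the linear term.\<close>

lemma rat_lipschitz:
  assumes "rat E U I f" "rat E U (insert 0 (Suc ` I)) f'" "nspace_on E" "U \<subseteq> vecs E" "x \<in> U"
    and "quad_deriv E U I f f' x M" "0 < M"
  shows "\<exists>L>0. \<forall>y\<in>U. nrm E (y - x) * M < 1 \<longrightarrow> (\<forall>v. (\<forall>i\<in>I. v i \<in> vecs E) \<longrightarrow>
     nrm X (f y v - f x v) \<le> L * nrm E (y - x) * (\<Prod>i\<in>I. nrm E (v i)))"
proof -
  interpret E: nspace_on E by fact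
  obtain K where "K \<ge> 0" and K: "\<And>h v. h \<in> vecs E \<Longrightarrow> \<forall>i\<in>I. v i \<in> vecs E \<Longrightarrow>
     f' x (case_nat h v) \<in> vecs X \<and>
     nrm X (f' x (case_nat h v)) \<le> K * nrm E h * (\<Prod>i\<in>I. nrm E (v i))"
    using rat_bounded_deriv[OF assms(2-5)] by blast
  have "nrm X (f y v - f x v) \<le> (K + 1) * nrm E (y - x) * (\<Prod>i\<in>I. nrm E (v i))"
    if y: "y \<in> U" and h: "nrm E (y - x) * M < 1" and v: "\<forall>i\<in>I. v i \<in> vecs E" for y v
  proof -
    let ?d = "f' x (case_nat (y - x) v)" and ?p = "\<Prod>i\<in>I. nrm E (v i)"
    have mem: "y - x \<in> vecs E" using y assms(4,5) by auto
    have cl: "f y v \<in> vecs X" "f x v \<in> vecs X" "?d \<in> vecs X"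
      using v y assms(4,5) K[OF mem v] by (auto intro!: rat_closed[OF assms(1)])
    have "nrm X (f y v - f x v) = nrm X ((f y v - f x v - ?d) + ?d)" by simp
    also have "\<dots> \<le> nrm X (f y v - f x v - ?d) + nrm X ?d" using cl by (intro nrm_triangle) auto
    also have "\<dots> \<le> M * (nrm E (y - x))\<^sup>2 * ?p + K * nrm E (y - x) * ?p"
      using K[OF mem v] quad_derivD[OF assms(6) y h, of v] v by simp
    also have "M * (nrm E (y - x))\<^sup>2 * ?p \<le> 1 * nrm E (y - x) * ?p"
    proof -
      have "M * (nrm E (y - x))\<^sup>2 = (nrm E (y - x) * M) * nrm E (y - x)"
        by (simp add: power2_eq_square mult_ac)
      also have "\<dots> \<le> 1 * nrm E (y - x)" using h by (intro mult_right_mono) auto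
      finally show ?thesis by (intro mult_right_mono prod_nonneg) auto
    qed
    finally show ?thesis by (simp add: algebra_simps)
  qed
  then show ?thesis using \<open>K \<ge> 0\<close> by (intro exI[of _ "K + 1"]) auto
qed

lemma nrm_mul3:
  assumes "a \<in> vecs X" "b \<in> vecs X" "c \<in> vecs X"
  shows "nrm X (a \<odot> b \<odot> c) \<le> nrm X a * nrm X b * nrm X c"
  using assms by (meson mult_right_mono nrm_mul mul_closed nrm_nonneg order_trans)

text \<open>Common shape of the remainder in the product rule and of the error terms when the
  isometry equation is expanded along a curve.\<close>

lemma nrm_sum_of_products:
  assumes "a \<in> vecs X" "b \<in> vecs X" "c \<in> vecs X" "d \<in> vecs X" "p \<in> vecs X" "q \<in> vecs X"
  shows "nrm X (a \<odot> b + c \<odot> d + p \<odot> q) \<le> nrm X a * nrm X b + nrm X c * nrm X d + nrm X p * nrm X q"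
proof -
  have "nrm X (a \<odot> b + c \<odot> d + p \<odot> q) \<le> nrm X (a \<odot> b + c \<odot> d) + nrm X (p \<odot> q)"
    using assms by (intro nrm_triangle) auto
  moreover have "nrm X (a \<odot> b + c \<odot> d) \<le> nrm X (a \<odot> b) + nrm X (c \<odot> d)"
    using assms by (intro nrm_triangle) auto
  ultimately show ?thesis using nrm_mul assms by (smt (verit))
qed

text \<open>The derivative must lie in the class again so that the statement can be iterated. It is
  one expression for all \<open>x\<close>; only \<open>M\<close> may depend on the point.\<close>

lemma rat_differentiable:
  assumes "rat E U I f" "nspace_on E" "U \<subseteq> vecs E"
  shows "\<exists>f'. rat E U (insert 0 (Suc ` I)) f' \<and> (\<forall>x\<in>U. \<exists>M>0. quad_deriv E U I f f' x M)"
  using assms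
proof (induction rule: rat.induct)
  case (zero I)
  then show ?case
    by (intro exI[of _ "\<lambda>x v. 0"])
      (auto simp: quad_deriv_def intro!: rat.zero exI[of _ 1] mult_nonneg_nonneg prod_nonneg
        nspace_on.nrm_nonneg)
next
  case (const c)
  then show ?case
    by (intro exI[of _ "\<lambda>x v. 0"])
      (auto simp: quad_deriv_def intro!: rat.zero exI[of _ 1] mult_nonneg_nonneg prod_nonneg)
next
  case (var l)
  have "l y - l x - l (y - x) = 0" if "x \<in> U" "y \<in> U" for x y
  proof -
    interpret E: nspace_on E by fact
    have "x \<in> vecs E" "y \<in> vecs E" using var that by auto
    then have "l ((y - x) + x) = l (y - x) + l x"
      using var(1) unfolding bounded_linear_nspace_def by blast
    then show ?thesis by simp
  qed
  then show ?case using var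
    by (intro exI[of _ "\<lambda>x v. l (v 0)"])
      (auto simp: quad_deriv_def intro!: rat.slot exI[of _ 1])
next
  case (slot l i)
  then show ?case
    by (intro exI[of _ "\<lambda>x v. 0"])
      (auto simp: quad_deriv_def intro!: rat.zero exI[of _ 1] mult_nonneg_nonneg prod_nonneg
        nspace_on.nrm_nonneg)
next
  case (add I f g)
  interpret E: nspace_on E by fact
  obtain f' g' where f': "rat E U (insert 0 (Suc ` I)) f'" "\<And>x. x \<in> U \<Longrightarrow> \<exists>M>0. quad_deriv E U I f f' x M"
    and g': "rat E U (insert 0 (Suc ` I)) g'" "\<And>x. x \<in> U \<Longrightarrow> \<exists>M>0. quad_deriv E U I g g' x M"
    using add by blast
  have "\<exists>M>0. quad_deriv E U I (\<lambda>x v. f x v + g x v) (\<lambda>x v. f' x v + g' x v) x M" if x: "x \<in> U" for x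
  proof -
    obtain M1 M2 where "M1 > 0" and M1: "quad_deriv E U I f f' x M1"
      and "M2 > 0" and M2: "quad_deriv E U I g g' x M2"
      using f'(2)[OF x] g'(2)[OF x] by blast
    have "quad_deriv E U I (\<lambda>x v. f x v + g x v) (\<lambda>x v. f' x v + g' x v) x (M1 + M2)"
      unfolding quad_deriv_def
    proof (intro ballI impI allI)
      fix y v assume y: "y \<in> U" and h: "nrm E (y - x) * (M1 + M2) < 1" and v: "\<forall>i\<in>I. v i \<in> vecs E"
      let ?h = "nrm E (y - x)" and ?v = "case_nat (y - x) v"
      have h': "?h * M1 < 1" "?h * M2 < 1"
        using h \<open>M1 > 0\<close> \<open>M2 > 0\<close> mult_left_mono[of M1 "M1 + M2" ?h] mult_left_mono[of M2 "M1 + M2" ?h]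
        by auto
      have mem: "y - x \<in> vecs E" using x y add by auto
      have cl: "f y v \<in> vecs X" "f x v \<in> vecs X" "g y v \<in> vecs X" "g x v \<in> vecs X"
        using v y x add by (auto intro!: rat_closed[OF add(1)] rat_closed[OF add(2)])
      have cl': "f' x ?v \<in> vecs X" "g' x ?v \<in> vecs X"
        using v mem x add by (auto intro!: rat_closed[OF f'(1)] rat_closed[OF g'(1)] split: nat.split)
      have "nrm X ((f y v + g y v) - (f x v + g x v) - (f' x ?v + g' x ?v))
        = nrm X ((f y v - f x v - f' x ?v) + (g y v - g x v - g' x ?v))"
        by (simp add: algebra_simps)
      also have "\<dots> \<le> nrm X (f y v - f x v - f' x ?v) + nrm X (g y v - g x v - g' x ?v)"
        using cl cl' by (intro nrm_triangle) auto
      also have "\<dots> \<le> (M1 + M2) * ?h\<^sup>2 * (\<Prod>i\<in>I. nrm E (v i))"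
        using quad_derivD[OF M1 y h'(1), of v] quad_derivD[OF M2 y h'(2), of v] v
        by (simp add: algebra_simps)
      finally show "nrm X ((f y v + g y v) - (f x v + g x v) - (f' x ?v + g' x ?v))
        \<le> (M1 + M2) * ?h\<^sup>2 * (\<Prod>i\<in>I. nrm E (v i))" .
    qed
    then show ?thesis using \<open>M1 > 0\<close> \<open>M2 > 0\<close> by (intro exI[of _ "M1 + M2"]) auto
  qed
  then show ?case using rat.add[OF f'(1) g'(1)] by blast
next
  case (mult I f J g)
  interpret E: nspace_on E by fact
  obtain f' g' where f': "rat E U (insert 0 (Suc ` I)) f'" "\<And>x. x \<in> U \<Longrightarrow> \<exists>M>0. quad_deriv E U I f f' x M"
    and g': "rat E U (insert 0 (Suc ` J)) g'" "\<And>x. x \<in> U \<Longrightarrow> \<exists>M>0. quad_deriv E U J g g' x M"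
    using mult by blast
  \<comment> \<open>Leibniz rule: the differentiated factor sees slot 0, the other one reads the old
    slots through \<open>v \<circ> Suc\<close>.\<close>
  let ?D = "\<lambda>x v. f' x v \<odot> g x (v \<circ> Suc) + f x (v \<circ> Suc) \<odot> g' x v"
  have "\<exists>M>0. quad_deriv E U (I \<union> J) (\<lambda>x v. f x v \<odot> g x v) ?D x M" if x: "x \<in> U" for x
  proof -
    obtain M1 M2 where "M1 > 0" and M1: "quad_deriv E U I f f' x M1"
      and "M2 > 0" and M2: "quad_deriv E U J g g' x M2"
      using f'(2)[OF x] g'(2)[OF x] by blast
    obtain Kf where "Kf \<ge> 0" and Kf: "\<And>v. (\<forall>i\<in>I. v i \<in> vecs E) \<Longrightarrow> nrm X (f x v) \<le> Kf * (\<Prod>i\<in>I. nrm E (v i))"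
      using rat_bounded[OF mult(1) mult.prems(1,2) x] by blast
    obtain Kg where "Kg \<ge> 0" and Kg: "\<And>v. (\<forall>i\<in>J. v i \<in> vecs E) \<Longrightarrow> nrm X (g x v) \<le> Kg * (\<Prod>i\<in>J. nrm E (v i))"
      using rat_bounded[OF mult(2) mult.prems(1,2) x] by blast
    obtain Kd where "Kd \<ge> 0" and Kd: "\<And>h v. h \<in> vecs E \<Longrightarrow> \<forall>i\<in>I. v i \<in> vecs E \<Longrightarrow>
       f' x (case_nat h v) \<in> vecs X \<and>
       nrm X (f' x (case_nat h v)) \<le> Kd * nrm E h * (\<Prod>i\<in>I. nrm E (v i))"
      using rat_bounded_deriv[OF f'(1) mult.prems(1,2) x] by blast
    obtain L where "L > 0" and L: "\<And>y v. y \<in> U \<Longrightarrow> nrm E (y - x) * M2 < 1 \<Longrightarrow> \<forall>i\<in>J. v i \<in> vecs E \<Longrightarrow>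
        nrm X (g y v - g x v) \<le> L * nrm E (y - x) * (\<Prod>i\<in>J. nrm E (v i))"
      using rat_lipschitz[OF mult(2) g'(1) mult.prems(1,2) x M2 \<open>M2 > 0\<close>] by blast
    \<comment> \<open>One summand for each product in \<open>eq\<close> below: \<open>Kg + L\<close>
      bounds \<open>g y\<close> for increments shorter than 1, and in the last product both factors
      are of first order.\<close>
    define C where "C = M1 * (Kg + L) + Kf * M2 + Kd * L"
    have "C \<ge> 0"
      unfolding C_def using \<open>M1 > 0\<close> \<open>M2 > 0\<close> \<open>Kf \<ge> 0\<close> \<open>Kg \<ge> 0\<close> \<open>Kd \<ge> 0\<close> \<open>L > 0\<close> by simp
    \<comment> \<open>\<open>M1\<close> and \<open>M2\<close> keep \<open>y\<close> within both
      radii, 1 makes the increment shorter than 1, and \<open>C\<close> is the bound itself.\<close>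
    define M where "M = M1 + M2 + 1 + C"
    have "quad_deriv E U (I \<union> J) (\<lambda>x v. f x v \<odot> g x v) ?D x M"
      unfolding quad_deriv_def
    proof (intro ballI impI allI)
      fix y v assume y: "y \<in> U" and h: "nrm E (y - x) * M < 1" and v: "\<forall>i\<in>I \<union> J. v i \<in> vecs E"
      let ?h = "nrm E (y - x)" and ?v = "case_nat (y - x) v"
      let ?p = "\<Prod>i\<in>I. nrm E (v i)" and ?q = "\<Prod>i\<in>J. nrm E (v i)"
      have pq: "?p \<ge> 0" "?q \<ge> 0" by (auto intro: prod_nonneg)
      have vI: "\<forall>i\<in>I. v i \<in> vecs E" and vJ: "\<forall>i\<in>J. v i \<in> vecs E" using v by auto
      have "?h * M1 \<le> ?h * M" "?h * M2 \<le> ?h * M" "?h * 1 \<le> ?h * M"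
        using \<open>M1 > 0\<close> \<open>M2 > 0\<close> \<open>C \<ge> 0\<close> by (intro mult_left_mono; simp add: M_def)+
      then have h': "?h * M1 < 1" "?h * M2 < 1" "?h < 1" using h by auto
      have mem: "y - x \<in> vecs E" using x y mult by auto
      have cl: "f y v \<in> vecs X" "f x v \<in> vecs X" "g y v \<in> vecs X" "g x v \<in> vecs X"
        using v y x mult by (auto intro!: rat_closed[OF mult(1)] rat_closed[OF mult(2)])
      have cl': "f' x ?v \<in> vecs X" "g' x ?v \<in> vecs X"
        using v mem x mult by (auto intro!: rat_closed[OF f'(1)] rat_closed[OF g'(1)] split: nat.split)
      have gy: "nrm X (g y v) \<le> (Kg + L) * ?q"
      proof -
        have "nrm X (g y v) = nrm X ((g y v - g x v) + g x v)" by simp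
        also have "\<dots> \<le> nrm X (g y v - g x v) + nrm X (g x v)" using cl by (intro nrm_triangle) auto
        also have "\<dots> \<le> L * ?h * ?q + Kg * ?q" using L[OF y h'(2) vJ] Kg[OF vJ] by simp
        also have "\<dots> \<le> L * 1 * ?q + Kg * ?q"
          using h' \<open>L > 0\<close> pq by (intro add_mono mult_right_mono mult_left_mono) auto
        finally show ?thesis by (simp add: algebra_simps)
      qed
      have df: "nrm X (f y v - f x v - f' x ?v) \<le> M1 * ?h\<^sup>2 * ?p"
        using quad_derivD[OF M1 y h'(1)] vI by blast
      have dg: "nrm X (g y v - g x v - g' x ?v) \<le> M2 * ?h\<^sup>2 * ?q"
        using quad_derivD[OF M2 y h'(2)] vJ by blast
      have cs: "?v \<circ> Suc = v" by (auto simp: fun_eq_iff)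
      have eq: "f y v \<odot> g y v - f x v \<odot> g x v - ?D x ?v
        = ((f y v - f x v - f' x ?v) \<odot> g y v + f x v \<odot> (g y v - g x v - g' x ?v))
           + f' x ?v \<odot> (g y v - g x v)"
        unfolding cs expand by (simp add: algebra_simps)
      have "nrm X (f y v \<odot> g y v - f x v \<odot> g x v - ?D x ?v) \<le> nrm X (f y v - f x v - f' x ?v) * nrm X (g y v)
          + nrm X (f x v) * nrm X (g y v - g x v - g' x ?v) + nrm X (f' x ?v) * nrm X (g y v - g x v)"
        unfolding eq by (rule nrm_sum_of_products) (use cl cl' in auto)
      also have "\<dots> \<le> (M1 * ?h\<^sup>2 * ?p) * ((Kg + L) * ?q) + (Kf * ?p) * (M2 * ?h\<^sup>2 * ?q)
          + (Kd * ?h * ?p) * (L * ?h * ?q)"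
        by (rule add_mono[OF add_mono[OF mult_mono[OF df gy] mult_mono[OF Kf[OF vI] dg]]
              mult_mono[OF conjunct2[OF Kd[OF mem vI]] L[OF y h'(2) vJ]]])
          (use pq \<open>M1 > 0\<close> \<open>Kf \<ge> 0\<close> \<open>Kd \<ge> 0\<close> in \<open>auto intro!: mult_nonneg_nonneg\<close>)
      also have "\<dots> = C * (?h\<^sup>2 * (?p * ?q))"
        unfolding C_def by (simp add: algebra_simps power2_eq_square)
      also have "\<dots> \<le> M * (?h\<^sup>2 * (?p * ?q))"
        using pq \<open>M1 > 0\<close> \<open>M2 > 0\<close> by (intro mult_right_mono) (auto simp: M_def)
      also have "?p * ?q = (\<Prod>i\<in>I \<union> J. nrm E (v i))"
        using mult rat_finite[OF mult(1)] rat_finite[OF mult(2)]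
        by (subst prod.union_disjoint) auto
      finally show "nrm X (f y v \<odot> g y v - f x v \<odot> g x v - ?D x ?v)
        \<le> M * ?h\<^sup>2 * (\<Prod>i\<in>I \<union> J. nrm E (v i))" by (simp only: mult.assoc)
    qed
    moreover have "M > 0" using \<open>M1 > 0\<close> \<open>M2 > 0\<close> \<open>C \<ge> 0\<close> by (simp add: M_def)
    ultimately show ?thesis by blast
  qed
  moreover have "rat E U (insert 0 (Suc ` (I \<union> J))) ?D"
  proof (rule rat.add)
    have "insert 0 (Suc ` I) \<inter> Suc ` J = {}" "Suc ` I \<inter> insert 0 (Suc ` J) = {}"
      using mult by auto
    then have "rat E U (insert 0 (Suc ` I) \<union> Suc ` J) (\<lambda>x v. f' x v \<odot> g x (v \<circ> Suc))"
      "rat E U (Suc ` I \<union> insert 0 (Suc ` J)) (\<lambda>x v. f x (v \<circ> Suc) \<odot> g' x v)"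
      using rat.mult[OF f'(1) rat_shift[OF mult(2)]] rat.mult[OF rat_shift[OF mult(1)] g'(1)] by auto
    then show "rat E U (insert 0 (Suc ` (I \<union> J))) (\<lambda>x v. f' x v \<odot> g x (v \<circ> Suc))"
      "rat E U (insert 0 (Suc ` (I \<union> J))) (\<lambda>x v. f x (v \<circ> Suc) \<odot> g' x v)"
      by (simp_all add: image_Un)
  qed
  ultimately show ?case by blast
next
  case (post l I f)
  interpret E: nspace_on E by fact
  obtain f' where f': "rat E U (insert 0 (Suc ` I)) f'" "\<And>x. x \<in> U \<Longrightarrow> \<exists>M>0. quad_deriv E U I f f' x M"
    using post by blast
  obtain K where "0 \<le> K" and K: "\<And>x. x \<in> vecs X \<Longrightarrow> nrm X (l x) \<le> K * nrm X x"
    using bounded_linear_nspaceE[OF post(1)] by blast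
  have ladd: "l (a + b) = l a + l b" if "a \<in> vecs X" "b \<in> vecs X" for a b
    using post(1) that by (auto simp: bounded_linear_nspace_def)
  have ldiff: "l (a - b) = l a - l b" if "a \<in> vecs X" "b \<in> vecs X" for a b
    using ladd[of "a - b" b] that by simp
  have "\<exists>M>0. quad_deriv E U I (\<lambda>x v. l (f x v)) (\<lambda>x v. l (f' x v)) x M" if x: "x \<in> U" for x
  proof -
    obtain M where "M > 0" and M: "quad_deriv E U I f f' x M"
      using f'(2)[OF x] by blast
    \<comment> \<open>\<open>K + 1\<close> in place of \<open>K\<close> keeps the constant positive
      and the radius within that of \<open>f\<close>, also for \<open>K < 1\<close>.\<close>
    have "quad_deriv E U I (\<lambda>x v. l (f x v)) (\<lambda>x v. l (f' x v)) x ((K + 1) * M)"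
      unfolding quad_deriv_def
    proof (intro ballI impI allI)
      fix y v assume y: "y \<in> U" and h: "nrm E (y - x) * ((K + 1) * M) < 1" and v: "\<forall>i\<in>I. v i \<in> vecs E"
      let ?h = "nrm E (y - x)" and ?v = "case_nat (y - x) v"
      have "?h * M \<le> ?h * ((K + 1) * M)"
        using \<open>M > 0\<close> \<open>K \<ge> 0\<close> by (intro mult_left_mono) (auto simp: algebra_simps)
      then have h': "?h * M < 1" using h by simp
      have mem: "y - x \<in> vecs E" using x y post by auto
      have cl: "f y v \<in> vecs X" "f x v \<in> vecs X" "f' x ?v \<in> vecs X"
        using v mem x y post
        by (auto intro!: rat_closed[OF f'(1)] rat_closed[OF post(2)] split: nat.split)
      then have "nrm X (l (f y v) - l (f x v) - l (f' x ?v)) = nrm X (l (f y v - f x v - f' x ?v))"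
        by (simp add: ldiff)
      also have "\<dots> \<le> K * nrm X (f y v - f x v - f' x ?v)" using cl by (intro K) auto
      also have "\<dots> \<le> (K + 1) * (M * ?h\<^sup>2 * (\<Prod>i\<in>I. nrm E (v i)))"
        using quad_derivD[OF M y h', of v] v \<open>K \<ge> 0\<close> by (intro mult_mono) auto
      finally show "nrm X (l (f y v) - l (f x v) - l (f' x ?v))
        \<le> (K + 1) * M * ?h\<^sup>2 * (\<Prod>i\<in>I. nrm E (v i))" by (simp add: mult_ac)
    qed
    then show ?thesis using \<open>M > 0\<close> \<open>K \<ge> 0\<close> by (intro exI[of _ "(K + 1) * M"]) auto
  qed
  then show ?case using rat.post[OF post(1) f'(1)] by blast
next
  case (inv f R)
  interpret E: nspace_on E by fact
  obtain f' where f': "rat E U {0} f'" "\<And>x. x \<in> U \<Longrightarrow> \<exists>M>0. quad_deriv E U {} (\<lambda>x v. f x) f' x M"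
    using inv by auto
  have fcl: "f x \<in> vecs X" if "x \<in> U" for x
    using rat_closed[OF inv(1) inv.prems(2) that] by simp
  \<comment> \<open>The formula is what differentiating \<open>f x \<odot> R x = \<one>\<close>
    suggests.\<close>
  let ?D = "\<lambda>x v. - 1 *\<^sub>R (R x \<odot> f' x v \<odot> R x)"
  have Rr: "rat E U {} (\<lambda>x v. R x)" using inv(1,2) by (rule rat.inv)
  have "rat E U (({} \<union> {0}) \<union> {}) (\<lambda>x v. R x \<odot> f' x v \<odot> R x)"
    by (intro rat.mult Rr f') auto
  then have "rat E U {0} (\<lambda>x v. R x \<odot> f' x v \<odot> R x)" by simp
  moreover have "bounded_linear_nspace X X (\<lambda>a. - 1 *\<^sub>R a)"
    by (auto simp: bounded_linear_nspace_def nrm_minus intro!: exI[of _ 1])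
  ultimately have rD: "rat E U {0} ?D" by (rule rat.post[rotated])
  have "\<exists>M>0. quad_deriv E U {} (\<lambda>x v. R x) ?D x M" if x: "x \<in> U" for x
  proof -
    obtain M where "M > 0" and M: "quad_deriv E U {} (\<lambda>x v. f x) f' x M"
      using f'(2)[OF x] by blast
    obtain L where "L > 0" and L: "\<And>y. y \<in> U \<Longrightarrow> nrm E (y - x) * M < 1 \<Longrightarrow>
        nrm X (f y - f x) \<le> L * nrm E (y - x)"
      using rat_lipschitz[OF inv(1) _ inv.prems(1,2) x M \<open>M > 0\<close>] f'(1) by auto
    define r where "r = nrm X (R x)"
    have "r \<ge> 0" by (simp add: r_def)
    \<comment> \<open>Two pieces: \<open>(R y - R x) \<odot> (f y - f x) \<odot> R x\<close>, where
      both differences are of first order, and the remainder of \<open>f\<close> between two copies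
      of \<open>R x\<close>.\<close>
    define C where "C = 2 * r * (L * r) * (L * r) + r * M * r"
    have "C \<ge> 0" unfolding C_def using \<open>r \<ge> 0\<close> \<open>L > 0\<close> \<open>M > 0\<close> by simp
    \<comment> \<open>The summand \<open>2 * L * r\<close> gives \<open>L * ?h * r < 1 / 2\<close>,
      which the absorption argument for \<open>R y\<close> requires.\<close>
    define N where "N = M + 2 * L * r + C"
    have "quad_deriv E U {} (\<lambda>x v. R x) ?D x N"
      unfolding quad_deriv_def
    proof (intro ballI impI allI)
      fix y v assume y: "y \<in> U" and h: "nrm E (y - x) * N < 1"
      let ?h = "nrm E (y - x)" and ?v = "case_nat (y - x) v"
      have "?h * M \<le> ?h * N" "?h * (2 * L * r) \<le> ?h * N"
        using \<open>M > 0\<close> \<open>L > 0\<close> \<open>r \<ge> 0\<close> \<open>C \<ge> 0\<close> by (intro mult_left_mono; simp add: N_def)+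
      then have h': "?h * M < 1" "?h * (2 * L * r) < 1" using h by auto
      have mem: "y - x \<in> vecs E" using x y inv by auto
      have cl: "f x \<in> vecs X" "f y \<in> vecs X" "R x \<in> vecs X" "R y \<in> vecs X" "f' x ?v \<in> vecs X"
        using fcl inv(2) x y mem inv.prems by (auto intro!: rat_closed[OF f'(1)])
      have inv_x: "f x \<odot> R x = \<one>" "R x \<odot> f x = \<one>" and inv_y: "f y \<odot> R y = \<one>" "R y \<odot> f y = \<one>"
        using inv(2) x y by auto
      have Rdiff: "R y - R x = - (R y \<odot> (f y - f x) \<odot> R x)"
      proof -
        have "R y \<odot> (f y - f x) \<odot> R x = (R y \<odot> f y) \<odot> R x - R y \<odot> (f x \<odot> R x)"
          by (simp only: expand)
        then show ?thesis by (simp add: inv_x inv_y)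
      qed
      have d: "nrm X (f y - f x) \<le> L * ?h" using L[OF y h'(1)] .
      have nd: "nrm X (R y - R x) \<le> nrm X (R y) * (L * ?h) * r"
      proof -
        have "nrm X (R y - R x) = nrm X (R y \<odot> (f y - f x) \<odot> R x)"
          unfolding Rdiff by (simp add: nrm_minus)
        also have "\<dots> \<le> nrm X (R y) * nrm X (f y - f x) * nrm X (R x)"
          using cl by (intro nrm_mul3) auto
        also have "\<dots> \<le> nrm X (R y) * (L * ?h) * r"
          using d by (simp add: r_def mult_left_mono mult_right_mono)
        finally show ?thesis .
      qed
      \<comment> \<open>\<open>R y\<close> occurs on both sides: the resolvent identity bounds
        \<open>R y - R x\<close> by half the norm of \<open>R y\<close>, which is then
        absorbed.\<close>
      have Ry: "nrm X (R y) \<le> 2 * r"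
      proof -
        have "nrm X (R y) = nrm X ((R y - R x) + R x)" by simp
        also have "\<dots> \<le> nrm X (R y - R x) + r"
          unfolding r_def using cl by (intro nrm_triangle) auto
        also have "\<dots> \<le> nrm X (R y) * (?h * (2 * L * r)) / 2 + r" using nd by (simp add: mult_ac)
        also have "\<dots> \<le> nrm X (R y) * 1 / 2 + r"
          using h' by (intro add_mono divide_right_mono mult_left_mono) auto
        finally show ?thesis by simp
      qed
      have *: "- ((R y - R x) \<odot> (f y - f x) \<odot> R x) - R x \<odot> (f y - f x - f' x ?v) \<odot> R x
        = - (R y \<odot> (f y - f x) \<odot> R x) + R x \<odot> f' x ?v \<odot> R x"
        by (simp add: expand)
      have eq: "R y - R x - ?D x ?v
        = - ((R y - R x) \<odot> (f y - f x) \<odot> R x) - R x \<odot> (f y - f x - f' x ?v) \<odot> R x"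
        unfolding * Rdiff[symmetric] by simp
      have "nrm X (R y - R x - ?D x ?v) \<le> nrm X ((R y - R x) \<odot> (f y - f x) \<odot> R x)
          + nrm X (R x \<odot> (f y - f x - f' x ?v) \<odot> R x)"
        unfolding eq using cl by (intro order_trans[OF nrm_diff_triangle]) (auto simp: nrm_minus)
      also have "\<dots> \<le> nrm X (R y - R x) * nrm X (f y - f x) * r
          + r * nrm X (f y - f x - f' x ?v) * r"
        unfolding r_def using cl by (intro add_mono nrm_mul3) auto
      also have "\<dots> \<le> (2 * r * (L * ?h) * r) * (L * ?h) * r + r * (M * ?h\<^sup>2) * r"
      proof (intro add_mono mult_right_mono mult_left_mono mult_mono)
        have "nrm X (R y) * (L * ?h) * r \<le> 2 * r * (L * ?h) * r"
          using Ry \<open>L > 0\<close> \<open>r \<ge> 0\<close> by (intro mult_right_mono) auto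
        then show "nrm X (R y - R x) \<le> 2 * r * (L * ?h) * r" using nd by linarith
        show "nrm X (f y - f x - f' x ?v) \<le> M * ?h\<^sup>2"
          using quad_derivD[OF M y h'(1), of v] by simp
      qed (use d \<open>r \<ge> 0\<close> \<open>L > 0\<close> in auto)
      also have "\<dots> = C * ?h\<^sup>2" unfolding C_def by (simp add: algebra_simps power2_eq_square)
      also have "\<dots> \<le> N * ?h\<^sup>2"
        using \<open>M > 0\<close> \<open>L > 0\<close> \<open>r \<ge> 0\<close> by (intro mult_right_mono) (auto simp: N_def)
      finally show "nrm X (R y - R x - ?D x ?v) \<le> N * ?h\<^sup>2 * (\<Prod>i\<in>{}. nrm E (v i))" by simp
    qed
    moreover have "N > 0" using \<open>M > 0\<close> \<open>L > 0\<close> \<open>r \<ge> 0\<close> \<open>C \<ge> 0\<close> by (simp add: N_def add_pos_nonneg)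
    ultimately show ?thesis by blast
  qed
  then show ?case using rD unfolding image_empty by blast
qed

text \<open>Slots of the \<open>n\<close>-th derivative are numbered from 0, newest first. This is
  the order of \<open>smooth_on\<close>, which conses each direction onto the list, so indexing into
  that list is the slot assignment.\<close>

lemma rat_smooth_on:
  assumes "rat E U {} (\<lambda>x v. f x)" "nspace_on E" "openin (ntop E) U"
  shows "smooth_on E X U f"
proof -
  interpret E: nspace_on E by fact
  have U: "U \<subseteq> vecs E" using openin_subset[OF assms(3)] by simp
  have "\<exists>D. \<forall>n. (rat E U {..<n} (D n) \<and> (n = 0 \<longrightarrow> D n = (\<lambda>x v. f x))) \<and>
     (\<forall>x\<in>U. \<exists>M>0. quad_deriv E U {..<n} (D n) (D (Suc n)) x M)"
  proof (rule dependent_nat_choice[where P = "\<lambda>n g. rat E U {..<n} g \<and> (n = 0 \<longrightarrow> g = (\<lambda>x v. f x))"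
        and Q = "\<lambda>n g g'. \<forall>x\<in>U. \<exists>M>0. quad_deriv E U {..<n} g g' x M"])
    show "\<exists>g. rat E U {..<0} g \<and> (0 = (0::nat) \<longrightarrow> g = (\<lambda>x v. f x))"
      using assms(1) by (intro exI[of _ "\<lambda>x v. f x"]) simp
  next
    fix g n assume "rat E U {..<n} g \<and> (n = 0 \<longrightarrow> g = (\<lambda>x v. f x))"
    then show "\<exists>g'. (rat E U {..<Suc n} g' \<and> (Suc n = 0 \<longrightarrow> g' = (\<lambda>x v. f x))) \<and>
        (\<forall>x\<in>U. \<exists>M>0. quad_deriv E U {..<n} g g' x M)"
      using rat_differentiable[of E U "{..<n}" g] assms(2) U
      by (simp only: lessThan_Suc_eq_insert_0 nat.distinct simp_thms)
  qed
  then obtain D where *: "\<forall>n. (rat E U {..<n} (D n) \<and> (n = 0 \<longrightarrow> D n = (\<lambda>x v. f x))) \<and>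
     (\<forall>x\<in>U. \<exists>M>0. quad_deriv E U {..<n} (D n) (D (Suc n)) x M)"
    by (rule exE)
  have D0: "D 0 = (\<lambda>x v. f x)" and D: "rat E U {..<n} (D n)"
    and D': "x \<in> U \<Longrightarrow> \<exists>M>0. quad_deriv E U {..<n} (D n) (D (Suc n)) x M" for n x
    using *[rule_format, of 0] *[rule_format, of n] by simp_all
  have prod: "(\<Prod>i<n. nrm E (vs ! i)) = prod_list (map (nrm E) vs)" if "length vs = n" for vs n
    using that by (simp add: prod.list_conv_set_nth atLeast0LessThan)
  have upd: "(!) (vs[i := z]) = ((!) vs)(i := z)" if "i < length vs" for vs :: "'b list" and i z
    using that by (auto simp: fun_eq_iff nth_list_update)
  have mem: "\<forall>i\<in>{..<n}. vs ! i \<in> vecs E" if "vs \<in> lists_of E n" for vs n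
    using that by (force simp: lists_of_def)
  show ?thesis
    unfolding smooth_on_def
  proof (intro conjI assms(3) exI[of _ "\<lambda>n x vs. D n x (nth vs)"] allI ballI impI)
    fix x assume "x \<in> U"
    show "D 0 x ((!) []) = f x" by (simp add: D0)
  next
    fix n x assume x: "x \<in> U"
    show "bounded_multilinear_nspace E X n (\<lambda>vs. D n x ((!) vs))"
      unfolding bounded_multilinear_nspace_def
    proof (intro conjI ballI allI impI)
      fix vs assume vs: "vs \<in> lists_of E n"
      show "D n x ((!) vs) \<in> vecs X"
        using mem[OF vs] by (intro rat_closed[OF D U x]) auto
    next
      fix vs i a b assume vs: "vs \<in> lists_of E n" and "i < n" "a \<in> vecs E" "b \<in> vecs E"
      moreover from this have len: "i < length vs" by (simp add: lists_of_def)
      ultimately show "D n x ((!) (vs[i := a + b])) = D n x ((!) (vs[i := a])) + D n x ((!) (vs[i := b]))"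
        using rat_linear[OF D assms(2) U x, of n "(!) vs" i a b] mem[OF vs] len
        by (simp only: upd lessThan_iff simp_thms)
    next
      fix vs i a c assume vs: "vs \<in> lists_of E n" and "i < n" "a \<in> vecs E"
      moreover from this have len: "i < length vs" by (simp add: lists_of_def)
      ultimately show "D n x ((!) (vs[i := c *\<^sub>R a])) = c *\<^sub>R D n x ((!) (vs[i := a]))"
        using rat_linear[OF D assms(2) U x, of n "(!) vs" i a a] mem[OF vs] len
        by (simp only: upd lessThan_iff simp_thms)
    next
      obtain K where K: "\<And>v. (\<forall>i\<in>{..<n}. v i \<in> vecs E) \<Longrightarrow> nrm X (D n x v) \<le> K * (\<Prod>i<n. nrm E (v i))"
        using rat_bounded[OF D assms(2) U x] by blast
      have "nrm X (D n x ((!) vs)) \<le> K * prod_list (map (nrm E) vs)" if "vs \<in> lists_of E n" for vs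
        using K[of "(!) vs"] mem[OF that] prod[of vs n] that by (simp add: lists_of_def)
      then show "\<exists>K. \<forall>vs\<in>lists_of E n. nrm X (D n x ((!) vs)) \<le> K * prod_list (map (nrm E) vs)"
        by blast
    qed
  next
    fix n x and e :: real assume x: "x \<in> U" and e: "e > 0"
    obtain M where "M > 0" and M: "quad_deriv E U {..<n} (D n) (D (Suc n)) x M"
      using D'[OF x] by blast
    show "\<exists>d>0. \<forall>y\<in>U. nrm E (y - x) < d \<longrightarrow> (\<forall>vs\<in>lists_of E n.
       nrm X (D n y ((!) vs) - D n x ((!) vs) - D (Suc n) x ((!) ((y - x) # vs)))
         \<le> e * nrm E (y - x) * prod_list (map (nrm E) vs))"
    \<comment> \<open>The first entry validates the quadratic bound, the second trades one of its
      two factors \<open>nrm E (y - x)\<close> for \<open>e\<close>.\<close>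
    proof (intro exI[of _ "min (1 / M) (e / M)"] conjI ballI impI)
      show "0 < min (1 / M) (e / M)" using e \<open>M > 0\<close> by simp
      fix y vs assume y: "y \<in> U" and h: "nrm E (y - x) < min (1 / M) (e / M)"
        and vs: "vs \<in> lists_of E n"
      have h': "nrm E (y - x) * M < 1" "nrm E (y - x) * M \<le> e"
        using h \<open>M > 0\<close> by (auto simp: field_simps)
      have "(!) ((y - x) # vs) = case_nat (y - x) ((!) vs)"
        by (auto simp: fun_eq_iff nth_Cons split: nat.split)
      then have "nrm X (D n y ((!) vs) - D n x ((!) vs) - D (Suc n) x ((!) ((y - x) # vs)))
        \<le> M * (nrm E (y - x))\<^sup>2 * prod_list (map (nrm E) vs)"
        using quad_derivD[OF M y h'(1), of "(!) vs"] mem[OF vs] vs prod[of vs n]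
        by (simp add: lists_of_def)
      also have "\<dots> = (nrm E (y - x) * M) * (nrm E (y - x) * prod_list (map (nrm E) vs))"
        by (simp add: power2_eq_square mult_ac)
      also have "\<dots> \<le> e * (nrm E (y - x) * prod_list (map (nrm E) vs))"
        using h' by (intro mult_right_mono mult_nonneg_nonneg prod_list_nonneg) auto
      finally show "nrm X (D n y ((!) vs) - D n x ((!) vs) - D (Suc n) x ((!) ((y - x) # vs)))
        \<le> e * nrm E (y - x) * prod_list (map (nrm E) vs)" by (simp add: mult_ac)
    qed
  qed
qed

section \<open>Rational maps without slots\<close>

abbreviation rational :: "'w::real_vector nspace \<Rightarrow> 'w set \<Rightarrow> ('w \<Rightarrow> 'v) \<Rightarrow> bool" where
  "rational E U f \<equiv> rat E U {} (\<lambda>x v. f x)"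

lemma bounded_linear_ident: "bounded_linear_nspace X X (\<lambda>a. a)"
  unfolding bounded_linear_nspace_def by (intro conjI ballI allI exI[of _ 1]) simp_all

lemma bounded_linear_scaleR: "bounded_linear_nspace X X (\<lambda>a. c *\<^sub>R a)"
  unfolding bounded_linear_nspace_def
  by (intro conjI ballI allI exI[of _ "\<bar>c\<bar>"]) (simp_all add: nrm_scaleR scaleR_add_right)

lemma rational_mult: "rational E U f \<Longrightarrow> rational E U g \<Longrightarrow> rational E U (\<lambda>x. f x \<odot> g x)"
  using rat.mult[of E U "{}" "\<lambda>x v. f x" "{}" "\<lambda>x v. g x"] by simp

lemma rational_scaleR: "rational E U f \<Longrightarrow> rational E U (\<lambda>x. c *\<^sub>R f x)"
  by (rule rat.post[OF bounded_linear_scaleR])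

lemma rational_star: "rational E U f \<Longrightarrow> rational E U (\<lambda>x. (f x)\<^sup>\<sharp>)"
  by (rule rat.post[OF bounded_linear_star])

lemma rational_diff:
  assumes "rational E U f" "rational E U g"
  shows "rational E U (\<lambda>x. f x - g x)"
proof -
  have "rational E U (\<lambda>x. f x + - 1 *\<^sub>R g x)"
    by (rule rat.add[OF assms(1) rational_scaleR[OF assms(2)]])
  then show ?thesis by simp
qed

lemma rational_ident: "rational X U (\<lambda>x. x)"
  by (rule rat.var[OF bounded_linear_ident])

lemma rational_inverse_in:
  "rational E U f \<Longrightarrow> (\<And>x. x \<in> U \<Longrightarrow> invertible_in (f x)) \<Longrightarrow> rational E U (\<lambda>x. inverse_in (f x))"
  by (rule rat.inv) (auto simp: inverse_in)

lemmas rational_intros = rational_ident rat.const rat.add rational_diff rational_mult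
  rational_star rational_scaleR rational_inverse_in

text \<open>If \<open>b\<close> inverts \<open>f x\<close>, then
  \<open>b \<odot> f y = \<one> - b \<odot> (f x - f y)\<close>, which is invertible by
  \<open>neumann\<close> once \<open>f y\<close> is close to \<open>f x\<close>; the Lipschitz bound
  supplies the continuity.\<close>

lemma openin_invertible:
  assumes f: "rational E (vecs E) f" and E: "nspace_on E"
  shows "openin (ntop E) {x \<in> vecs E. invertible_in (f x)}"
proof -
  interpret E: nspace_on E by fact
  show ?thesis
    unfolding E.openin_ntop
  proof (intro conjI ballI)
    fix x assume "x \<in> {x \<in> vecs E. invertible_in (f x)}"
    then have x: "x \<in> vecs E" and "invertible_in (f x)" by auto
    then obtain b where b: "b \<in> vecs X" "f x \<odot> b = \<one>" "b \<odot> f x = \<one>"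
      by (auto simp: invertible_in_def)
    obtain f' where f': "rat E (vecs E) (insert 0 (Suc ` {})) f'"
      and ex: "\<forall>x\<in>vecs E. \<exists>M>0. quad_deriv E (vecs E) {} (\<lambda>x v. f x) f' x M"
      using rat_differentiable[OF f E order_refl] by blast
    then obtain M where "M > 0" and M: "quad_deriv E (vecs E) {} (\<lambda>x v. f x) f' x M"
      using x by blast
    obtain L where "L > 0" and L: "\<And>y. y \<in> vecs E \<Longrightarrow> nrm E (y - x) * M < 1 \<Longrightarrow>
        nrm X (f y - f x) \<le> L * nrm E (y - x)"
      using rat_lipschitz[OF f f' E order_refl x M \<open>M > 0\<close>] by auto
    \<comment> \<open>The second entry makes \<open>b \<odot> (f x - f y)\<close> shorter than 1;
      adding 1 to the norm of \<open>b\<close> avoids a zero denominator.\<close>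
    define d where "d = min (1 / M) (1 / (L * (nrm X b + 1)))"
    have "d > 0" using \<open>M > 0\<close> \<open>L > 0\<close> by (simp add: d_def add_nonneg_pos)
    moreover have "invertible_in (f y)" if y: "y \<in> vecs E" and h: "nrm E (y - x) < d" for y
    proof -
      have cl: "f x \<in> vecs X" "f y \<in> vecs X" using rat_closed[OF f order_refl] x y by auto
      have "nrm E (y - x) * M < 1" and h': "nrm E (y - x) * (L * (nrm X b + 1)) < 1"
        using h \<open>M > 0\<close> \<open>L > 0\<close> nrm_nonneg[of b]
        by (auto simp: d_def pos_less_divide_eq add_nonneg_pos simp del: nrm_nonneg)
      then have "nrm X (f x - f y) \<le> L * nrm E (y - x)"
        using L[OF y] nrm_diff_commute[of "f x"] by simp
      then have "nrm X (b \<odot> (f x - f y)) \<le> (nrm X b + 1) * (L * nrm E (y - x))"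
        using nrm_mul[of b "f x - f y"] b cl
          mult_mono[of "nrm X b" "nrm X b + 1" "nrm X (f x - f y)" "L * nrm E (y - x)"] by fastforce
      then have "nrm X (b \<odot> (f x - f y)) < 1" using h' by (simp add: mult_ac)
      then obtain c where c: "c \<in> vecs X" "(\<one> - b \<odot> (f x - f y)) \<odot> c = \<one>"
        "c \<odot> (\<one> - b \<odot> (f x - f y)) = \<one>"
        using neumann[of "b \<odot> (f x - f y)"] b cl by auto
      have "\<one> - b \<odot> (f x - f y) = b \<odot> f y" using b by (simp add: mul_diff_right)
      then have c': "b \<odot> (f y \<odot> c) = \<one>" "c \<odot> (b \<odot> f y) = \<one>"
        using c by (simp_all add: mul_assoc)
      \<comment> \<open>So far \<open>c \<odot> b\<close> is only a left inverse of
        \<open>f y\<close>. Multiplying \<open>b \<odot> (f y \<odot> c) = \<one>\<close> by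
        \<open>f x\<close> makes it a right inverse as well.\<close>
      have "f y \<odot> c = f x \<odot> (b \<odot> (f y \<odot> c))"
        using b by (simp add: mul_assoc[symmetric])
      then have "f y \<odot> c = f x" by (simp only: c' mul_one)
      then have "f y \<odot> (c \<odot> b) = \<one>" using b by (simp add: mul_assoc[symmetric])
      moreover have "(c \<odot> b) \<odot> f y = \<one>" using c' by (simp add: mul_assoc)
      ultimately show ?thesis
        unfolding invertible_in_def using c b by (intro bexI[of _ "c \<odot> b"]) auto
    qed
    ultimately show "\<exists>d>0. \<forall>y\<in>vecs E. nrm E (y - x) < d \<longrightarrow> y \<in> {x \<in> vecs E. invertible_in (f x)}"
      by auto
  qed auto
qed

section \<open>Isometries, unitaries and orbits\<close>

definition isometries :: "'v set" where
  "isometries = {T \<in> vecs X. T\<^sup>\<sharp> \<odot> T = \<one>}"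

definition unitaries :: "'v set" where
  "unitaries = {G \<in> vecs X. G\<^sup>\<sharp> \<odot> G = \<one> \<and> G \<odot> G\<^sup>\<sharp> = \<one>}"

definition orbit :: "'v \<Rightarrow> 'v set" where
  "orbit T = {G \<odot> T | G. G \<in> unitaries}"

lemma unitaries_mult:
  assumes "G \<in> unitaries" "H \<in> unitaries"
  shows "G \<odot> H \<in> unitaries"
proof -
  have cl: "G \<in> vecs X" "H \<in> vecs X" using assms by (simp_all add: unitaries_def)
  have "(G \<odot> H)\<^sup>\<sharp> \<odot> (G \<odot> H) = H\<^sup>\<sharp> \<odot> ((G\<^sup>\<sharp> \<odot> G) \<odot> H)"
    "(G \<odot> H) \<odot> (G \<odot> H)\<^sup>\<sharp> = G \<odot> ((H \<odot> H\<^sup>\<sharp>) \<odot> G\<^sup>\<sharp>)"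
    using cl by (simp_all add: star_mul mul_assoc)
  then show ?thesis using assms by (simp add: unitaries_def)
qed

lemma unitaries_star: "G \<in> unitaries \<Longrightarrow> G\<^sup>\<sharp> \<in> unitaries"
  by (simp add: unitaries_def)

lemma orbit_subset_isometries:
  assumes "T \<in> isometries"
  shows "orbit T \<subseteq> isometries"
proof
  fix S assume "S \<in> orbit T"
  then obtain G where G: "G \<in> unitaries" and S: "S = G \<odot> T" by (auto simp: orbit_def)
  have cl: "G \<in> vecs X" "T \<in> vecs X" using G assms by (simp_all add: unitaries_def isometries_def)
  have "S\<^sup>\<sharp> \<odot> S = T\<^sup>\<sharp> \<odot> ((G\<^sup>\<sharp> \<odot> G) \<odot> T)"
    using cl by (simp add: S star_mul mul_assoc)
  then show "S \<in> isometries" using G assms by (simp add: S isometries_def unitaries_def)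
qed

lemma orbit_eq:
  assumes "S \<in> orbit T"
  shows "orbit S = orbit T"
proof -
  obtain G where G: "G \<in> unitaries" and S: "S = G \<odot> T" using assms by (auto simp: orbit_def)
  have T: "T = G\<^sup>\<sharp> \<odot> S" using G by (simp add: S unitaries_def mul_assoc[symmetric])
  show ?thesis
  proof
    show "orbit S \<subseteq> orbit T"
      using unitaries_mult[OF _ G] by (auto simp: orbit_def S mul_assoc[symmetric])
    show "orbit T \<subseteq> orbit S"
      unfolding T orbit_def using unitaries_mult[OF _ unitaries_star[OF G]]
      by (auto simp: mul_assoc[symmetric])
  qed
qed

lemma one_unitary [simp]: "\<one> \<in> unitaries"
  by (simp add: unitaries_def)

lemma self_in_orbit: "T \<in> orbit T"
  unfolding orbit_def using one_unitary by (auto intro!: exI[of _ \<one>])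

lemma unitaries_eq_orbit_one: "unitaries = orbit \<one>"
  by (simp add: orbit_def)

text \<open>The star turns \<open>\<one> - k\<close> into \<open>\<one> + k\<close>, and the two
  commute, so the star of the transform is its inverse. The inverse \<open>b\<close> has to be
  given: in pairs of reals with the swap as involution, \<open>k = (1, -1)\<close> is skew while
  \<open>\<one> - k\<close> is singular.\<close>

lemma cayley_unitary:
  assumes k: "k \<in> vecs X" "k\<^sup>\<sharp> = - k" and b: "b \<in> vecs X" "(\<one> - k) \<odot> b = \<one>" "b \<odot> (\<one> - k) = \<one>"
  shows "(\<one> + k) \<odot> b \<in> unitaries"
proof -
  have "b\<^sup>\<sharp> \<odot> (\<one> + k) = ((\<one> - k) \<odot> b)\<^sup>\<sharp>" using k b(1) by (simp add: star_mul star_diff)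
  then have c1: "b\<^sup>\<sharp> \<odot> (\<one> + k) = \<one>" by (simp add: b)
  have "(\<one> + k) \<odot> b\<^sup>\<sharp> = (b \<odot> (\<one> - k))\<^sup>\<sharp>" using k b(1) by (simp add: star_mul star_diff)
  then have c2: "(\<one> + k) \<odot> b\<^sup>\<sharp> = \<one>" by (simp add: b)
  have comm: "(\<one> - k) \<odot> (\<one> + k) = (\<one> + k) \<odot> (\<one> - k)" by (simp add: expand)
  have "b \<odot> (\<one> + k) = b \<odot> ((\<one> + k) \<odot> (\<one> - k)) \<odot> b" by (simp add: mul_assoc b)
  also have "\<dots> = (b \<odot> (\<one> - k)) \<odot> ((\<one> + k) \<odot> b)" by (simp only: comm[symmetric] mul_assoc)
  finally have bk: "b \<odot> (\<one> + k) = (\<one> + k) \<odot> b" by (simp add: b)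
  have st: "((\<one> + k) \<odot> b)\<^sup>\<sharp> = b\<^sup>\<sharp> \<odot> (\<one> - k)" using k b by (simp add: star_expand)
  have "b\<^sup>\<sharp> \<odot> (\<one> - k) \<odot> ((\<one> + k) \<odot> b) = b\<^sup>\<sharp> \<odot> ((\<one> - k) \<odot> (\<one> + k)) \<odot> b"
    by (simp only: mul_assoc)
  also have "\<dots> = (b\<^sup>\<sharp> \<odot> (\<one> + k)) \<odot> ((\<one> - k) \<odot> b)" by (simp only: comm mul_assoc)
  finally have 1: "b\<^sup>\<sharp> \<odot> (\<one> - k) \<odot> ((\<one> + k) \<odot> b) = \<one>" by (simp add: c1 b)
  have "(\<one> + k) \<odot> b \<odot> (b\<^sup>\<sharp> \<odot> (\<one> - k)) = b \<odot> ((\<one> + k) \<odot> b\<^sup>\<sharp>) \<odot> (\<one> - k)"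
    by (simp only: bk[symmetric] mul_assoc)
  then have 2: "(\<one> + k) \<odot> b \<odot> (b\<^sup>\<sharp> \<odot> (\<one> - k)) = \<one>" by (simp add: c2 b)
  show ?thesis unfolding unitaries_def using k b 1 2 by (simp add: st)
qed

section \<open>Cayley charts\<close>

text \<open>Writing \<open>T = t x + y\<close> with \<open>x = t\<^sup>\<sharp> T\<close> and \<open>y = q T\<close>, where \<open>q = 1 - t t\<^sup>\<sharp>\<close>, isometries are
  the solutions of \<open>x\<^sup>\<sharp> x + y\<^sup>\<sharp> y = 1\<close>. This is a noncommutative sphere, and the chart is the
  Cayley transform to the Heisenberg picture: with \<open>u = (1 - x) (1 + x)\<^sup>-\<^sup>1 = 2 (1 + x)\<^sup>-\<^sup>1 - 1\<close> and
  \<open>w = y (1 + x)\<^sup>-\<^sup>1\<close> the equation says that \<open>u - w\<^sup>\<sharp> w\<close> is skew.\<close>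

context
  fixes t :: 'v
  assumes t: "t \<in> vecs X" and tt: "t\<^sup>\<sharp> \<odot> t = \<one>"
begin

definition defect :: 'v where "defect = \<one> - t \<odot> t\<^sup>\<sharp>"

definition chart_dom :: "'v set" where
  "chart_dom = {T \<in> vecs X. invertible_in (\<one> + t\<^sup>\<sharp> \<odot> T)}"

definition chart_cod :: "'v set" where
  "chart_cod = {Y \<in> vecs X.
     invertible_in (\<one> + t\<^sup>\<sharp> \<odot> Y + (defect \<odot> Y)\<^sup>\<sharp> \<odot> (defect \<odot> Y))}"

definition cay :: "'v \<Rightarrow> 'v" where "cay T = inverse_in (\<one> + t\<^sup>\<sharp> \<odot> T)"

definition hor :: "'v \<Rightarrow> 'v" where "hor T = defect \<odot> T \<odot> cay T"

text \<open>This is \<open>t (u - w\<^sup>\<sharp> w) + w\<close>: subtracting the square of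
  \<open>w\<close> from \<open>u\<close> makes the isometry condition linear in the value of the
  chart, and leaves \<open>w\<close> free.\<close>

definition chart :: "'v \<Rightarrow> 'v" where
  "chart T = t \<odot> (2 *\<^sub>R cay T - \<one> - (hor T)\<^sup>\<sharp> \<odot> hor T) + hor T"

text \<open>From \<open>Y\<close> one recovers \<open>w = defect \<odot> Y\<close> and
  \<open>u = t\<^sup>\<sharp> \<odot> Y + w\<^sup>\<sharp> \<odot> w\<close>. The relation between
  \<open>x\<close> and \<open>u\<close> is symmetric, so
  \<open>1 + x = 2 (1 + u)\<^sup>-\<^sup>1\<close>, and \<open>y = w (1 + x)\<close>; then
  \<open>t x + y\<close> is the formula.\<close>

definition unchart :: "'v \<Rightarrow> 'v" where
  "unchart Y = 2 *\<^sub>R ((t + defect \<odot> Y) \<odot>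
     inverse_in (\<one> + t\<^sup>\<sharp> \<odot> Y + (defect \<odot> Y)\<^sup>\<sharp> \<odot> (defect \<odot> Y))) - t"

text \<open>The isometry equation linearised at \<open>t\<close>: it is the model space of the chart
  and will turn out to be the tangent space.\<close>

definition skew_along :: "'v set" where
  "skew_along = {v \<in> vecs X. t\<^sup>\<sharp> \<odot> v + v\<^sup>\<sharp> \<odot> t = 0}"

lemma tt': "t\<^sup>\<sharp> \<odot> (t \<odot> z) = z"
  by (simp add: mul_assoc[symmetric] tt)

lemma defect_closed [simp]: "defect \<in> vecs X"
  using t by (simp add: defect_def)

lemma defect_rules:
  "defect\<^sup>\<sharp> = defect" "defect \<odot> t = 0" "defect \<odot> (t \<odot> z) = 0" "t\<^sup>\<sharp> \<odot> defect = 0"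
  "t\<^sup>\<sharp> \<odot> (defect \<odot> z) = 0" "defect \<odot> defect = defect" "defect \<odot> (defect \<odot> z) = defect \<odot> z"
  using t by (simp_all add: defect_def star_expand expand tt tt')

lemmas iso_rules = tt tt' defect_rules

lemma defect_mult: "t \<odot> (t\<^sup>\<sharp> \<odot> z) = z - defect \<odot> z"
  by (simp add: defect_def expand)

lemma cay:
  assumes "T \<in> chart_dom"
  shows "cay T \<in> vecs X" "cay T + t\<^sup>\<sharp> \<odot> T \<odot> cay T = \<one>" "cay T + cay T \<odot> (t\<^sup>\<sharp> \<odot> T) = \<one>"
    "(\<one> + t\<^sup>\<sharp> \<odot> T) \<odot> cay T = \<one>" "cay T \<odot> (\<one> + t\<^sup>\<sharp> \<odot> T) = \<one>"
  using assms inverse_in[of "\<one> + t\<^sup>\<sharp> \<odot> T"]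
  by (simp_all add: chart_dom_def cay_def mul_add_left mul_add_right)

lemma hor:
  assumes "T \<in> chart_dom"
  shows "hor T \<in> vecs X" "defect \<odot> hor T = hor T" "t\<^sup>\<sharp> \<odot> hor T = 0" "(hor T)\<^sup>\<sharp> \<odot> t = 0"
    "(hor T)\<^sup>\<sharp> \<odot> defect = (hor T)\<^sup>\<sharp>"
    "hor T \<odot> (\<one> + t\<^sup>\<sharp> \<odot> T) = defect \<odot> T"
proof -
  have T: "T \<in> vecs X" using assms by (simp add: chart_dom_def)
  show h: "hor T \<in> vecs X" using T cay(1)[OF assms] by (simp add: hor_def)
  show d: "defect \<odot> hor T = hor T" and tw: "t\<^sup>\<sharp> \<odot> hor T = 0"
    by (simp_all add: hor_def mul_assoc iso_rules)
  show "(hor T)\<^sup>\<sharp> \<odot> t = 0" using arg_cong[OF tw, of star] t h by (simp add: star_mul)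
  show "(hor T)\<^sup>\<sharp> \<odot> defect = (hor T)\<^sup>\<sharp>" using arg_cong[OF d, of star] h by (simp add: star_mul iso_rules)
  have "hor T \<odot> (\<one> + t\<^sup>\<sharp> \<odot> T) = defect \<odot> T \<odot> (cay T \<odot> (\<one> + t\<^sup>\<sharp> \<odot> T))"
    unfolding hor_def by (simp only: mul_assoc)
  then show "hor T \<odot> (\<one> + t\<^sup>\<sharp> \<odot> T) = defect \<odot> T" by (simp only: cay(5)[OF assms] mul_one)
qed

lemma chart:
  assumes "T \<in> chart_dom"
  shows "chart T \<in> vecs X" "defect \<odot> chart T = hor T"
    "t\<^sup>\<sharp> \<odot> chart T = 2 *\<^sub>R cay T - \<one> - (hor T)\<^sup>\<sharp> \<odot> hor T"
  using t cay(1)[OF assms] hor[OF assms]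
  by (simp_all add: chart_def mul_add_right iso_rules)

lemma unchart_chart:
  assumes "T \<in> chart_dom"
  shows "chart T \<in> chart_cod" "unchart (chart T) = T"
proof -
  have T: "T \<in> vecs X" using assms by (simp add: chart_dom_def)
  \<comment> \<open>The square of \<open>hor T\<close> cancels and \<open>1 + u\<close> is left, so
    the inverse is half of \<open>\<one> + t\<^sup>\<sharp> \<odot> T\<close>.\<close>
  have den: "\<one> + t\<^sup>\<sharp> \<odot> chart T + (defect \<odot> chart T)\<^sup>\<sharp> \<odot> (defect \<odot> chart T) = 2 *\<^sub>R cay T"
    using chart[OF assms] by simp
  have e: "(1/2) *\<^sub>R (\<one> + t\<^sup>\<sharp> \<odot> T) \<in> vecs X" "2 *\<^sub>R cay T \<odot> ((1/2) *\<^sub>R (\<one> + t\<^sup>\<sharp> \<odot> T)) = \<one>"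
    "((1/2) *\<^sub>R (\<one> + t\<^sup>\<sharp> \<odot> T)) \<odot> 2 *\<^sub>R cay T = \<one>"
    using t T cay(4,5)[OF assms] by (auto simp only: mul_scaleR_left mul_scaleR_right) simp_all
  show "chart T \<in> chart_cod"
    unfolding chart_cod_def mem_Collect_eq den invertible_in_def using e chart(1)[OF assms] by blast
  have "unchart (chart T) = (t + hor T) \<odot> (\<one> + t\<^sup>\<sharp> \<odot> T) - t"
    unfolding unchart_def den inverse_in_eq[OF e] unfolding chart(2)[OF assms]
    by (simp add: mul_scaleR_right)
  also have "\<dots> = t \<odot> (t\<^sup>\<sharp> \<odot> T) + hor T \<odot> (\<one> + t\<^sup>\<sharp> \<odot> T)"
    by (simp add: mul_add_left mul_add_right)
  finally show "unchart (chart T) = T" by (simp add: hor(6)[OF assms] defect_mult)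
qed

lemma chart_unchart:
  assumes "Y \<in> chart_cod"
  shows "unchart Y \<in> chart_dom" "chart (unchart Y) = Y"
proof -
  define w where "w = defect \<odot> Y"
  define u where "u = t\<^sup>\<sharp> \<odot> Y + w\<^sup>\<sharp> \<odot> w"
  define e where "e = inverse_in (\<one> + u)"
  have Y: "Y \<in> vecs X" and "invertible_in (\<one> + u)"
    using assms by (simp_all add: chart_cod_def u_def w_def add.assoc)
  then have e: "e \<in> vecs X" "(\<one> + u) \<odot> e = \<one>" "e \<odot> (\<one> + u) = \<one>"
    using inverse_in unfolding e_def by blast+
  have w: "w \<in> vecs X" using Y by (simp add: w_def)
  have u: "u \<in> vecs X" using Y w t by (simp add: u_def)
  have T: "unchart Y = 2 *\<^sub>R ((t + w) \<odot> e) - t"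
    by (simp add: unchart_def e_def u_def w_def add.assoc)
  have Tcl: "unchart Y \<in> vecs X" using t w e by (simp add: T)
  have tw: "t\<^sup>\<sharp> \<odot> (w \<odot> z) = 0" "t\<^sup>\<sharp> \<odot> w = 0" "defect \<odot> w = w" "defect \<odot> (w \<odot> z) = w \<odot> z" for z
    by (simp_all add: w_def mul_assoc iso_rules)
  have tT: "\<one> + t\<^sup>\<sharp> \<odot> unchart Y = 2 *\<^sub>R e"
    by (simp add: T expand iso_rules tw)
  have r: "(1/2) *\<^sub>R (\<one> + u) \<in> vecs X" "2 *\<^sub>R e \<odot> ((1/2) *\<^sub>R (\<one> + u)) = \<one>"
    "((1/2) *\<^sub>R (\<one> + u)) \<odot> 2 *\<^sub>R e = \<one>"
    using u e by (auto simp only: mul_scaleR_left mul_scaleR_right) simp_all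
  show dom: "unchart Y \<in> chart_dom"
    unfolding chart_dom_def mem_Collect_eq tT invertible_in_def using r Tcl by blast
  have cay: "cay (unchart Y) = (1/2) *\<^sub>R (\<one> + u)"
    unfolding cay_def tT by (rule inverse_in_eq[OF r])
  have "defect \<odot> unchart Y = 2 *\<^sub>R (w \<odot> e)"
    by (simp add: T expand iso_rules tw)
  then have hor: "hor (unchart Y) = w"
    unfolding hor_def cay using e by (simp add: mul_assoc mul_scaleR_left mul_scaleR_right)
  have "chart (unchart Y) = t \<odot> (t\<^sup>\<sharp> \<odot> Y) + defect \<odot> Y"
    unfolding chart_def hor cay by (simp add: u_def w_def)
  then show "chart (unchart Y) = Y" by (simp add: defect_mult)
qed

text \<open>For \<open>z = \<one> + t\<^sup>\<sharp> \<odot> T\<close>, the congruence by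
  \<open>z\<close> carries the obstruction \<open>s\<close> to skewness into
  \<open>2 *\<^sub>R (\<one> - T\<^sup>\<sharp> \<odot> T)\<close>. As \<open>z\<close> is
  invertible, the two vanish together.\<close>

lemma chart_isometry_iff:
  assumes "T \<in> chart_dom"
  shows "T \<in> isometries \<longleftrightarrow> chart T \<in> skew_along"
proof -
  have T: "T \<in> vecs X" using assms by (simp add: chart_dom_def)
  define r where "r = cay T"
  define w where "w = hor T"
  define z where "z = \<one> + t\<^sup>\<sharp> \<odot> T"
  define s where "s = t\<^sup>\<sharp> \<odot> chart T + (chart T)\<^sup>\<sharp> \<odot> t"
  note cl = T t cay(1)[OF assms, folded r_def] hor(1)[OF assms, folded w_def] chart(1)[OF assms]
  have z: "z \<in> vecs X" "z \<odot> r = \<one>" "r \<odot> z = \<one>" "w \<odot> z = defect \<odot> T"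
    using t T cay(4,5)[OF assms] hor(6)[OF assms] by (simp_all add: z_def r_def w_def)
  have "(chart T)\<^sup>\<sharp> \<odot> t = (t\<^sup>\<sharp> \<odot> chart T)\<^sup>\<sharp>" using cl by (simp add: star_mul)
  then have s: "s = 2 *\<^sub>R r + 2 *\<^sub>R r\<^sup>\<sharp> - 2 *\<^sub>R \<one> - 2 *\<^sub>R (w\<^sup>\<sharp> \<odot> w)"
    using cl unfolding s_def chart(3)[OF assms] r_def[symmetric] w_def[symmetric]
    by (simp add: star_expand scaleR_2)
  have wz: "z\<^sup>\<sharp> \<odot> w\<^sup>\<sharp> = T\<^sup>\<sharp> \<odot> defect"
    using arg_cong[OF z(4), of star] cl z(1) by (simp add: star_mul iso_rules)
  have rz: "z\<^sup>\<sharp> \<odot> r\<^sup>\<sharp> = \<one>" "r\<^sup>\<sharp> \<odot> z\<^sup>\<sharp> = \<one>"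
    using arg_cong[OF z(3), of star] arg_cong[OF z(2), of star] cl z(1) by (simp_all add: star_mul)
  have "z\<^sup>\<sharp> \<odot> s \<odot> z = 2 *\<^sub>R (z\<^sup>\<sharp> \<odot> (r \<odot> z)) + 2 *\<^sub>R ((z\<^sup>\<sharp> \<odot> r\<^sup>\<sharp>) \<odot> z) - 2 *\<^sub>R (z\<^sup>\<sharp> \<odot> z)
      - 2 *\<^sub>R ((z\<^sup>\<sharp> \<odot> w\<^sup>\<sharp>) \<odot> (w \<odot> z))"
    unfolding s by (simp add: expand)
  also have "\<dots> = 2 *\<^sub>R (z\<^sup>\<sharp> + z - z\<^sup>\<sharp> \<odot> z - T\<^sup>\<sharp> \<odot> (defect \<odot> T))"
    unfolding z(3,4) wz rz by (simp add: mul_assoc iso_rules algebra_simps)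
  \<comment> \<open>With \<open>a = t\<^sup>\<sharp> \<odot> T\<close> the first three terms are
    \<open>\<one> - a\<^sup>\<sharp> \<odot> a\<close>, and
    \<open>t \<odot> t\<^sup>\<sharp> + defect = \<one>\<close>.\<close>
  also have "z\<^sup>\<sharp> + z - z\<^sup>\<sharp> \<odot> z - T\<^sup>\<sharp> \<odot> (defect \<odot> T) = \<one> - T\<^sup>\<sharp> \<odot> T"
    using cl by (simp add: z_def star_expand expand defect_mult)
  finally have eq: "z\<^sup>\<sharp> \<odot> s \<odot> z = 2 *\<^sub>R (\<one> - T\<^sup>\<sharp> \<odot> T)" .
  have "s = (r\<^sup>\<sharp> \<odot> z\<^sup>\<sharp>) \<odot> s \<odot> (z \<odot> r)" by (simp add: rz z)
  also have "\<dots> = r\<^sup>\<sharp> \<odot> (z\<^sup>\<sharp> \<odot> s \<odot> z) \<odot> r" by (simp only: mul_assoc)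
  finally have eq': "s = r\<^sup>\<sharp> \<odot> (z\<^sup>\<sharp> \<odot> s \<odot> z) \<odot> r" .
  have "s = 0 \<longleftrightarrow> T\<^sup>\<sharp> \<odot> T = \<one>"
  proof
    assume "s = 0"
    then show "T\<^sup>\<sharp> \<odot> T = \<one>" using eq by simp
  next
    assume "T\<^sup>\<sharp> \<odot> T = \<one>"
    then have "z\<^sup>\<sharp> \<odot> s \<odot> z = 0" using eq by simp
    then show "s = 0" using eq' by simp
  qed
  then show ?thesis using cl by (simp add: isometries_def skew_along_def s_def)
qed

section \<open>The chart as a diffeomorphism, and its model space\<close>

lemma openin_chart_dom: "openin (ntop X) chart_dom"
  unfolding chart_dom_def using t
  by (intro openin_invertible nspace_on_axioms rational_intros) auto

lemma openin_chart_cod: "openin (ntop X) chart_cod"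
  unfolding chart_cod_def using t
  by (intro openin_invertible nspace_on_axioms rational_intros) auto

lemma bij_betw_chart: "bij_betw chart chart_dom chart_cod"
  by (intro bij_betw_byWitness[where f' = unchart]) (auto simp: unchart_chart chart_unchart)

lemma smooth_diffeo_chart: "smooth_diffeo X chart_dom chart_cod chart"
  unfolding smooth_diffeo_def
proof (intro conjI bij_betw_chart)
  have c: "rational X chart_dom cay"
    unfolding cay_def using t
    by (intro rational_intros) (auto simp: chart_dom_def)
  have h: "rational X chart_dom hor"
    unfolding hor_def using c by (intro rational_intros) auto
  show "smooth_on X X chart_dom chart"
    using t c h unfolding chart_def
    by (intro rat_smooth_on nspace_on_axioms openin_chart_dom rational_intros) auto
  have "rational X chart_cod unchart"
    unfolding unchart_def using t
    by (intro rational_intros) (auto simp: chart_cod_def)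
  then have "smooth_on X X chart_cod unchart"
    by (intro rat_smooth_on nspace_on_axioms openin_chart_cod)
  moreover have "unchart Y = inv_into chart_dom chart Y" if "Y \<in> chart_cod" for Y
    using chart_unchart[OF that] bij_betw_chart
    by (metis bij_betw_def inv_into_f_f)
  ultimately show "smooth_on X X chart_cod (inv_into chart_dom chart)"
    by (rule smooth_on_cong)
qed

text \<open>\<open>M\<close> is left open so that one chart serves an orbit as well as the set of
  all isometries.\<close>

lemma chart_image:
  assumes "M \<subseteq> isometries" "chart_dom \<inter> isometries \<subseteq> M"
  shows "chart ` (chart_dom \<inter> M) = chart_cod \<inter> skew_along"
proof
  show "chart ` (chart_dom \<inter> M) \<subseteq> chart_cod \<inter> skew_along"
    using assms unchart_chart chart_isometry_iff by blast
  show "chart_cod \<inter> skew_along \<subseteq> chart ` (chart_dom \<inter> M)"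
  proof
    fix Y assume Y: "Y \<in> chart_cod \<inter> skew_along"
    then have "unchart Y \<in> chart_dom \<inter> M"
      using assms chart_unchart chart_isometry_iff by fastforce
    then show "Y \<in> chart ` (chart_dom \<inter> M)" using chart_unchart Y by force
  qed
qed

lemma subspace_skew_along: "subspace skew_along"
  by (auto simp: skew_along_def subspace_def star_expand expand algebra_simps
      simp flip: scaleR_add_right)

text \<open>\<open>?L\<close> multiplies \<open>t\<close> by the self-adjoint part of
  \<open>t\<^sup>\<sharp> \<odot> v\<close>, so it projects onto all \<open>t \<odot> h\<close> with
  \<open>h\<close> self-adjoint. Left multiplication by \<open>t\<close> is injective, hence the
  kernel is where that part vanishes.\<close>

lemma complemented_skew_along: "complemented_subspace X skew_along"
proof -
  let ?L = "\<lambda>v. (1/2) *\<^sub>R (t \<odot> (t\<^sup>\<sharp> \<odot> v + v\<^sup>\<sharp> \<odot> t))"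
  have "bounded_linear_nspace X X (\<lambda>v. t\<^sup>\<sharp> \<odot> v \<odot> \<one> + \<one> \<odot> v\<^sup>\<sharp> \<odot> t)"
    using t by (intro bounded_linear_add bounded_linear_mul nspace_on_axioms
        bounded_linear_compose[OF bounded_linear_star]) auto
  from bounded_linear_compose[OF bounded_linear_compose[OF this bounded_linear_mul[of t \<one>]]
      bounded_linear_scaleR[of "1/2"]]
  have "bounded_linear_nspace X X ?L" using t nspace_on_axioms by simp
  moreover have "?L (?L v) = ?L v" if "v \<in> vecs X" for v
    using that t by (simp add: star_expand expand iso_rules algebra_simps flip: scaleR_add_left)
  ultimately have "complemented_subspace X {v \<in> vecs X. ?L v = 0}"
    by (rule complemented_subspace_kernel)
  moreover have "?L v = 0 \<longleftrightarrow> t\<^sup>\<sharp> \<odot> v + v\<^sup>\<sharp> \<odot> t = 0" for v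
    using tt'[of "t\<^sup>\<sharp> \<odot> v + v\<^sup>\<sharp> \<odot> t"] by auto
  ultimately show ?thesis by (simp add: skew_along_def)
qed

lemma base_in_chart_dom: "t \<in> chart_dom"
proof -
  have "\<one> + t\<^sup>\<sharp> \<odot> t = 2 *\<^sub>R \<one>" by (simp add: tt scaleR_2)
  moreover have "2 *\<^sub>R \<one> \<odot> ((1/2) *\<^sub>R \<one>) = \<one>" "((1/2) *\<^sub>R \<one>) \<odot> 2 *\<^sub>R \<one> = \<one>"
    by (simp_all add: mul_scaleR_left mul_scaleR_right)
  ultimately have "invertible_in (\<one> + t\<^sup>\<sharp> \<odot> t)"
    unfolding invertible_in_def by (metis one_closed vecs_closed(5))
  then show ?thesis using t by (simp add: chart_dom_def)
qed

text \<open>The isometry \<open>T\<close> is the image of \<open>t\<close> under the Cayley transform of the skew element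
  \<open>K\<close> with \<open>K (T + t) = T - t\<close>.\<close>

lemma chart_dom_isometries_subset_orbit: "chart_dom \<inter> isometries \<subseteq> orbit t"
proof
  fix T assume "T \<in> chart_dom \<inter> isometries"
  then have dom: "T \<in> chart_dom" and skew: "chart T \<in> skew_along"
    using chart_isometry_iff by auto
  have T: "T \<in> vecs X" using dom by (simp add: chart_dom_def)
  define r where "r = cay T"
  define w where "w = hor T"
  define z where "z = \<one> + t\<^sup>\<sharp> \<odot> T"
  define k where "k = - (t\<^sup>\<sharp> \<odot> chart T)"
  \<comment> \<open>In blocks for \<open>t \<odot> t\<^sup>\<sharp>\<close> and
    \<open>defect\<close>, \<open>K\<close> has the corner \<open>k\<close>, the off-diagonal
    entries \<open>w\<close> and \<open>- w\<^sup>\<sharp>\<close>, and zero in the corner of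
    \<open>defect\<close>.\<close>
  define K where "K = t \<odot> k \<odot> t\<^sup>\<sharp> + w \<odot> t\<^sup>\<sharp> - t \<odot> w\<^sup>\<sharp>"
  define e where "e = (1/2) *\<^sub>R z"
  \<comment> \<open>Inverse of \<open>\<one> - K\<close> by a Schur complement: the corner of
    \<open>defect\<close> is the identity there, and the complement is
    \<open>\<one> - k + w\<^sup>\<sharp> \<odot> w = 2 *\<^sub>R r\<close>, with inverse
    \<open>e\<close>.\<close>
  define b where "b = defect + (t + w) \<odot> e \<odot> (t\<^sup>\<sharp> - w\<^sup>\<sharp>)"
  note cl = T t cay(1)[OF dom, folded r_def] hor(1)[OF dom, folded w_def] chart(1)[OF dom]
  have k: "k \<in> vecs X" "k\<^sup>\<sharp> = - k" "k = \<one> - 2 *\<^sub>R r + w\<^sup>\<sharp> \<odot> w"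
  proof -
    have "(t\<^sup>\<sharp> \<odot> chart T)\<^sup>\<sharp> = - (t\<^sup>\<sharp> \<odot> chart T)"
      using skew cl by (simp add: skew_along_def star_mul eq_neg_iff_add_eq_0 add.commute)
    then show "k\<^sup>\<sharp> = - k" using cl by (simp add: k_def star_minus)
  qed (use cl in \<open>simp_all add: k_def chart(3)[OF dom] r_def w_def\<close>)
  have z: "z \<in> vecs X" "z \<odot> r = \<one>" "r \<odot> z = \<one>" "w \<odot> z = defect \<odot> T"
    using cl cay(4,5)[OF dom] hor(6)[OF dom] by (simp_all add: z_def r_def w_def)
  have e: "e \<in> vecs X" using z by (simp add: e_def)
  have er: "e \<odot> 2 *\<^sub>R r = \<one>" "2 *\<^sub>R r \<odot> e = \<one>"
    using z by (simp_all add: e_def mul_scaleR_left mul_scaleR_right)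
  note w = hor(2-5)[OF dom, folded w_def]
  have w': "defect \<odot> (w \<odot> y) = w \<odot> y" "t\<^sup>\<sharp> \<odot> (w \<odot> y) = 0" "w\<^sup>\<sharp> \<odot> (t \<odot> y) = 0"
    "w\<^sup>\<sharp> \<odot> (defect \<odot> y) = w\<^sup>\<sharp> \<odot> y" for y
    by (simp_all only: mul_assoc[symmetric] w mul_zero)
  have K: "K \<in> vecs X" "K\<^sup>\<sharp> = - K"
    using cl k(1,2) by (simp_all add: K_def star_expand mul_assoc)
  have "(\<one> - K) \<odot> (t + w) = t \<odot> (\<one> - k + w\<^sup>\<sharp> \<odot> w)"
    by (simp add: K_def expand iso_rules w w')
  also have "\<one> - k + w\<^sup>\<sharp> \<odot> w = 2 *\<^sub>R r" by (simp add: k)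
  finally have K1: "(\<one> - K) \<odot> (t + w) = t \<odot> 2 *\<^sub>R r" .
  have K2: "(\<one> - K) \<odot> defect = defect + t \<odot> w\<^sup>\<sharp>"
    by (simp add: K_def expand iso_rules w w')
  have "(t\<^sup>\<sharp> - w\<^sup>\<sharp>) \<odot> (\<one> - K) = (\<one> - k + w\<^sup>\<sharp> \<odot> w) \<odot> t\<^sup>\<sharp>"
    by (simp add: K_def expand iso_rules w w')
  also have "\<one> - k + w\<^sup>\<sharp> \<odot> w = 2 *\<^sub>R r" by (simp add: k)
  finally have K3: "(t\<^sup>\<sharp> - w\<^sup>\<sharp>) \<odot> (\<one> - K) = 2 *\<^sub>R r \<odot> t\<^sup>\<sharp>" .
  have K4: "defect \<odot> (\<one> - K) = defect - w \<odot> t\<^sup>\<sharp>"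
    by (simp add: K_def expand iso_rules w w')
  have b: "b \<in> vecs X" using cl e by (simp add: b_def)
  have "(\<one> - K) \<odot> b = (\<one> - K) \<odot> defect + ((\<one> - K) \<odot> (t + w)) \<odot> (e \<odot> (t\<^sup>\<sharp> - w\<^sup>\<sharp>))"
    unfolding b_def by (simp only: mul_add_right[of "\<one> - K" defect] mul_assoc)
  also have "((\<one> - K) \<odot> (t + w)) \<odot> (e \<odot> (t\<^sup>\<sharp> - w\<^sup>\<sharp>)) = t \<odot> (2 *\<^sub>R r \<odot> e) \<odot> (t\<^sup>\<sharp> - w\<^sup>\<sharp>)"
    by (simp only: K1 mul_assoc)
  also have "(\<one> - K) \<odot> defect + t \<odot> (2 *\<^sub>R r \<odot> e) \<odot> (t\<^sup>\<sharp> - w\<^sup>\<sharp>) = \<one>"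
    unfolding er K2 by (simp add: mul_diff_right defect_def)
  finally have b1: "(\<one> - K) \<odot> b = \<one>" .
  have "b \<odot> (\<one> - K) = defect \<odot> (\<one> - K) + (t + w) \<odot> e \<odot> ((t\<^sup>\<sharp> - w\<^sup>\<sharp>) \<odot> (\<one> - K))"
    unfolding b_def by (simp only: mul_add_left[of defect _ "\<one> - K"] mul_assoc)
  also have "(t + w) \<odot> e \<odot> ((t\<^sup>\<sharp> - w\<^sup>\<sharp>) \<odot> (\<one> - K)) = (t + w) \<odot> (e \<odot> 2 *\<^sub>R r) \<odot> t\<^sup>\<sharp>"
    by (simp only: K3 mul_assoc)
  also have "defect \<odot> (\<one> - K) + (t + w) \<odot> (e \<odot> 2 *\<^sub>R r) \<odot> t\<^sup>\<sharp> = \<one>"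
    unfolding er K4 by (simp add: mul_add_left defect_def)
  finally have b2: "b \<odot> (\<one> - K) = \<one>" .
  have G: "(\<one> + K) \<odot> b \<in> unitaries" by (rule cayley_unitary[OF K b b1 b2])
  have bt: "b \<odot> t = (t + w) \<odot> e" by (simp add: b_def expand iso_rules w w')
  \<comment> \<open>As \<open>\<one> + K = 2 *\<^sub>R \<one> - (\<one> - K)\<close>, the transform
    is \<open>2 *\<^sub>R b - \<one>\<close>.\<close>
  have "(\<one> + K) \<odot> b \<odot> t = 2 *\<^sub>R (b \<odot> t) - ((\<one> - K) \<odot> b) \<odot> t"
    by (simp add: expand scaleR_2)
  also have "\<dots> = (t + w) \<odot> z - t" by (simp add: b1 bt e_def mul_scaleR_right)
  also have "\<dots> = t \<odot> (t\<^sup>\<sharp> \<odot> T) + w \<odot> z" by (simp add: z_def mul_add_left mul_add_right)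
  also have "\<dots> = T" by (simp add: z defect_mult)
  finally have "(\<one> + K) \<odot> b \<odot> t = T" .
  then show "T \<in> orbit t" using G unfolding orbit_def by blast
qed

end

section \<open>Sets of isometries invariant under the unitaries\<close>

lemma isometriesD: "T \<in> isometries \<Longrightarrow> T \<in> vecs X" "T \<in> isometries \<Longrightarrow> T\<^sup>\<sharp> \<odot> T = \<one>"
  by (simp_all add: isometries_def)

text \<open>Such a set contains every isometry near each of its points. The notion covers an orbit,
  its complement, the set of all isometries and, as the orbit of \<open>\<one>\<close>, the unitary
  group.\<close>

definition saturated :: "'v set \<Rightarrow> bool" where
  "saturated M \<longleftrightarrow> M \<subseteq> isometries \<and> (\<forall>T\<in>M. orbit T \<subseteq> M)"

lemma saturated_chart_dom:
  assumes "saturated M" "T \<in> M"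
  shows "chart_dom T \<inter> isometries \<subseteq> M"
proof -
  have "T \<in> isometries" using assms by (auto simp: saturated_def)
  then have "chart_dom T \<inter> isometries \<subseteq> orbit T"
    using isometriesD by (intro chart_dom_isometries_subset_orbit) auto
  then show ?thesis using assms by (auto simp: saturated_def)
qed

lemma saturated_isometries: "saturated isometries"
  unfolding saturated_def using orbit_subset_isometries by blast

lemma saturated_orbit:
  assumes "T \<in> isometries"
  shows "saturated (orbit T)"
  unfolding saturated_def using orbit_subset_isometries[OF assms] by (simp add: orbit_eq)

text \<open>Openness of this complement will make the orbit closed among the isometries.\<close>

lemma saturated_diff_orbit:
  assumes "T \<in> isometries"
  shows "saturated (isometries - orbit T)"
proof -
  have "orbit S \<subseteq> isometries - orbit T" if S: "S \<in> isometries" "S \<notin> orbit T" for S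
  proof
    fix R assume R: "R \<in> orbit S"
    have "R \<notin> orbit T"
    proof
      assume "R \<in> orbit T"
      then have "orbit S = orbit T" using orbit_eq[OF R] orbit_eq[of R T] by simp
      then show False using self_in_orbit[of S] S(2) by simp
    qed
    then show "R \<in> isometries - orbit T" using orbit_subset_isometries[OF S(1)] R by blast
  qed
  then show ?thesis unfolding saturated_def by blast
qed

text \<open>The Cayley chart at \<open>p\<close> serves without shrinking, as \<open>M\<close>
  contains all the isometries in its domain.\<close>

lemma complemented_submanifold_saturated:
  assumes "saturated M"
  shows "complemented_submanifold X M"
  unfolding complemented_submanifold_def
proof (intro conjI ballI)
  have iso: "M \<subseteq> isometries" using assms by (simp add: saturated_def)
  then show "M \<subseteq> vecs X" using isometriesD by blast
  fix p assume p: "p \<in> M"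
  then have t: "p \<in> vecs X" "p\<^sup>\<sharp> \<odot> p = \<one>" using iso isometriesD by blast+
  show "\<exists>U V \<phi> F. p \<in> U \<and> smooth_diffeo X U V \<phi> \<and> complemented_subspace X F \<and>
      \<phi> ` (U \<inter> M) = V \<inter> F"
    by (intro exI conjI) (rule base_in_chart_dom[OF t] smooth_diffeo_chart[OF t]
        complemented_skew_along[OF t] chart_image[OF t iso saturated_chart_dom[OF assms p]])+
qed

lemma openin_saturated:
  assumes "saturated M"
  shows "openin (subtopology (ntop X) isometries) M"
proof -
  have iso: "M \<subseteq> isometries" using assms by (simp add: saturated_def)
  have t: "T \<in> vecs X" "T\<^sup>\<sharp> \<odot> T = \<one>" if "T \<in> M" for T
    using iso that isometriesD[of T] by auto
  have "openin (ntop X) (\<Union>T\<in>M. chart_dom T)"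
    using openin_chart_dom[OF t] by (intro openin_Union) blast
  moreover have "M = (\<Union>T\<in>M. chart_dom T) \<inter> isometries"
  proof
    show "M \<subseteq> (\<Union>T\<in>M. chart_dom T) \<inter> isometries" using iso base_in_chart_dom[OF t] by auto
    show "(\<Union>T\<in>M. chart_dom T) \<inter> isometries \<subseteq> M" using saturated_chart_dom[OF assms] by auto
  qed
  ultimately show ?thesis unfolding openin_subtopology by blast
qed

lemma topspace_isometries [simp]: "topspace (subtopology (ntop X) isometries) = isometries"
  using isometriesD by auto

text \<open>The orbit is open and closed, so a component that meets it cannot leave it.\<close>

lemma orbit_Union_components:
  assumes "T \<in> isometries"
  shows "\<exists>\<C> \<subseteq> connected_components_of (subtopology (ntop X) isometries). orbit T = \<Union>\<C>"
proof -
  let ?Y = "subtopology (ntop X) isometries"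
  have op: "openin ?Y (orbit T)" by (rule openin_saturated[OF saturated_orbit[OF assms]])
  have cl: "closedin ?Y (orbit T)"
    unfolding closedin_def topspace_isometries
    using openin_saturated[OF saturated_diff_orbit[OF assms]] orbit_subset_isometries[OF assms] by simp
  let ?C = "{C \<in> connected_components_of ?Y. C \<subseteq> orbit T}"
  have "orbit T \<subseteq> \<Union>?C"
  proof
    fix x assume x: "x \<in> orbit T"
    then have "x \<in> \<Union>(connected_components_of ?Y)"
      unfolding Union_connected_components_of topspace_isometries
      using orbit_subset_isometries[OF assms] by blast
    then obtain C where C: "C \<in> connected_components_of ?Y" "x \<in> C" by blast
    have "C \<subseteq> orbit T \<or> disjnt C (orbit T)"
      by (rule connectedin_clopen_cases[OF connectedin_connected_components_of[OF C(1)] cl op])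
    then show "x \<in> \<Union>?C" using C x by (auto simp: disjnt_iff)
  qed
  then show ?thesis by (intro exI[of _ ?C]) auto
qed

section \<open>Tangent spaces and the submersion\<close>

text \<open>A Cayley transform replaces the exponential: it is rational in \<open>s\<close>, so its
  smoothness is already known. To first order it is
  \<open>\<one> + 2 *\<^sub>R s *\<^sub>R k\<close>, whence the factor 2.\<close>

lemma curve_in_orbit:
  assumes p: "p \<in> vecs X" and k: "k \<in> vecs X" "k\<^sup>\<sharp> = - k"
  shows "\<exists>\<gamma> e. e > 0 \<and> smooth_on real_line X {-e<..<e} \<gamma> \<and> \<gamma> ` {-e<..<e} \<subseteq> orbit p \<and> \<gamma> 0 = p \<and>
     has_fderiv real_line X {-e<..<e} \<gamma> 0 (\<lambda>s. s *\<^sub>R (2 *\<^sub>R (k \<odot> p)))"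
proof -
  \<comment> \<open>Keeps \<open>s *\<^sub>R k\<close> in the ball of radius 1/2, where
    \<open>neumann\<close> applies and \<open>R s\<close> is uniformly bounded.\<close>
  define e where "e = 1 / (2 * (nrm X k + 1))"
  have e: "e > 0" by (simp add: e_def add_nonneg_pos)
  define R where "R s = inverse_in (\<one> - s *\<^sub>R k)" for s
  define \<gamma> where "\<gamma> s = (\<one> + s *\<^sub>R k) \<odot> R s \<odot> p" for s
  have small: "nrm X (s *\<^sub>R k) \<le> 1/2" if "s \<in> {-e<..<e}" for s
  proof -
    have "nrm X (s *\<^sub>R k) \<le> e * (nrm X k + 1)"
      unfolding nrm_scaleR[OF k(1)] using that by (intro mult_mono) auto
    also have "\<dots> = 1/2" using nrm_nonneg[of k] by (simp add: e_def field_simps del: nrm_nonneg)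
    finally show ?thesis .
  qed
  have inv: "invertible_in (\<one> - s *\<^sub>R k)" if "s \<in> {-e<..<e}" for s
    using neumann[of "s *\<^sub>R k"] small[OF that] k by (auto simp: invertible_in_def)
  note R = inverse_in[OF inv, folded R_def]
  have "bounded_linear_nspace real_line X (\<lambda>s. s *\<^sub>R v)" if "v \<in> vecs X" for v
    unfolding bounded_linear_nspace_def using that
    by (intro conjI ballI allI exI[of _ "nrm X v"])
      (simp_all add: real_line_def nrm_scaleR scaleR_add_left mult.commute)
  note bl = this
  have lin: "rational real_line {-e<..<e} (\<lambda>s. s *\<^sub>R k)" by (rule rat.var[OF bl[OF k(1)]])
  have "rational real_line {-e<..<e} R"
    unfolding R_def using inv by (intro rational_intros lin) auto
  then have "rational real_line {-e<..<e} \<gamma>"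
    unfolding \<gamma>_def using p by (intro rational_intros lin) auto
  then have sm: "smooth_on real_line X {-e<..<e} \<gamma>"
    by (rule rat_smooth_on[OF _ nspace_on_real_line openin_real_line])
  have "\<gamma> s \<in> orbit p" if "s \<in> {-e<..<e}" for s
  proof -
    have "(\<one> + s *\<^sub>R k) \<odot> R s \<in> unitaries"
      using R(1-3)[OF that] k by (intro cayley_unitary) (auto simp: star_scaleR)
    then show ?thesis unfolding orbit_def \<gamma>_def by blast
  qed
  then have im: "\<gamma> ` {-e<..<e} \<subseteq> orbit p" by blast
  have R0: "R 0 = \<one>" unfolding R_def by (rule inverse_in_eq) simp_all
  then have \<gamma>0: "\<gamma> 0 = p" by (simp add: \<gamma>_def)
  \<comment> \<open>Absorption, from \<open>R s = \<one> + (s *\<^sub>R k) \<odot> R s\<close>. The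
    axioms do not normalise \<open>\<one>\<close>, so its norm stays in the bound.\<close>
  have Rb: "nrm X (R s) \<le> 2 * nrm X \<one>" if "s \<in> {-e<..<e}" for s
  proof -
    have "R s = \<one> + (s *\<^sub>R k) \<odot> R s" using R(2)[OF that] by (simp add: mul_diff_left algebra_simps)
    then have "nrm X (R s) \<le> nrm X \<one> + nrm X ((s *\<^sub>R k) \<odot> R s)"
      using nrm_triangle[of \<one> "(s *\<^sub>R k) \<odot> R s"] R(1)[OF that] k by simp
    also have "nrm X ((s *\<^sub>R k) \<odot> R s) \<le> nrm X (s *\<^sub>R k) * nrm X (R s)"
      using R(1)[OF that] k by (intro nrm_mul) auto
    also have "\<dots> \<le> 1/2 * nrm X (R s)" using small[OF that] by (intro mult_right_mono) auto
    finally show ?thesis by simp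
  qed
  define C where "C = 2 * nrm X (k \<odot> k) * (2 * nrm X \<one>) * nrm X p"
  have C: "C \<ge> 0" by (simp add: C_def)
  have rem: "nrm X (\<gamma> s - p - s *\<^sub>R (2 *\<^sub>R (k \<odot> p))) \<le> C * s\<^sup>2" if s: "s \<in> {-e<..<e}" for s
  proof -
    have "\<gamma> s - p - s *\<^sub>R (2 *\<^sub>R (k \<odot> p))
      = ((\<one> + s *\<^sub>R k) - (\<one> + 2 *\<^sub>R s *\<^sub>R k) \<odot> (\<one> - s *\<^sub>R k)) \<odot> R s \<odot> p"
    proof -
      have "(\<one> + 2 *\<^sub>R s *\<^sub>R k) \<odot> (\<one> - s *\<^sub>R k) \<odot> R s \<odot> p = (\<one> + 2 *\<^sub>R s *\<^sub>R k) \<odot> p"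
        by (simp only: mul_assoc R(4)[OF s])
      then have "((\<one> + s *\<^sub>R k) - (\<one> + 2 *\<^sub>R s *\<^sub>R k) \<odot> (\<one> - s *\<^sub>R k)) \<odot> R s \<odot> p
        = \<gamma> s - (\<one> + 2 *\<^sub>R s *\<^sub>R k) \<odot> p"
        unfolding mul_diff_left \<gamma>_def by (rule arg_cong)
      moreover have "(\<one> + 2 *\<^sub>R s *\<^sub>R k) \<odot> p = p + s *\<^sub>R (2 *\<^sub>R (k \<odot> p))"
        by (simp add: expand mult.commute)
      ultimately show ?thesis by (simp only: diff_diff_eq)
    qed
    also have "(\<one> + s *\<^sub>R k) - (\<one> + 2 *\<^sub>R s *\<^sub>R k) \<odot> (\<one> - s *\<^sub>R k) = (2 * s\<^sup>2) *\<^sub>R (k \<odot> k)"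
    proof -
      have "(\<one> + a) - (\<one> + 2 *\<^sub>R a) \<odot> (\<one> - a) = 2 *\<^sub>R (a \<odot> a)" for a
        by (simp add: mul_add_left mul_diff_right scaleR_2)
      from this[of "s *\<^sub>R k"] show ?thesis
        by (simp only: mul_scaleR_left mul_scaleR_right scaleR_scaleR power2_eq_square)
    qed
    finally have eq: "\<gamma> s - p - s *\<^sub>R (2 *\<^sub>R (k \<odot> p)) = (2 * s\<^sup>2) *\<^sub>R (k \<odot> k) \<odot> R s \<odot> p" .
    have "nrm X (\<gamma> s - p - s *\<^sub>R (2 *\<^sub>R (k \<odot> p)))
      \<le> nrm X ((2 * s\<^sup>2) *\<^sub>R (k \<odot> k)) * nrm X (R s) * nrm X p"
      unfolding eq using k p R(1)[OF s] by (intro nrm_mul3) auto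
    also have "\<dots> \<le> (2 * s\<^sup>2 * nrm X (k \<odot> k)) * (2 * nrm X \<one>) * nrm X p"
      using k by (intro mult_right_mono mult_mono Rb[OF s]) (auto simp: nrm_scaleR)
    finally show ?thesis by (simp add: C_def mult_ac)
  qed
  have "has_fderiv real_line X {-e<..<e} \<gamma> 0 (\<lambda>s. s *\<^sub>R (2 *\<^sub>R (k \<odot> p)))"
    unfolding has_fderiv_def
  proof (intro conjI allI impI)
    show "bounded_linear_nspace real_line X (\<lambda>s. s *\<^sub>R (2 *\<^sub>R (k \<odot> p)))" using k p by (intro bl) auto
    fix \<epsilon> :: real assume \<epsilon>: "\<epsilon> > 0"
    show "\<exists>d>0. \<forall>y\<in>{-e<..<e}. nrm real_line (y - 0) < d \<longrightarrow>
       nrm X (\<gamma> y - \<gamma> 0 - (y - 0) *\<^sub>R (2 *\<^sub>R (k \<odot> p))) \<le> \<epsilon> * nrm real_line (y - 0)"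
    proof (intro exI[of _ "\<epsilon> / (C + 1)"] conjI ballI impI)
      show "0 < \<epsilon> / (C + 1)" using \<epsilon> C by simp
      fix y assume y: "y \<in> {-e<..<e}" and "nrm real_line (y - 0) < \<epsilon> / (C + 1)"
      then have small: "\<bar>y\<bar> * (C + 1) \<le> \<epsilon>" using C by (simp add: real_line_def field_simps)
      have "nrm X (\<gamma> y - \<gamma> 0 - (y - 0) *\<^sub>R (2 *\<^sub>R (k \<odot> p))) \<le> C * y\<^sup>2"
        using rem[OF y] by (simp add: \<gamma>0)
      also have "\<dots> \<le> (C + 1) * y\<^sup>2" by (intro mult_right_mono) auto
      also have "\<dots> = (\<bar>y\<bar> * (C + 1)) * \<bar>y\<bar>" by (simp add: power2_eq_square)
      also have "\<dots> \<le> \<epsilon> * \<bar>y\<bar>" using small by (intro mult_right_mono) auto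
      finally show "nrm X (\<gamma> y - \<gamma> 0 - (y - 0) *\<^sub>R (2 *\<^sub>R (k \<odot> p))) \<le> \<epsilon> * nrm real_line (y - 0)"
        by (simp add: real_line_def)
    qed
  qed
  then show ?thesis using e sm im \<gamma>0 by (intro exI[of _ \<gamma>] exI[of _ e] conjI)
qed

text \<open>The isometry equation is differentiated at 0 using one small \<open>s\<close>: the
  first-order terms add up to \<open>s *\<^sub>R c\<close>, the rest is at most
  \<open>s * \<epsilon>\<close>, and division by \<open>s\<close> leaves an arbitrarily small bound
  for \<open>c\<close>.\<close>

lemma tangent_isometry_skew:
  assumes p: "p \<in> isometries" and v: "v \<in> vecs X" and e: "e > 0"
    and \<gamma>: "\<gamma> ` {-e<..<e} \<subseteq> isometries" "\<gamma> 0 = p"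
    and der: "has_fderiv real_line X {-e<..<e} \<gamma> 0 (\<lambda>s. s *\<^sub>R v)"
  shows "p\<^sup>\<sharp> \<odot> v + v\<^sup>\<sharp> \<odot> p = 0"
proof -
  note pX = isometriesD[OF p]
  define c where "c = p\<^sup>\<sharp> \<odot> v + v\<^sup>\<sharp> \<odot> p"
  have c: "c \<in> vecs X" using pX v by (simp add: c_def)
  have "nrm X c \<le> \<epsilon>" if "\<epsilon> > 0" for \<epsilon>
  proof -
    \<comment> \<open>The two cross terms of \<open>p\<close> and \<open>r\<close> then take at most
      half of the allowance \<open>s * \<epsilon>\<close>.\<close>
    define \<eta> where "\<eta> = \<epsilon> / (4 * (nrm X p + 1))"
    have \<eta>: "\<eta> > 0" using that by (simp add: \<eta>_def add_nonneg_pos)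
    have "\<exists>d>0. \<forall>y\<in>{-e<..<e}. nrm real_line (y - 0) < d \<longrightarrow>
        nrm X (\<gamma> y - \<gamma> 0 - (y - 0) *\<^sub>R v) \<le> \<eta> * nrm real_line (y - 0)"
      using der \<eta> unfolding has_fderiv_def by (elim conjE allE[of _ \<eta>] impE)
    then obtain d where "d > 0" and d: "\<And>y. y \<in> {-e<..<e} \<Longrightarrow> \<bar>y\<bar> < d \<Longrightarrow>
        nrm X (\<gamma> y - p - y *\<^sub>R v) \<le> \<eta> * \<bar>y\<bar>"
      unfolding real_line_def snd_conv \<gamma>(2) diff_zero by (elim exE conjE) (rule that, auto)
    define m where "m = nrm X v + \<eta>"
    have m: "m > 0" using \<eta> by (simp add: m_def add_nonneg_pos)
    \<comment> \<open>The last entry fits the product of \<open>h\<^sup>\<sharp>\<close> and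
      \<open>h\<close>, of size at most \<open>(m * s)\<^sup>2\<close>, into the other half.\<close>
    define s where "s = min (min (e / 2) (d / 2)) (\<epsilon> / (2 * m\<^sup>2))"
    have s: "0 < s" "s < e" "s < d" "s * m\<^sup>2 \<le> \<epsilon> / 2"
    proof -
      show "0 < s" using \<open>d > 0\<close> e that m by (simp add: s_def)
      show "s < e" "s < d" using \<open>d > 0\<close> e by (auto simp: s_def)
      have "s \<le> \<epsilon> / (2 * m\<^sup>2)" by (simp add: s_def)
      then show "s * m\<^sup>2 \<le> \<epsilon> / 2" using m by (simp add: field_simps)
    qed
    define r where "r = \<gamma> s - p - s *\<^sub>R v"
    define h where "h = s *\<^sub>R v + r"
    have iso: "\<gamma> s \<in> isometries" using \<gamma> s by auto
    have r: "r \<in> vecs X" using isometriesD[OF iso] pX v by (simp add: r_def)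
    have h: "h \<in> vecs X" using r v by (simp add: h_def)
    have nr: "nrm X r \<le> \<eta> * s" using d[of s] s by (simp add: r_def)
    have nh: "nrm X h \<le> m * s"
      using nrm_triangle[of "s *\<^sub>R v" r] r v nr s by (simp add: h_def nrm_scaleR m_def algebra_simps)
    have \<gamma>s: "\<gamma> s = p + h" by (simp add: h_def r_def)
    have "\<one> = (p + h)\<^sup>\<sharp> \<odot> (p + h)" using isometriesD[OF iso] by (simp add: \<gamma>s)
    also have "\<dots> = p\<^sup>\<sharp> \<odot> p + (p\<^sup>\<sharp> \<odot> h + h\<^sup>\<sharp> \<odot> p) + h\<^sup>\<sharp> \<odot> h"
      using pX h by (simp add: star_add mul_add_left mul_add_right)
    also have "p\<^sup>\<sharp> \<odot> h + h\<^sup>\<sharp> \<odot> p = s *\<^sub>R c + (p\<^sup>\<sharp> \<odot> r + r\<^sup>\<sharp> \<odot> p)"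
      using r v by (simp add: h_def c_def star_expand expand algebra_simps)
    finally have "s *\<^sub>R c + (p\<^sup>\<sharp> \<odot> r + r\<^sup>\<sharp> \<odot> p + h\<^sup>\<sharp> \<odot> h) = 0"
      by (simp add: pX(2) add.assoc)
    then have "s *\<^sub>R c = - (p\<^sup>\<sharp> \<odot> r + r\<^sup>\<sharp> \<odot> p + h\<^sup>\<sharp> \<odot> h)"
      by (simp only: eq_neg_iff_add_eq_0)
    then have "nrm X (s *\<^sub>R c) = nrm X (p\<^sup>\<sharp> \<odot> r + r\<^sup>\<sharp> \<odot> p + h\<^sup>\<sharp> \<odot> h)" by (simp only: nrm_minus)
    also have "\<dots> \<le> nrm X (p\<^sup>\<sharp>) * nrm X r + nrm X (r\<^sup>\<sharp>) * nrm X p + nrm X (h\<^sup>\<sharp>) * nrm X h"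
      using pX r h by (intro nrm_sum_of_products) auto
    also have "\<dots> = 2 * (nrm X p * nrm X r) + nrm X h * nrm X h"
      using pX r h by (simp add: nrm_star)
    also have "\<dots> \<le> 2 * ((nrm X p + 1) * (\<eta> * s)) + (m * s) * (m * s)"
      using nr nh m s by (intro add_mono mult_left_mono mult_mono) auto
    also have "2 * ((nrm X p + 1) * (\<eta> * s)) = s * (\<epsilon> / 2)"
      using nrm_nonneg[of p] by (simp add: \<eta>_def field_simps del: nrm_nonneg)
    also have "(m * s) * (m * s) = s * (s * m\<^sup>2)" by (simp add: power2_eq_square)
    also have "s * (\<epsilon> / 2) + s * (s * m\<^sup>2) \<le> s * \<epsilon>"
    proof -
      have "s * (s * m\<^sup>2) \<le> s * (\<epsilon> / 2)" using s by (intro mult_left_mono) auto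
      then show ?thesis by linarith
    qed
    finally show ?thesis using s(1) c by (simp add: nrm_scaleR)
  qed
  then have "nrm X c \<le> 0" using field_le_epsilon[of "nrm X c" 0] by simp
  then have "nrm X c = 0" using nrm_nonneg[of c] by linarith
  then show ?thesis using nrm_eq_0[OF c] by (simp add: c_def)
qed

text \<open>Tangent vectors at \<open>q\<close> are exactly the velocities \<open>k q\<close> of one-parameter motions, \<open>k\<close> skew.\<close>

lemma skew_along_generator:
  assumes q: "q \<in> isometries" and w: "w \<in> skew_along q"
  shows "\<exists>k\<in>vecs X. k\<^sup>\<sharp> = - k \<and> k \<odot> q = w"
proof -
  note qX = isometriesD[OF q]
  have wX: "w \<in> vecs X" and sk: "q\<^sup>\<sharp> \<odot> w = - (w\<^sup>\<sharp> \<odot> q)"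
    using w by (auto simp: skew_along_def[OF qX] eq_neg_iff_add_eq_0)
  \<comment> \<open>The first two terms are skew together but send \<open>q\<close> to
    \<open>w - q \<odot> (w\<^sup>\<sharp> \<odot> q)\<close>. The third cancels the excess, and is
    skew because \<open>w\<^sup>\<sharp> \<odot> q\<close> is.\<close>
  define k where "k = w \<odot> q\<^sup>\<sharp> - q \<odot> w\<^sup>\<sharp> + q \<odot> (w\<^sup>\<sharp> \<odot> q) \<odot> q\<^sup>\<sharp>"
  have "(q \<odot> (w\<^sup>\<sharp> \<odot> q) \<odot> q\<^sup>\<sharp>)\<^sup>\<sharp> = q \<odot> (q\<^sup>\<sharp> \<odot> w) \<odot> q\<^sup>\<sharp>"
    using qX wX by (simp add: star_mul mul_assoc)
  also have "\<dots> = - (q \<odot> (w\<^sup>\<sharp> \<odot> q) \<odot> q\<^sup>\<sharp>)" by (simp add: sk)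
  finally have "k\<^sup>\<sharp> = - k" using qX wX by (simp add: k_def star_expand)
  moreover have "k \<odot> q = w" by (simp add: k_def expand qX(2))
  moreover have "k \<in> vecs X" using qX wX by (simp add: k_def)
  ultimately show ?thesis by blast
qed

lemma tangent_space_orbit:
  assumes p: "p \<in> isometries"
  shows "tangent_space X (orbit p) p = skew_along p"
proof
  show "tangent_space X (orbit p) p \<subseteq> skew_along p"
  proof
    fix v assume "v \<in> tangent_space X (orbit p) p"
    then obtain \<gamma> e where v: "v \<in> vecs X" and "e > 0" "\<gamma> ` {-e<..<e} \<subseteq> orbit p" "\<gamma> 0 = p"
      "has_fderiv real_line X {-e<..<e} \<gamma> 0 (\<lambda>s. s *\<^sub>R v)"
      unfolding tangent_space_def by (elim CollectE conjE exE)
    then have "p\<^sup>\<sharp> \<odot> v + v\<^sup>\<sharp> \<odot> p = 0"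
      using orbit_subset_isometries[OF p] by (intro tangent_isometry_skew[OF p]) auto
    then show "v \<in> skew_along p" using v by (simp add: skew_along_def[OF isometriesD[OF p]])
  qed
  show "skew_along p \<subseteq> tangent_space X (orbit p) p"
  proof
    fix v assume v: "v \<in> skew_along p"
    then obtain k where k: "k \<in> vecs X" "k\<^sup>\<sharp> = - k" "k \<odot> p = v"
      using skew_along_generator[OF p] by blast
    then have vX: "v \<in> vecs X" using isometriesD[OF p] by auto
    \<comment> \<open>Compensates the velocity \<open>2 *\<^sub>R (k \<odot> p)\<close> of the
      Cayley curve.\<close>
    have half: "((1/2) *\<^sub>R k)\<^sup>\<sharp> = - ((1/2) *\<^sub>R k)" using k by (simp add: star_scaleR)
    have "2 *\<^sub>R ((1/2) *\<^sub>R k \<odot> p) = v" using k by (simp add: mul_scaleR_left)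
    then show "v \<in> tangent_space X (orbit p) p"
      using curve_in_orbit[OF isometriesD(1)[OF p] _ half] k(1) vX unfolding tangent_space_def by simp
  qed
qed

lemma one_isometry [simp]: "\<one> \<in> isometries"
  by (simp add: isometries_def)

text \<open>The orbit map is the restriction of a bounded linear map, which is its own derivative.
  It is onto because a skew \<open>k\<close> generating a tangent vector at
  \<open>p \<odot> t\<close> also generates one at \<open>p\<close>.\<close>

lemma smooth_submersion_orbit:
  assumes t: "t \<in> isometries"
  shows "smooth_submersion X unitaries X (orbit t) (\<lambda>G. G \<odot> t)"
  unfolding smooth_submersion_def
proof (intro conjI ballI)
  show "complemented_submanifold X unitaries"
    unfolding unitaries_eq_orbit_one by (intro complemented_submanifold_saturated saturated_orbit) simp
  show "complemented_submanifold X (orbit t)"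
    by (intro complemented_submanifold_saturated saturated_orbit t)
  show "(\<lambda>G. G \<odot> t) ` unitaries \<subseteq> orbit t" by (auto simp: orbit_def)
  fix p assume p: "p \<in> unitaries"
  note tX = isometriesD[OF t]
  have pX: "p \<in> vecs X" "p\<^sup>\<sharp> \<odot> p = \<one>" "p \<odot> p\<^sup>\<sharp> = \<one>" using p by (simp_all add: unitaries_def)
  have piso: "p \<in> isometries" using pX by (simp add: isometries_def)
  have pt: "p \<odot> t \<in> orbit t" using p by (auto simp: orbit_def)
  have ptiso: "p \<odot> t \<in> isometries" using orbit_subset_isometries[OF t] pt by blast
  define P where "P = skew_along p"
  have P: "P = {v \<in> vecs X. p\<^sup>\<sharp> \<odot> v + v\<^sup>\<sharp> \<odot> p = 0}"
    unfolding P_def by (rule skew_along_def[OF pX(1,2)])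
  have TU: "tangent_space X unitaries p = P"
    using tangent_space_orbit[OF piso] orbit_eq[of p \<one>] p by (simp add: unitaries_eq_orbit_one P_def)
  have TO: "tangent_space X (orbit t) (p \<odot> t) = skew_along (p \<odot> t)"
    using tangent_space_orbit[OF ptiso] orbit_eq[OF pt] by simp
  have bl: "bounded_linear_nspace X X (\<lambda>G. G \<odot> t)" using bounded_linear_mul[of \<one> t] tX by simp
  have "rational X (vecs X) (\<lambda>G. G \<odot> t)" using tX by (intro rational_intros)
  moreover have opX: "openin (ntop X) (vecs X)" using openin_topspace[of "ntop X"] by simp
  ultimately have sm: "smooth_on X X (vecs X) (\<lambda>G. G \<odot> t)"
    by (intro rat_smooth_on nspace_on_axioms)
  have der: "has_fderiv X X (vecs X) (\<lambda>G. G \<odot> t) p (\<lambda>G. G \<odot> t)"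
    unfolding has_fderiv_def using bl by (auto simp: mul_diff_left intro!: exI[of _ 1])
  have onto: "(\<lambda>G. G \<odot> t) ` P = skew_along (p \<odot> t)"
  proof
    show "(\<lambda>G. G \<odot> t) ` P \<subseteq> skew_along (p \<odot> t)"
    proof
      fix w assume "w \<in> (\<lambda>G. G \<odot> t) ` P"
      then obtain v where v: "v \<in> vecs X" "p\<^sup>\<sharp> \<odot> v + v\<^sup>\<sharp> \<odot> p = 0" and w: "w = v \<odot> t" by (auto simp: P)
      have "(p \<odot> t)\<^sup>\<sharp> \<odot> w + w\<^sup>\<sharp> \<odot> (p \<odot> t) = t\<^sup>\<sharp> \<odot> (p\<^sup>\<sharp> \<odot> v + v\<^sup>\<sharp> \<odot> p) \<odot> t"
        using v(1) tX pX by (simp add: w star_mul expand)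
      then show "w \<in> skew_along (p \<odot> t)"
        unfolding skew_along_def[OF isometriesD[OF ptiso]] using v tX w by simp
    qed
    show "skew_along (p \<odot> t) \<subseteq> (\<lambda>G. G \<odot> t) ` P"
    proof
      fix w assume "w \<in> skew_along (p \<odot> t)"
      then obtain k where k: "k \<in> vecs X" "k\<^sup>\<sharp> = - k" and kw: "k \<odot> (p \<odot> t) = w"
        using skew_along_generator[OF ptiso] by blast
      have "w = (k \<odot> p) \<odot> t" by (simp add: kw mul_assoc)
      moreover have "k \<odot> p \<in> P" using k pX by (simp add: P star_mul mul_assoc)
      ultimately show "w \<in> (\<lambda>G. G \<odot> t) ` P" by blast
    qed
  qed
  define d where "d = defect t"
  note d = defect_rules[OF tX, folded d_def] defect_closed[OF tX, folded d_def]
  \<comment> \<open>For \<open>v = p \<odot> x\<close> with \<open>x\<close> skew, \<open>x\<close>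
    goes to \<open>x - d \<odot> x \<odot> d\<close>, a projection that keeps skewness. If
    \<open>x \<odot> t = 0\<close>, skewness gives \<open>t\<^sup>\<sharp> \<odot> x = 0\<close>
    too, so \<open>x = d \<odot> x \<odot> d\<close>: its kernel is the required one.\<close>
  let ?L = "\<lambda>v. v - (p \<odot> d \<odot> p\<^sup>\<sharp>) \<odot> v \<odot> d"
  have compl: "complemented_subspace (P, nrm X) {v \<in> P. v \<odot> t = 0}"
  proof -
    interpret P: nspace_on "(P, nrm X)"
      by (rule nspace_on_subspace) (use subspace_skew_along[OF pX(1,2)] in \<open>auto simp: P_def[symmetric] P\<close>)
    have pp: "p\<^sup>\<sharp> \<odot> (p \<odot> z) = z" "p \<odot> (p\<^sup>\<sharp> \<odot> z) = z" for z
      by (simp_all add: mul_assoc[symmetric] pX)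
    have LP: "?L v \<in> P" if v: "v \<in> P" for v
    proof -
      have vX: "v \<in> vecs X" and sk: "p\<^sup>\<sharp> \<odot> v + v\<^sup>\<sharp> \<odot> p = 0" using v by (auto simp: P)
      have "p\<^sup>\<sharp> \<odot> ?L v + (?L v)\<^sup>\<sharp> \<odot> p = (p\<^sup>\<sharp> \<odot> v + v\<^sup>\<sharp> \<odot> p) - d \<odot> (p\<^sup>\<sharp> \<odot> v + v\<^sup>\<sharp> \<odot> p) \<odot> d"
        using vX pX d by (simp add: star_expand expand pp)
      then show ?thesis using sk vX pX d by (simp add: P)
    qed
    have "bounded_linear_nspace X X (\<lambda>v. (\<one> \<odot> v \<odot> \<one>) + ((- (p \<odot> d \<odot> p\<^sup>\<sharp>)) \<odot> v \<odot> d))"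
      using pX d by (intro bounded_linear_add bounded_linear_mul nspace_on_axioms) auto
    then have "bounded_linear_nspace X X ?L" by simp
    then have "bounded_linear_nspace (P, nrm X) (P, nrm X) ?L"
      using LP unfolding bounded_linear_nspace_def fst_conv snd_conv by (auto simp: P)
    moreover have "?L (?L v) = ?L v" for v
      using d by (simp add: expand pp)
    ultimately have "complemented_subspace (P, nrm X) {v \<in> vecs (P, nrm X). ?L v = 0}"
      by (intro P.complemented_subspace_kernel)
    moreover have "?L v = 0 \<longleftrightarrow> v \<odot> t = 0" if v: "v \<in> P" for v
    proof
      assume "?L v = 0"
      then have "v = (p \<odot> d \<odot> p\<^sup>\<sharp>) \<odot> v \<odot> d" by simp
      then have "v \<odot> t = (p \<odot> d \<odot> p\<^sup>\<sharp>) \<odot> v \<odot> d \<odot> t" by simp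
      then show "v \<odot> t = 0" by (simp add: mul_assoc d)
    next
      assume vt: "v \<odot> t = 0"
      have vX: "v \<in> vecs X" and sk: "p\<^sup>\<sharp> \<odot> v = - (v\<^sup>\<sharp> \<odot> p)"
        using v by (auto simp: P eq_neg_iff_add_eq_0)
      have tv: "t\<^sup>\<sharp> \<odot> v\<^sup>\<sharp> = 0" using arg_cong[OF vt, of star] vX tX by (simp add: star_mul)
      have "v \<odot> d = v" by (simp add: d_def defect_def[OF tX] mul_diff_right mul_assoc[symmetric] vt)
      moreover have "t\<^sup>\<sharp> \<odot> (p\<^sup>\<sharp> \<odot> v) = 0" by (simp add: sk mul_assoc[symmetric] tv)
      then have "d \<odot> (p\<^sup>\<sharp> \<odot> v) = p\<^sup>\<sharp> \<odot> v"
        by (simp add: d_def defect_def[OF tX] mul_diff_left mul_assoc)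
      ultimately show "?L v = 0" by (simp add: mul_assoc pp)
    qed
    then have "{v \<in> vecs (P, nrm X). ?L v = 0} = {v \<in> P. v \<odot> t = 0}" by auto
    ultimately show ?thesis by simp
  qed
  show "\<exists>U g L. p \<in> U \<and> smooth_on X X U g \<and> (\<forall>x\<in>U \<inter> unitaries. g x = x \<odot> t) \<and>
      has_fderiv X X U g p L \<and>
      L ` tangent_space X unitaries p = tangent_space X (orbit t) (p \<odot> t) \<and>
      complemented_subspace (tangent_space X unitaries p, nrm X)
        {v \<in> tangent_space X unitaries p. L v = 0}"
    unfolding TU TO
    by (intro exI[of _ "vecs X"] exI[of _ "\<lambda>G. G \<odot> t"] conjI pX(1) sm der onto compl) simp
qed

end

section \<open>Adjoints in complex Hilbert spaces\<close>

lemma cinner_add_right: "cinner x (y + z) = cinner x y + cinner x z"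
  by (metis cinner_add_left cinner_commute complex_cnj_add)

lemma cinner_scaleC_right: "cinner x (scaleC a y) = cnj a * cinner x y"
  by (metis cinner_commute cinner_scaleC_left complex_cnj_mult)

lemma cinner_scaleR_left: "cinner (r *\<^sub>R x) y = complex_of_real r * cinner x y"
  by (metis cinner_scaleC_left scaleC_of_real)

lemma cinner_scaleR_right: "cinner x (r *\<^sub>R y) = complex_of_real r * cinner x y"
  by (metis cinner_scaleC_right scaleC_of_real complex_cnj_complex_of_real)

lemma cinner_zero_left [simp]: "cinner 0 y = 0"
  using cinner_scaleR_left[of 0 0 y] by simp

lemma cinner_zero_right [simp]: "cinner x 0 = 0"
  using cinner_scaleR_right[of x 0 0] by simp

lemma cinner_minus_left: "cinner (- x) y = - cinner x y"
  using cinner_scaleR_left[of "-1" x y] by simp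

lemma cinner_minus_right: "cinner x (- y) = - cinner x y"
  using cinner_scaleR_right[of x "-1" y] by simp

lemma cinner_diff_right: "cinner x (y - z) = cinner x y - cinner x z"
  using cinner_add_right[of x y "- z"] by (simp add: cinner_minus_right)

lemma cinner_eq_zero_imp: "(\<And>x. cinner x y = 0) \<Longrightarrow> y = 0"
  using cinner_self[of y] by simp

lemma cinner_ext_right: "(\<And>x. cinner x y = cinner x z) \<Longrightarrow> y = z"
  using cinner_eq_zero_imp[of "y - z"] by (simp add: cinner_diff_right)

lemma Re_cinner_commute: "Re (cinner x y) = Re (cinner y x)"
  by (metis cinner_commute complex_cnj_cnj cnj.simps(1))

lemma norm_add_square: "(norm (x + y))\<^sup>2 = (norm x)\<^sup>2 + (norm y)\<^sup>2 + 2 * Re (cinner x y)"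
proof -
  have "complex_of_real ((norm (x + y))\<^sup>2) = cinner x x + cinner y y + (cinner x y + cinner y x)"
    unfolding cinner_self[symmetric] by (simp add: cinner_add_left cinner_add_right)
  then have "(norm (x + y))\<^sup>2 = Re (cinner x x + cinner y y + (cinner x y + cinner y x))"
    by (metis Re_complex_of_real)
  then show ?thesis using Re_cinner_commute[of y x] by (simp add: cinner_self)
qed

text \<open>The triangle inequality belongs to the normed type class, so this half of Cauchy-Schwarz
  can be read off from it.\<close>

lemma Re_cinner_le: "Re (cinner x y) \<le> norm x * norm y"
proof -
  have "(norm (x + y))\<^sup>2 \<le> (norm x + norm y)\<^sup>2"
    using norm_triangle_ineq[of x y] by (intro power_mono) auto
  then show ?thesis unfolding norm_add_square by (simp add: power2_sum)
qed

text \<open>Riesz representation: the representing vector minimizes \<open>\<parallel>x\<parallel>\<^sup>2 - 2 f x\<close>; the parallelogram law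
  makes every minimizing sequence Cauchy.\<close>

lemma riesz_real:
  fixes f :: "'a::complex_hilbert_space \<Rightarrow> real"
  assumes lin: "\<And>x y. f (x + y) = f x + f y" "\<And>r x. f (r *\<^sub>R x) = r * f x"
    and bd: "\<And>x. \<bar>f x\<bar> \<le> K * norm x"
  shows "\<exists>z. \<forall>x. Re (cinner x z) = f x"
proof -
  define J where "J x = (norm x)\<^sup>2 - 2 * f x" for x
  have Jadd: "J (x + y) = J x + (norm y)\<^sup>2 + 2 * (Re (cinner x y) - f y)" for x y
    by (simp add: J_def norm_add_square lin)
  have "- K\<^sup>2 \<le> J x" for x
  proof -
    have "0 \<le> (norm x - K)\<^sup>2" by simp
    then show ?thesis using bd[of x] by (simp add: J_def power2_diff mult.commute)
  qed
  then have below: "bdd_below (range J)" by (auto intro!: bdd_belowI)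
  define m where "m = Inf (range J)"
  have mle: "m \<le> J x" for x unfolding m_def by (intro cInf_lower below) auto
  have "\<exists>x. J x < m + 1 / real (Suc n)" for n
    using cInf_lessD[of "range J" "m + 1 / real (Suc n)"] by (auto simp: m_def)
  then obtain X where X: "\<And>n. J (X n) < m + 1 / real (Suc n)" by metis
  have para: "(norm (x - y))\<^sup>2 = 2 * J x + 2 * J y - 4 * J ((1/2) *\<^sub>R (x + y))" for x y
  proof -
    have "(norm (x - y))\<^sup>2 + (norm (x + y))\<^sup>2 = 2 * (norm x)\<^sup>2 + 2 * (norm y)\<^sup>2"
      using norm_add_square[of x y] norm_add_square[of x "- y"] by (simp add: cinner_minus_right)
    moreover have "4 * J ((1/2) *\<^sub>R (x + y)) = (norm (x + y))\<^sup>2 - 4 * f x - 4 * f y"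
    proof -
      have "J ((1/2) *\<^sub>R (x + y)) = (norm (x + y))\<^sup>2 / 4 - (f x + f y)"
        unfolding J_def lin norm_scaleR power_mult_distrib by (simp add: power2_eq_square field_simps)
      then show ?thesis by simp
    qed
    ultimately show ?thesis by (simp add: J_def)
  qed
  have close: "(norm (X i - X j))\<^sup>2 \<le> 2 / real (Suc i) + 2 / real (Suc j)" for i j
    using para[of "X i" "X j"] X[of i] X[of j] mle[of "(1/2) *\<^sub>R (X i + X j)"] by simp
  have "Cauchy X"
  proof (rule CauchyI)
    fix e :: real assume e: "e > 0"
    obtain N where N: "real N > 4 / e\<^sup>2" using reals_Archimedean2 by blast
    show "\<exists>M. \<forall>i\<ge>M. \<forall>j\<ge>M. norm (X i - X j) < e"
    proof (intro exI[of _ N] allI impI)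
      fix i j assume "N \<le> i" "N \<le> j"
      have N0: "real N > 0" using N e by (meson divide_pos_pos less_trans zero_less_numeral zero_less_power)
      have "2 / real (Suc i) \<le> 2 / real N" "2 / real (Suc j) \<le> 2 / real N"
        using \<open>N \<le> i\<close> \<open>N \<le> j\<close> N0 by (auto intro!: divide_left_mono)
      then have "(norm (X i - X j))\<^sup>2 \<le> 4 / real N" using close[of i j] by simp
      also have "\<dots> < e\<^sup>2" using N N0 e by (simp add: field_simps)
      finally show "norm (X i - X j) < e" using e by (simp add: power_less_imp_less_base)
    qed
  qed
  then obtain z where z: "X \<longlonglongrightarrow> z" using Cauchy_convergent convergent_def by blast
  have "bounded_linear f" by (rule bounded_linear_intro[where K = K]) (use lin bd in \<open>auto simp: mult.commute\<close>)
  then have "(\<lambda>n. f (X n)) \<longlonglongrightarrow> f z" using z by (rule bounded_linear.tendsto)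
  then have "(\<lambda>n. J (X n)) \<longlonglongrightarrow> J z" unfolding J_def by (intro tendsto_intros z)
  moreover have "(\<lambda>n. m + 1 / real (Suc n)) \<longlonglongrightarrow> m + 0"
    by (intro tendsto_intros LIMSEQ_Suc lim_1_over_n)
  ultimately have "J z \<le> m + 0"
    using X by (intro LIMSEQ_le) (auto intro!: exI less_imp_le)
  then have min: "J z \<le> J x" for x using mle[of x] by simp
  have "Re (cinner x z) = f x" for x
  proof -
    \<comment> \<open>Half the derivative of \<open>J\<close> at the minimiser \<open>z\<close> in
      direction \<open>x\<close>.\<close>
    define c where "c = Re (cinner z x) - f x"
    define N where "N = (norm x)\<^sup>2"
    have "N \<ge> 0" by (simp add: N_def)
    have "0 \<le> s\<^sup>2 * N + 2 * (s * c)" for s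
      using min[of "z + s *\<^sub>R x"] by (simp add: Jadd N_def c_def power_mult_distrib lin
          cinner_scaleR_right right_diff_distrib)
    note quad = this
    have "c = 0"
    proof (rule ccontr)
      assume "c \<noteq> 0"
      \<comment> \<open>At \<open>s = - c * k\<close> the negative linear term outweighs the
        quadratic one; \<open>N + 1\<close> avoids dividing by zero.\<close>
      define k where "k = 1 / (N + 1)"
      have k: "k > 0" "k * N \<le> 1" using \<open>N \<ge> 0\<close> by (simp_all add: k_def)
      have "(- c * k)\<^sup>2 * N + 2 * ((- c * k) * c) = c\<^sup>2 * k * (k * N - 2)"
        by (simp add: power2_eq_square algebra_simps)
      also have "\<dots> < 0" using k \<open>c \<noteq> 0\<close> by (intro mult_pos_neg mult_pos_pos) auto
      finally show False using quad[of "- c * k"] by simp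
    qed
    then show ?thesis using Re_cinner_commute[of z x] by (simp add: c_def)
  qed
  then show ?thesis by blast
qed

lemma bop_scaleC: "B \<in> bop \<Longrightarrow> blinfun_apply B (scaleC c x) = scaleC c (blinfun_apply B x)"
  by (simp add: bop_def)

text \<open>Riesz is applied to the real part of the form; the imaginary part follows by inserting
  \<open>scaleC (- \<i>) x\<close>, since \<open>B\<close> is complex-linear.\<close>

lemma adjoint_exists:
  assumes B: "B \<in> bop"
  shows "\<exists>C\<in>bop. \<forall>x y. cinner (blinfun_apply B x) y = cinner x (blinfun_apply C y)"
proof -
  have "\<exists>z. \<forall>x. cinner (blinfun_apply B x) y = cinner x z" for y
  proof -
    have "\<bar>Re (cinner (blinfun_apply B x) y)\<bar> \<le> (norm B * norm y) * norm x" for x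
    proof -
      have "norm (blinfun_apply B x) * norm y \<le> (norm B * norm x) * norm y"
        by (intro mult_right_mono norm_blinfun) auto
      then show ?thesis
        using Re_cinner_le[of "blinfun_apply B x" y] Re_cinner_le[of "- blinfun_apply B x" y]
        by (simp add: cinner_minus_left mult_ac)
    qed
    then obtain z where z: "\<And>x. Re (cinner x z) = Re (cinner (blinfun_apply B x) y)"
      using riesz_real[of "\<lambda>x. Re (cinner (blinfun_apply B x) y)" "norm B * norm y"]
      by (auto simp: blinfun.add_right blinfun.scaleR_right cinner_add_left cinner_scaleR_left)
    have "Im (cinner x z) = Im (cinner (blinfun_apply B x) y)" for x
      using z[of "scaleC (- \<i>) x"] B by (simp add: bop_scaleC cinner_scaleC_left)
    then show ?thesis using z by (auto intro!: exI[of _ z] complex_eqI)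
  qed
  then obtain C where C: "\<And>x y. cinner (blinfun_apply B x) y = cinner x (C y)" by metis
  have add: "C (y + z) = C y + C z" for y z
    by (rule cinner_ext_right) (simp add: C[symmetric] cinner_add_right)
  have scC: "C (scaleC c y) = scaleC c (C y)" for c y
    by (rule cinner_ext_right) (simp add: C[symmetric] cinner_scaleC_right)
  have "norm (C y) \<le> norm y * norm B" for y
  proof -
    have "(norm (C y))\<^sup>2 = Re (cinner (blinfun_apply B (C y)) y)" by (simp add: C cinner_self)
    also have "\<dots> \<le> norm (blinfun_apply B (C y)) * norm y" by (rule Re_cinner_le)
    also have "\<dots> \<le> (norm B * norm (C y)) * norm y" by (intro mult_right_mono norm_blinfun) auto
    finally have "norm (C y) * norm (C y) \<le> norm (C y) * (norm y * norm B)"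
      by (simp add: power2_eq_square mult_ac)
    then show ?thesis by (cases "norm (C y) = 0") (auto simp: mult_le_cancel_left)
  qed
  then have bl: "bounded_linear C"
    using add scC by (intro bounded_linear_intro[where K = "norm B"]) (auto simp flip: scaleC_of_real)
  have "Blinfun C \<in> bop" by (simp add: bop_def bounded_linear_Blinfun_apply[OF bl] scC)
  then show ?thesis
    by (intro bexI[of _ "Blinfun C"]) (simp_all add: bounded_linear_Blinfun_apply[OF bl] C)
qed

lemma hadj:
  assumes "B \<in> bop"
  shows "cinner (blinfun_apply B x) y = cinner x (blinfun_apply (hadj B) y)"
proof -
  let ?P = "\<lambda>C. C \<in> bop \<and> (\<forall>x y. cinner (blinfun_apply B x) y = cinner x (blinfun_apply C y))"
  obtain C where C: "?P C" using adjoint_exists[OF assms] by blast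
  have "D = C" if "?P D" for D
  proof (rule blinfun_eqI)
    show "blinfun_apply D y = blinfun_apply C y" for y
      by (rule cinner_ext_right) (metis C that)
  qed
  then have "?P (hadj B)" unfolding hadj_def using C by (intro theI[of ?P C]) blast+
  then show ?thesis by blast
qed

text \<open>Polarisation: reality of the quadratic form at \<open>x + y\<close> and at
  \<open>x + scaleC \<i> y\<close> gives the imaginary and the real part of the symmetry.\<close>

lemma positive_op_selfadjoint:
  assumes "positive_op A"
  shows "cinner (blinfun_apply A x) y = cinner x (blinfun_apply A y)"
proof -
  have A: "A \<in> bop" and re: "Im (cinner (blinfun_apply A z) z) = 0" for z
    using assms by (auto simp: positive_op_def complex_nonneg_Reals_iff)
  let ?s = "cinner (blinfun_apply A x) y" and ?r = "cinner (blinfun_apply A y) x"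
  have "Im ?s + Im ?r = 0"
    using re[of "x + y"] re[of x] re[of y]
    by (simp add: blinfun.add_right cinner_add_left cinner_add_right)
  moreover have "Re ?s = Re ?r"
    using re[of "x + scaleC \<i> y"] re[of x] re[of "scaleC \<i> y"]
    by (simp add: blinfun.add_right cinner_add_left cinner_add_right bop_scaleC[OF A]
        cinner_scaleC_left cinner_scaleC_right)
  ultimately have "?s = cnj ?r" by (simp add: complex_eq_iff)
  then show ?thesis by (metis cinner_commute)
qed

section \<open>The algebra of \<open>A\<close>-adjointable operators\<close>

lemma scaleC_zero_right [simp]: "scaleC c 0 = 0"
  using scaleC_add_right[of c 0 0] by simp

lemma scaleR_scaleC_commute: "r *\<^sub>R scaleC c x = scaleC c (r *\<^sub>R x)"
  by (metis scaleC_of_real scaleC_scaleC mult.commute)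

lemma bop_closed:
  "id_blinfun \<in> bop" "0 \<in> bop"
  "B \<in> bop \<Longrightarrow> C \<in> bop \<Longrightarrow> B + C \<in> bop"
  "B \<in> bop \<Longrightarrow> r *\<^sub>R B \<in> bop"
  "B \<in> bop \<Longrightarrow> C \<in> bop \<Longrightarrow> B o\<^sub>L C \<in> bop"
  by (simp_all add: bop_def blinfun.add_left blinfun.scaleR_left scaleC_add_right
      scaleR_scaleC_commute)

lemma blinfun_compose_assoc: "(B o\<^sub>L C) o\<^sub>L D = B o\<^sub>L (C o\<^sub>L D)"
  by (rule blinfun_eqI) simp

lemma id_blinfun_compose: "id_blinfun o\<^sub>L B = B"
  by (rule blinfun_eqI) simp

lemma compose_id_blinfun: "B o\<^sub>L id_blinfun = B"
  by (rule blinfun_eqI) simp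

text \<open>The contraction principle yields fixed points of
  \<open>\<lambda>R. id_blinfun + (B o\<^sub>L R)\<close> and of its mirror image: a right and a
  left inverse, which coincide.\<close>

lemma neumann_blinfun:
  fixes B :: "'a::banach \<Rightarrow>\<^sub>L 'a"
  assumes "norm B < 1"
  shows "\<exists>R. (id_blinfun - B) o\<^sub>L R = id_blinfun \<and> R o\<^sub>L (id_blinfun - B) = id_blinfun"
proof -
  interpret comp: bounded_bilinear "(o\<^sub>L) :: ('a \<Rightarrow>\<^sub>L 'a) \<Rightarrow> ('a \<Rightarrow>\<^sub>L 'a) \<Rightarrow> 'a \<Rightarrow>\<^sub>L 'a"
    by (rule bounded_bilinear_blinfun_compose)
  have "dist (id_blinfun + (B o\<^sub>L R)) (id_blinfun + (B o\<^sub>L S)) \<le> norm B * dist R S" for R S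
    using norm_blinfun_compose[of B "R - S"] by (simp add: dist_norm comp.diff_right)
  then obtain R where R: "id_blinfun + (B o\<^sub>L R) = R"
    using banach_fix_type[of "norm B" "\<lambda>R. id_blinfun + (B o\<^sub>L R)"] assms by auto
  have "dist (id_blinfun + (R o\<^sub>L B)) (id_blinfun + (S o\<^sub>L B)) \<le> norm B * dist R S" for R S
    using norm_blinfun_compose[of "R - S" B] by (simp add: dist_norm comp.diff_left mult.commute)
  then obtain L where L: "id_blinfun + (L o\<^sub>L B) = L"
    using banach_fix_type[of "norm B" "\<lambda>R. id_blinfun + (R o\<^sub>L B)"] assms by auto
  have 1: "(id_blinfun - B) o\<^sub>L R = id_blinfun"
    using R by (simp add: comp.diff_left id_blinfun_compose algebra_simps)
  have 2: "L o\<^sub>L (id_blinfun - B) = id_blinfun"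
    using L by (simp add: comp.diff_right compose_id_blinfun algebra_simps)
  have "L = L o\<^sub>L ((id_blinfun - B) o\<^sub>L R)" by (simp add: 1 compose_id_blinfun)
  also have "\<dots> = (L o\<^sub>L (id_blinfun - B)) o\<^sub>L R" by (simp only: blinfun_compose_assoc)
  also have "\<dots> = R" by (simp add: 2 id_blinfun_compose)
  finally show ?thesis using 1 2 by blast
qed

locale positive_injective =
  fixes A :: "'a::complex_hilbert_space \<Rightarrow>\<^sub>L 'a"
  assumes positive: "positive_op A" and injective: "blinfun_apply A x = 0 \<Longrightarrow> x = 0"
begin

lemma self_adjoint: "cinner (blinfun_apply A x) y = cinner x (blinfun_apply A y)"
  by (rule positive_op_selfadjoint[OF positive])

text \<open>Injectivity of \<open>A\<close> cancels it from the two defining identities; this is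
  what makes the description in \<open>sharp\<close> legitimate.\<close>

lemma is_A_adjoint_unique:
  assumes "is_A_adjoint A B C" "is_A_adjoint A B D"
  shows "C = D"
proof (rule blinfun_eqI)
  fix y
  have "cinner x (blinfun_apply A (blinfun_apply C y)) = cinner x (blinfun_apply A (blinfun_apply D y))" for x
    using assms by (metis is_A_adjoint_def A_inner_def self_adjoint)
  then have "blinfun_apply A (blinfun_apply C y) = blinfun_apply A (blinfun_apply D y)"
    by (rule cinner_ext_right)
  then have "blinfun_apply A (blinfun_apply C y - blinfun_apply D y) = 0" by (simp add: blinfun.diff_right)
  then show "blinfun_apply C y = blinfun_apply D y" using injective by fastforce
qed

lemma sharp_eq: "is_A_adjoint A B C \<Longrightarrow> sharp A B = C"
  unfolding sharp_def using is_A_adjoint_unique by blast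

lemma is_A_adjoint_sharp: "B \<in> A_adjointable A \<Longrightarrow> is_A_adjoint A B (sharp A B)"
  using sharp_eq unfolding A_adjointable_def by blast

lemma A_adjointableI: "B \<in> bop \<Longrightarrow> is_A_adjoint A B C \<Longrightarrow> B \<in> A_adjointable A"
  unfolding A_adjointable_def by blast

lemma A_adjointable_bop: "B \<in> A_adjointable A \<Longrightarrow> B \<in> bop"
  unfolding A_adjointable_def by blast

lemma is_A_adjoint_add:
  "is_A_adjoint A B C \<Longrightarrow> is_A_adjoint A B' C' \<Longrightarrow> is_A_adjoint A (B + B') (C + C')"
  by (simp add: is_A_adjoint_def A_inner_def bop_closed blinfun.add_left blinfun.add_right
      cinner_add_left cinner_add_right)

lemma is_A_adjoint_scaleR: "is_A_adjoint A B C \<Longrightarrow> is_A_adjoint A (r *\<^sub>R B) (r *\<^sub>R C)"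
  by (simp add: is_A_adjoint_def A_inner_def bop_closed blinfun.scaleR_left blinfun.scaleR_right
      cinner_scaleR_left cinner_scaleR_right)

lemma is_A_adjoint_zero: "is_A_adjoint A 0 0"
  by (simp add: is_A_adjoint_def A_inner_def bop_closed)

lemma is_A_adjoint_id: "is_A_adjoint A id_blinfun id_blinfun"
  by (simp add: is_A_adjoint_def A_inner_def bop_closed)

lemma is_A_adjoint_compose:
  "is_A_adjoint A B C \<Longrightarrow> is_A_adjoint A B' C' \<Longrightarrow> is_A_adjoint A (B o\<^sub>L B') (C' o\<^sub>L C)"
  by (simp add: is_A_adjoint_def A_inner_def bop_closed)

lemma is_A_adjoint_sym:
  assumes "B \<in> bop" "is_A_adjoint A B C"
  shows "is_A_adjoint A C B"
proof -
  have "A_inner A (blinfun_apply C f) g = A_inner A f (blinfun_apply B g)" for f g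
  proof -
    have "A_inner A (blinfun_apply C f) g = cnj (A_inner A g (blinfun_apply C f))"
      unfolding A_inner_def by (metis cinner_commute self_adjoint)
    also have "\<dots> = cnj (A_inner A (blinfun_apply B g) f)"
      using assms(2) by (simp add: is_A_adjoint_def)
    also have "\<dots> = A_inner A f (blinfun_apply B g)"
      unfolding A_inner_def by (metis cinner_commute self_adjoint)
    finally show ?thesis .
  qed
  then show ?thesis using assms by (simp add: is_A_adjoint_def)
qed

lemma sharp_bop: "B \<in> A_adjointable A \<Longrightarrow> sharp A B \<in> bop"
  using is_A_adjoint_sharp by (auto simp: is_A_adjoint_def)

text \<open>The equality is required also off the carrier. There neither operator has an adjoint, so
  both descriptions in \<open>sharp\<close> denote the same default value.\<close>

lemma A_norm_minus: "A_norm A (- B) = A_norm A B"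
proof (cases "\<exists>C. is_A_adjoint A B C")
  case True
  then obtain C where "is_A_adjoint A B C" by blast
  then have "sharp A B = C" "sharp A (- B) = - C"
    using sharp_eq is_A_adjoint_scaleR[of B C "-1"] by auto
  then show ?thesis by (simp add: A_norm_def)
next
  case False
  moreover from this have "\<not> is_A_adjoint A (- B) C" for C
    using is_A_adjoint_scaleR[of "- B" C "-1"] by auto
  ultimately show ?thesis by (simp add: A_norm_def sharp_def)
qed

text \<open>The maximum in \<open>A_norm\<close> makes both \<open>B\<close> and its adjoint
  \<open>C\<close> short, so \<open>id_blinfun - B\<close> and \<open>id_blinfun - C\<close> have
  inverses, and these are adjoint to each other.\<close>

lemma neumann_A_adjointable:
  assumes B: "B \<in> A_adjointable A" and n: "A_norm A B < 1"
  shows "\<exists>R\<in>A_adjointable A. (id_blinfun - B) o\<^sub>L R = id_blinfun \<and> R o\<^sub>L (id_blinfun - B) = id_blinfun"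
proof -
  interpret comp: bounded_bilinear "(o\<^sub>L) :: ('a \<Rightarrow>\<^sub>L 'a) \<Rightarrow> ('a \<Rightarrow>\<^sub>L 'a) \<Rightarrow> 'a \<Rightarrow>\<^sub>L 'a"
    by (rule bounded_bilinear_blinfun_compose)
  \<comment> \<open>The operator type only records real-linearity, so complex-linearity of an
    inverse has to be recovered.\<close>
  have inverse_bop: "R \<in> bop" if "D \<in> bop" "R o\<^sub>L D = id_blinfun" "D o\<^sub>L R = id_blinfun"
    for D R :: "'a \<Rightarrow>\<^sub>L 'a"
  proof -
    have "blinfun_apply R (scaleC c x) = scaleC c (blinfun_apply R x)" for c x
    proof -
      have "blinfun_apply D (blinfun_apply R (scaleC c x)) = blinfun_apply D (scaleC c (blinfun_apply R x))"
        using that by (metis blinfun_apply_blinfun_compose bop_scaleC blinfun_apply_id_blinfun id_apply)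
      then show ?thesis using that(2) by (metis blinfun_apply_blinfun_compose blinfun_apply_id_blinfun id_apply)
    qed
    then show ?thesis by (simp add: bop_def)
  qed
  have diff_bop: "id_blinfun - D \<in> bop" if "D \<in> bop" for D :: "'a \<Rightarrow>\<^sub>L 'a"
    using bop_closed(3)[OF bop_closed(1) bop_closed(4)[OF that, of "-1"]] by simp
  define C where "C = sharp A B"
  have adj: "is_A_adjoint A B C" using is_A_adjoint_sharp[OF B] by (simp add: C_def)
  then have adj': "is_A_adjoint A (id_blinfun - B) (id_blinfun - C)"
    using is_A_adjoint_add[OF is_A_adjoint_id is_A_adjoint_scaleR[OF adj, of "-1"]] by simp
  have "norm B < 1" "norm C < 1" using n by (simp_all add: A_norm_def C_def)
  then obtain R S where R: "(id_blinfun - B) o\<^sub>L R = id_blinfun" "R o\<^sub>L (id_blinfun - B) = id_blinfun"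
    and S: "(id_blinfun - C) o\<^sub>L S = id_blinfun" "S o\<^sub>L (id_blinfun - C) = id_blinfun"
    using neumann_blinfun by metis
  have bop: "R \<in> bop" "S \<in> bop"
    using inverse_bop[OF diff_bop R(2,1)] inverse_bop[OF diff_bop S(2,1)]
      A_adjointable_bop[OF B] sharp_bop[OF B] by (simp_all add: C_def)
  have "A_inner A (blinfun_apply R f) g = A_inner A f (blinfun_apply S g)" for f g
  proof -
    have "A_inner A (blinfun_apply R f) g
      = A_inner A (blinfun_apply R f) (blinfun_apply (id_blinfun - C) (blinfun_apply S g))"
      by (simp add: S flip: blinfun_apply_blinfun_compose)
    also have "\<dots> = A_inner A (blinfun_apply (id_blinfun - B) (blinfun_apply R f)) (blinfun_apply S g)"
      using adj' by (simp add: is_A_adjoint_def)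
    also have "\<dots> = A_inner A f (blinfun_apply S g)"
      by (simp add: R flip: blinfun_apply_blinfun_compose)
    finally show ?thesis .
  qed
  then have "R \<in> A_adjointable A" using bop by (intro A_adjointableI[of R S]) (auto simp: is_A_adjoint_def)
  then show ?thesis using R by blast
qed

lemma star_algebra_BA: "star_algebra (BA A) (o\<^sub>L) id_blinfun (sharp A)"
proof -
  interpret comp: bounded_bilinear "(o\<^sub>L) :: ('a \<Rightarrow>\<^sub>L 'a) \<Rightarrow> ('a \<Rightarrow>\<^sub>L 'a) \<Rightarrow> 'a \<Rightarrow>\<^sub>L 'a"
    by (rule bounded_bilinear_blinfun_compose)
  note adj = is_A_adjoint_sharp
  note sharp_add = sharp_eq[OF is_A_adjoint_add[OF adj adj]]
  note sharp_scaleR = sharp_eq[OF is_A_adjoint_scaleR[OF adj]]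
  note sharp_compose = sharp_eq[OF is_A_adjoint_compose[OF adj adj]]
  note sharp_sharp = sharp_eq[OF is_A_adjoint_sym[OF A_adjointable_bop adj]]
  note cl = A_adjointableI[OF bop_closed(1) is_A_adjoint_id]
    A_adjointableI[OF bop_closed(2) is_A_adjoint_zero]
    A_adjointableI[OF bop_closed(3)[OF A_adjointable_bop A_adjointable_bop] is_A_adjoint_add[OF adj adj]]
    A_adjointableI[OF bop_closed(4)[OF A_adjointable_bop] is_A_adjoint_scaleR[OF adj]]
    A_adjointableI[OF bop_closed(5)[OF A_adjointable_bop A_adjointable_bop] is_A_adjoint_compose[OF adj adj]]
    A_adjointableI[OF sharp_bop is_A_adjoint_sym[OF A_adjointable_bop adj]]
  have mult_max: "a * b \<le> max a c * max b d" "c * d \<le> max a c * max b d"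
    if "0 \<le> a" "0 \<le> b" "0 \<le> c" "0 \<le> d" for a b c d :: real
    using that by (auto intro!: mult_mono simp: le_max_iff_disj)
  show ?thesis
  proof (unfold_locales, goal_cases)
    case (1 B)
    then show ?case by (simp add: BA_def A_norm_def le_max_iff_disj)
  next
    case (2 B)
    then show ?case by (simp add: BA_def A_norm_minus)
  next
    case 3
    then show ?case unfolding subspace_def BA_def fst_conv using cl by blast
  next
    case (4 B C)
    then show ?case
      using norm_triangle_ineq[of B C] norm_triangle_ineq[of "sharp A B" "sharp A C"]
      by (auto simp: BA_def A_norm_def sharp_add)
  next
    case (5 B c)
    then show ?case by (simp add: BA_def A_norm_def sharp_scaleR max_mult_distrib_left)
  next
    case (6 B)
    then have "norm B \<le> 0" by (simp add: BA_def A_norm_def max_def split: if_splits)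
    then show ?case by simp
  next
    case (7 a b c)
    then show ?case by (rule blinfun_compose_assoc)
  next
    case (8 a b c)
    then show ?case by (rule comp.add_left)
  next
    case (9 a b c)
    then show ?case by (rule comp.add_right)
  next
    case (10 s a b)
    then show ?case by (rule comp.scaleR_left)
  next
    case (11 a s b)
    then show ?case by (rule comp.scaleR_right)
  next
    case (12 a)
    then show ?case by (rule id_blinfun_compose)
  next
    case (13 a)
    then show ?case by (rule compose_id_blinfun)
  next
    case 14
    then show ?case by (simp add: BA_def cl(1))
  next
    case (15 a b)
    then show ?case by (simp add: BA_def cl(5))
  next
    case (16 a)
    then show ?case by (simp add: BA_def cl(6))
  next
    case (17 a b)
    then show ?case by (simp add: BA_def sharp_add)
  next
    case (18 a s)
    then show ?case by (simp add: BA_def sharp_scaleR)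
  next
    case (19 a b)
    then show ?case by (simp add: BA_def sharp_compose)
  next
    case (20 a)
    then show ?case by (simp add: BA_def sharp_sharp)
  next
    case (21 B C)
    let ?m = "max (norm B) (norm (sharp A B)) * max (norm C) (norm (sharp A C))"
    have "norm (B o\<^sub>L C) \<le> norm B * norm C" by (rule norm_blinfun_compose)
    also have "\<dots> \<le> ?m" by (intro mult_max) auto
    finally have 1: "norm (B o\<^sub>L C) \<le> ?m" .
    have "norm (sharp A C o\<^sub>L sharp A B) \<le> norm (sharp A C) * norm (sharp A B)"
      by (rule norm_blinfun_compose)
    also have "\<dots> = norm (sharp A B) * norm (sharp A C)" by (rule mult.commute)
    also have "\<dots> \<le> ?m" by (intro mult_max) auto
    finally show ?case using 1 21 by (simp add: BA_def A_norm_def sharp_compose)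
  next
    case (22 B)
    then show ?case by (simp add: BA_def A_norm_def sharp_sharp max.commute)
  next
    case (23 B)
    then show ?case using neumann_A_adjointable[of B] by (simp add: BA_def)
  qed
qed

sublocale star_algebra "BA A" "(o\<^sub>L)" id_blinfun "sharp A"
  by (rule star_algebra_BA)

section \<open>The concrete isometries, unitaries and orbits as instances of the abstract
  ones\<close>

lemma vecs_BA: "vecs (BA A) = A_adjointable A"
  by (simp add: BA_def)

lemma A_isometry_iff:
  assumes "T \<in> bop"
  shows "hadj T o\<^sub>L A o\<^sub>L T = A \<longleftrightarrow> (\<forall>f g. A_inner A (blinfun_apply T f) (blinfun_apply T g) = A_inner A f g)"
proof -
  have eq: "cinner x (blinfun_apply (hadj T o\<^sub>L A o\<^sub>L T) y) = A_inner A (blinfun_apply T x) (blinfun_apply T y)" for x y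
    by (simp add: hadj[OF assms, symmetric] A_inner_def self_adjoint)
  have "hadj T o\<^sub>L A o\<^sub>L T = A \<longleftrightarrow>
      (\<forall>x y. cinner x (blinfun_apply (hadj T o\<^sub>L A o\<^sub>L T) y) = cinner x (blinfun_apply A y))"
    using blinfun_eqI cinner_ext_right by metis
  then show ?thesis unfolding eq by (simp add: A_inner_def self_adjoint)
qed

text \<open>Preserving the \<open>A\<close>-inner product means that
  \<open>sharp A T o\<^sub>L T\<close> is an adjoint of the identity, hence equals it by
  uniqueness.\<close>

lemma isometries_BA: "adjointable_A_isometries A = isometries"
proof -
  have "hadj T o\<^sub>L A o\<^sub>L T = A \<longleftrightarrow> sharp A T o\<^sub>L T = id_blinfun" if T: "T \<in> A_adjointable A" for T
  proof -
    note adj = is_A_adjoint_sharp[OF T]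
    have "A_inner A (blinfun_apply T f) (blinfun_apply T g) = A_inner A f (blinfun_apply (sharp A T o\<^sub>L T) g)" for f g
      using adj by (simp add: is_A_adjoint_def)
    then have "hadj T o\<^sub>L A o\<^sub>L T = A \<longleftrightarrow> is_A_adjoint A id_blinfun (sharp A T o\<^sub>L T)"
      using A_isometry_iff[OF A_adjointable_bop[OF T]] sharp_bop[OF T] A_adjointable_bop[OF T]
      by (auto simp: is_A_adjoint_def bop_closed)
    also have "\<dots> \<longleftrightarrow> sharp A T o\<^sub>L T = id_blinfun"
      using is_A_adjoint_unique is_A_adjoint_id by metis
    finally show ?thesis .
  qed
  then show ?thesis by (auto simp: adjointable_A_isometries_def isometries_def vecs_BA)
qed

text \<open>The inverse \<open>K\<close> is itself the adjoint: write \<open>g\<close> as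
  \<open>G\<close> applied to \<open>K g\<close> and use that \<open>G\<close> preserves the
  \<open>A\<close>-inner product.\<close>

lemma unitaries_BA: "A_unitaries A = unitaries"
proof
  show "A_unitaries A \<subseteq> unitaries"
  proof
    fix G assume "G \<in> A_unitaries A"
    then obtain K where G: "G \<in> bop" "hadj G o\<^sub>L A o\<^sub>L G = A" and K: "K \<in> bop"
      "G o\<^sub>L K = id_blinfun" "K o\<^sub>L G = id_blinfun"
      by (auto simp: A_unitaries_def)
    have "A_inner A (blinfun_apply G f) g = A_inner A f (blinfun_apply K g)" for f g
    proof -
      have "A_inner A (blinfun_apply G f) g = A_inner A (blinfun_apply G f) (blinfun_apply G (blinfun_apply K g))"
        by (simp add: K flip: blinfun_apply_blinfun_compose)
      then show ?thesis using A_isometry_iff[OF G(1)] G(2) by simp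
    qed
    then have "is_A_adjoint A G K" using K by (simp add: is_A_adjoint_def)
    then show "G \<in> unitaries"
      using A_adjointableI[OF G(1)] sharp_eq K by (auto simp: unitaries_def vecs_BA)
  qed
  show "unitaries \<subseteq> A_unitaries A"
  proof
    fix G assume G: "G \<in> unitaries"
    then have adj: "G \<in> A_adjointable A" and inv: "sharp A G o\<^sub>L G = id_blinfun" "G o\<^sub>L sharp A G = id_blinfun"
      by (auto simp: unitaries_def vecs_BA)
    have "G \<in> adjointable_A_isometries A"
      unfolding isometries_BA using G by (simp add: isometries_def unitaries_def)
    then show "G \<in> A_unitaries A"
      using inv sharp_bop[OF adj] A_adjointable_bop[OF adj]
      by (auto simp: A_unitaries_def adjointable_A_isometries_def)
  qed
qed

lemma orbit_BA: "A_orbit A T = orbit T"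
  by (simp add: A_orbit_def orbit_def unitaries_BA)

end

theorem theorem4p3:
  fixes A T\<^sub>0 :: "'a::complex_hilbert_space \<Rightarrow>\<^sub>L 'a"
  assumes "positive_op A"
    and "norm A \<le> 1"
    and "\<And>x. blinfun_apply A x = 0 \<Longrightarrow> x = 0"
    and "T\<^sub>0 \<in> adjointable_A_isometries A"
  shows "complemented_submanifold (BA A) (A_orbit A T\<^sub>0) \<and>
    smooth_submersion (BA A) (A_unitaries A) (BA A) (A_orbit A T\<^sub>0) (\<lambda>G. G o\<^sub>L T\<^sub>0) \<and>
    (\<exists>\<C> \<subseteq> connected_components_of (subtopology (ntop (BA A)) (adjointable_A_isometries A)).
       A_orbit A T\<^sub>0 = \<Union>\<C>) \<and>
    complemented_submanifold (BA A) (adjointable_A_isometries A)"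
proof -
  interpret positive_injective A
    using assms by unfold_locales
  have T: "T\<^sub>0 \<in> isometries" using assms(4) by (simp add: isometries_BA)
  show ?thesis
    unfolding isometries_BA unitaries_BA orbit_BA
    by (intro conjI complemented_submanifold_saturated saturated_orbit saturated_isometries
        smooth_submersion_orbit orbit_Union_components T)
qed

end
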